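(* Let $G$ be a simple graph. Then $$\hat{\pi}_3(G)=\begin{cases}1-\frac{1}{\chi(G)-1} & \text{if } \chi(G)\ge 4,\\ 0 & \text{if } G \text{ satisfies conditions (1) and (2) below},\\ \frac12 & \text{otherwise,}\end{cases}$$ where (1): $G$ is triangle-free and there is a vertex $v$ with $G-v$ bipartite; (2): there exists a bipartite subgraph $B\subseteq G$ with bipartition $(U_1,U_2)$ of $V(G)$ such that $E(G)\setminus E(B)$ is a (possibly empty) matching all of whose edges lie inside one and the same part $U_i$.
   Context: A 3-graph is a hypergraph all of whose edges have exactly 3 vertices. The shadow $\partial(\mathcal{H})$ of a hypergraph $\mathcal{H}$ is the simple graph on $V(\mathcal{H})$ in which $uv$ is an edge iff $\{u,v\}\subseteq h$ for some edge $h$ of $\mathcal{H}$. For a simple graph $G$, a hypergraph $\mathcal{H}$ is a Berge-$G$ if there is an injection $i:V(G)\to V(\mathcal{H})$ and a bijection $f:E(G)\to E(\mathcal{H})$ with $\{i(u),i(v)\}\subseteq f(uv)$ for every $uv\in E(G)$; $\mathcal{H}$ is Berge-$G$-free if no subhypergraph of it is a Berge-$G$. $\hat{\mathrm{ex}}_3(n,G)$ is the maximum number of edges of $\partial(\mathcal{H})$ over all Berge-$G$-free 3-graphs $\mathcal{H}$ on $n$ vertices, and $\hat{\pi}_3(G)=\limsup_{n\to\infty}\hat{\mathrm{ex}}_3(n,G)/\binom{n}{2}$. $\chi(G)$ is the chromatic number. *)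

theory Defs
  imports Complex_Main "HOL-Library.Extended_Real"
begin

type_synonym 'a hypergraph = "'a set \<times> 'a set set"

definition verts :: "'a hypergraph \<Rightarrow> 'a set" where
  "verts H = fst H"

definition edges :: "'a hypergraph \<Rightarrow> 'a set set" where
  "edges H = snd H"

definition hypergraph :: "'a hypergraph \<Rightarrow> bool" where
  "hypergraph H \<longleftrightarrow> finite (verts H) \<and> edges H \<subseteq> Pow (verts H)"

definition uniform :: "nat \<Rightarrow> 'a hypergraph \<Rightarrow> bool" where
  "uniform r H \<longleftrightarrow> hypergraph H \<and> (\<forall>h\<in>edges H. card h = r)"

definition simple_graph :: "'a hypergraph \<Rightarrow> bool" where
  "simple_graph G \<longleftrightarrow> uniform 2 G"

definition subhypergraph :: "'a hypergraph \<Rightarrow> 'a hypergraph \<Rightarrow> bool" where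
  "subhypergraph H' H \<longleftrightarrow> hypergraph H' \<and> verts H' \<subseteq> verts H \<and> edges H' \<subseteq> edges H"

definition shadow :: "'a hypergraph \<Rightarrow> 'a hypergraph" where
  "shadow H = (verts H, {{u, v} |u v. u \<noteq> v \<and> (\<exists>h\<in>edges H. {u, v} \<subseteq> h)})"

definition berge :: "'a hypergraph \<Rightarrow> 'b hypergraph \<Rightarrow> bool" where
  "berge G H \<longleftrightarrow> (\<exists>i f. inj_on i (verts G) \<and> i ` verts G \<subseteq> verts H \<and>
     bij_betw f (edges G) (edges H) \<and>
     (\<forall>u v. {u, v} \<in> edges G \<longrightarrow> {i u, i v} \<subseteq> f {u, v}))"

definition berge_free :: "'a hypergraph \<Rightarrow> 'b hypergraph \<Rightarrow> bool" where
  "berge_free G H \<longleftrightarrow> \<not> (\<exists>H'. subhypergraph H' H \<and> berge G H')"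

text \<open>Hypergraphs on \<open>n\<close> vertices are taken up to isomorphism, with natural numbers as vertices.
  The set below is finite, so its supremum is its maximum if it is nonempty. It is empty
  only if \<open>G\<close> has no edge and at most \<open>n\<close> vertices; the supremum is then \<open>0\<close>.\<close>

definition ex_hat :: "nat \<Rightarrow> nat \<Rightarrow> 'a hypergraph \<Rightarrow> nat" where
  "ex_hat r n G = Sup {card (edges (shadow H)) |H :: nat hypergraph.
     uniform r H \<and> card (verts H) = n \<and> berge_free G H}"

definition pi_hat :: "nat \<Rightarrow> 'a hypergraph \<Rightarrow> ereal" where
  "pi_hat r G = limsup (\<lambda>n. ereal (real (ex_hat r n G) / real (n choose 2)))"

definition proper_coloring :: "'a hypergraph \<Rightarrow> nat \<Rightarrow> ('a \<Rightarrow> nat) \<Rightarrow> bool" where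
  "proper_coloring G k c \<longleftrightarrow>
     c ` verts G \<subseteq> {..<k} \<and> (\<forall>u v. {u, v} \<in> edges G \<longrightarrow> c u \<noteq> c v)"

definition chromatic_number :: "'a hypergraph \<Rightarrow> nat" where
  "chromatic_number G = (LEAST k. \<exists>c. proper_coloring G k c)"

definition triangle_free :: "'a hypergraph \<Rightarrow> bool" where
  "triangle_free G \<longleftrightarrow>
     \<not> (\<exists>x y z. {x, y} \<in> edges G \<and> {y, z} \<in> edges G \<and> {x, z} \<in> edges G)"

definition delete_vertex :: "'a hypergraph \<Rightarrow> 'a \<Rightarrow> 'a hypergraph" where
  "delete_vertex G v = (verts G - {v}, {e \<in> edges G. v \<notin> e})"

text \<open>The parts of a bipartition may be empty.\<close>

definition bipartition :: "'a hypergraph \<Rightarrow> 'a set \<Rightarrow> 'a set \<Rightarrow> bool" where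
  "bipartition G U1 U2 \<longleftrightarrow> U1 \<union> U2 = verts G \<and> U1 \<inter> U2 = {} \<and>
     (\<forall>e\<in>edges G. \<exists>u\<in>U1. \<exists>v\<in>U2. e = {u, v})"

definition bipartite :: "'a hypergraph \<Rightarrow> bool" where
  "bipartite G \<longleftrightarrow> (\<exists>U1 U2. bipartition G U1 U2)"

definition matching :: "'a set set \<Rightarrow> bool" where
  "matching M \<longleftrightarrow> pairwise disjnt M"

definition condition1 :: "'a hypergraph \<Rightarrow> bool" where
  "condition1 G \<longleftrightarrow> triangle_free G \<and> (\<exists>v\<in>verts G. bipartite (delete_vertex G v))"

definition condition2 :: "'a hypergraph \<Rightarrow> bool" where
  "condition2 G \<longleftrightarrow> (\<exists>B U1 U2. subhypergraph B G \<and> verts B = verts G \<and> bipartition B U1 U2 \<and>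
     matching (edges G - edges B) \<and>
     (edges G - edges B \<subseteq> Pow U1 \<or> edges G - edges B \<subseteq> Pow U2))"

end

theory Submission
  imports Defs "HOL-Library.FuncSet"
begin

text \<open>
  Lower bounds. The complete \<open>(\<chi>(G) - 1)\<close>-partite 3-graph has a \<open>(\<chi>(G) - 1)\<close>-colourable shadow.
  For density \<open>1/2\<close>, take two large parts \<open>A, B\<close> and either all triples \<open>{w, a, b}\<close> through one extra
  vertex \<open>w\<close>, or all triples \<open>{a, a', b}\<close> where \<open>{a, a'}\<close> runs over a perfect matching of \<open>A\<close>. A Berge
  copy in the first makes \<open>G\<close> bipartite after deleting a vertex. A Berge copy in the second gives
  condition (2) and excludes triangles, because the pairs \<open>ab\<close> and \<open>a'b\<close> lie in a single triple.

  Upper bounds. By the Erdos-Stone theorem a dense shadow contains a large complete multipartite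
  graph. Each of its edges lies in a triple, and a random choice of vertices avoids all third
  vertices of the triples used, which makes these triples distinct.

  In the remaining case \<open>G\<close> satisfies (1) and (2). Colouring the vertices of a 3-graph with dense
  shadow at random by three colours yields a dense bipartite graph \<open>F\<close> between \<open>X\<close> and \<open>Y\<close> and a map
  \<open>\<zeta> : F \<rightarrow> Z\<close> such that \<open>{x, y, \<zeta> x y}\<close> is always a triple. Pass to a pair \<open>(A, B)\<close> in which \<open>F\<close> is
  one-sidedly regular. If a positive proportion of the edges \<open>xy\<close> have linear codegree at \<open>x, \<zeta> x y\<close>
  (or at \<open>y, \<zeta> x y\<close>), then Kovari-Sos-Turan produces a large piece of one of the two
  constructions of density \<open>1/2\<close>, and \<open>G\<close> embeds into both. Otherwise some \<open>z\<close> has a large matching in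
  its link inside \<open>A \<times> B\<close>. Send the vertex \<open>v\<close> with \<open>G - v\<close> bipartite to \<open>z\<close> and its neighbours to matching
  vertices. Triangle-freeness means that no edge is needed between two neighbours of \<open>v\<close>, and
  regularity provides the rest of \<open>G - v\<close> in the common neighbourhoods.
\<close>

section \<open>Berge copies and the shadow density\<close>

lemma simple_graphD:
  assumes "simple_graph G"
  shows "finite (verts G)" "finite (edges G)" "\<And>e. e \<in> edges G \<Longrightarrow> e \<subseteq> verts G"
    "\<And>e. e \<in> edges G \<Longrightarrow> card e = 2"
proof -
  show "finite (verts G)" "\<And>e. e \<in> edges G \<Longrightarrow> e \<subseteq> verts G" "\<And>e. e \<in> edges G \<Longrightarrow> card e = 2"
    using assms unfolding simple_graph_def uniform_def hypergraph_def by auto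
  then show "finite (edges G)" by (meson PowI finite_Pow_iff finite_subset subsetI)
qed

lemma simple_graph_edgeE:
  assumes "simple_graph G" "e \<in> edges G"
  obtains u v where "e = {u, v}" "u \<noteq> v" "u \<in> verts G" "v \<in> verts G"
  using simple_graphD(3,4)[OF assms(1), of e] assms(2) by (auto simp: card_2_iff)

lemma simple_graph_edge_neq:
  assumes "simple_graph G" "{u, v} \<in> edges G"
  shows "u \<noteq> v" "u \<in> verts G" "v \<in> verts G"
  using simple_graphD(3,4)[OF assms(1) assms(2)] by auto

text \<open>The relation \<open>P e h\<close> records how the hyperedge \<open>h\<close> is selected
  for \<open>e\<close>. Since \<open>h\<close> determines \<open>e\<close> through \<open>P\<close>,
  every choice function is automatically injective, and its image is the edge set of a Berge copy.
  Applications need not define \<open>f\<close> explicitly.\<close>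

lemma not_berge_freeI:
  fixes H :: "'b hypergraph"
  assumes "hypergraph H" "inj_on i (verts G)" "i ` verts G \<subseteq> verts H"
    and ex: "\<And>e. e \<in> edges G \<Longrightarrow> \<exists>h\<in>edges H. i ` e \<subseteq> h \<and> P e h"
    and inj: "\<And>e e' h. \<lbrakk>e \<in> edges G; e' \<in> edges G; P e h; P e' h\<rbrakk> \<Longrightarrow> e = e'"
  shows "\<not> berge_free G H"
proof -
  obtain f where f: "\<And>e. e \<in> edges G \<Longrightarrow> f e \<in> edges H \<and> i ` e \<subseteq> f e \<and> P e (f e)"
    using ex by metis
  have inj_f: "inj_on f (edges G)"
    by (rule inj_onI) (metis f inj)
  let ?H = "(verts H, f ` edges G)"
  have "subhypergraph ?H H"
    using f assms(1) unfolding subhypergraph_def hypergraph_def verts_def edges_def by auto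
  moreover have "berge G ?H"
    unfolding berge_def
    by (rule exI[of _ i], rule exI[of _ f])
      (use f assms(2,3) inj_f in \<open>auto simp: verts_def edges_def bij_betw_def\<close>)
  ultimately show ?thesis unfolding berge_free_def by blast
qed

text \<open>The converse interface: a Berge copy in a subhypergraph becomes an injection
  \<open>f\<close> into the edges of \<open>H\<close> itself, with containment phrased through
  images of edges.\<close>

lemma berge_freeI:
  assumes "simple_graph G"
    and "\<And>i f. \<lbrakk>inj_on i (verts G); i ` verts G \<subseteq> verts H; inj_on f (edges G);
      \<And>e. e \<in> edges G \<Longrightarrow> f e \<in> edges H \<and> i ` e \<subseteq> f e\<rbrakk> \<Longrightarrow> False"
  shows "berge_free G H"
proof -
  have False if H': "subhypergraph H' H" and b: "berge G H'" for H'
  proof -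
    obtain i f where "inj_on i (verts G)" "i ` verts G \<subseteq> verts H'"
      "bij_betw f (edges G) (edges H')" and *: "\<forall>u v. {u, v} \<in> edges G \<longrightarrow> {i u, i v} \<subseteq> f {u, v}"
      using b unfolding berge_def by blast
    note if' = this
    have sub: "verts H' \<subseteq> verts H" "edges H' \<subseteq> edges H" using H' unfolding subhypergraph_def by auto
    show False
    proof (rule assms(2)[of i f])
      show "inj_on i (verts G)" "i ` verts G \<subseteq> verts H" "inj_on f (edges G)"
        using if' sub(1) by (auto simp: bij_betw_def)
      show "f e \<in> edges H \<and> i ` e \<subseteq> f e" if e: "e \<in> edges G" for e
      proof -
        obtain u v where "e = {u, v}" using simple_graph_edgeE[OF assms(1) e] by blast
        moreover have "f e \<in> edges H'" using if'(3) e by (auto simp: bij_betw_def)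
        ultimately show ?thesis using * e sub(2) by auto
      qed
    qed
  qed
  then show ?thesis unfolding berge_free_def by blast
qed

lemma uniform_finite_shadow:
  assumes "uniform r H"
  shows "finite (edges (shadow H))" "\<And>e. e \<in> edges (shadow H) \<Longrightarrow> e \<subseteq> verts H \<and> card e = 2"
proof -
  have *: "edges (shadow H) \<subseteq> Pow (verts H)" 
    using assms unfolding shadow_def uniform_def hypergraph_def edges_def by force
  have fin: "finite (verts H)" using assms unfolding uniform_def hypergraph_def by auto
  show "finite (edges (shadow H))" using * fin by (meson finite_Pow_iff finite_subset)
  show "e \<subseteq> verts H \<and> card e = 2" if "e \<in> edges (shadow H)" for e
    using * that by (auto simp: shadow_def edges_def)
qed

lemma mem_shadow_iff:
  "{u, v} \<in> edges (shadow H) \<longleftrightarrow> u \<noteq> v \<and> (\<exists>h\<in>edges H. {u, v} \<subseteq> h)"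
  unfolding shadow_def edges_def by (auto simp: doubleton_eq_iff)

lemma card_shadow_le_ex_hat:
  fixes H :: "nat hypergraph"
  assumes "uniform r H" "card (verts H) = n" "berge_free G H"
  shows "card (edges (shadow H)) \<le> ex_hat r n G"
proof -
  have "card (edges (shadow H')) \<le> 2 ^ n" if "uniform r H'" "card (verts H') = n"
    for H' :: "nat hypergraph"
  proof -
    have fin: "finite (verts H')" using that(1) unfolding uniform_def hypergraph_def by auto
    have "card (edges (shadow H')) \<le> card (Pow (verts H'))"
      using uniform_finite_shadow[OF that(1)] fin by (intro card_mono) auto
    then show ?thesis using that(2) by (simp add: card_Pow[OF fin])
  qed
  then have "bdd_above {card (edges (shadow H)) |H :: nat hypergraph.
     uniform r H \<and> card (verts H) = n \<and> berge_free G H}"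
    by (intro bdd_aboveI[of _ "2 ^ n"]) blast
  then show ?thesis
    unfolding ex_hat_def using assms by (intro cSup_upper) blast
qed

text \<open>A limsup is bounded below by what happens for infinitely many \<open>n\<close>, so
  constructions are needed for suitable orders only. The bound 2 on the order keeps the binomial
  coefficient positive.\<close>

lemma pi_hat_ge:
  assumes "\<And>N. \<exists>H :: nat hypergraph. uniform r H \<and> card (verts H) \<ge> max N 2 \<and> berge_free G H \<and>
    c * real (card (verts H) choose 2) \<le> real (card (edges (shadow H)))"
  shows "ereal c \<le> pi_hat r G"
proof -
  let ?u = "\<lambda>n. ereal (real (ex_hat r n G) / real (n choose 2))"
  have "\<exists>n\<ge>N. ereal c \<le> ?u n" for N
  proof -
    obtain H :: "nat hypergraph" where H: "uniform r H" "card (verts H) \<ge> max N 2" "berge_free G H"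
      "c * real (card (verts H) choose 2) \<le> real (card (edges (shadow H)))"
      using assms by blast
    define n where "n = card (verts H)"
    have pos: "real (n choose 2) > 0" using H(2) unfolding n_def by auto
    have "c * real (n choose 2) \<le> real (ex_hat r n G)"
      using card_shadow_le_ex_hat[OF H(1) _ H(3)] H(4) unfolding n_def
      by (smt (verit) of_nat_mono)
    then have "c \<le> real (ex_hat r n G) / real (n choose 2)"
      using pos by (simp add: pos_le_divide_eq)
    then show ?thesis using H(2) n_def by (intro exI[of _ n]) auto
  qed
  then show ?thesis
    unfolding pi_hat_def limsup_INF_SUP
    by (intro INF_greatest) (meson SUP_upper2 atLeast_iff)
qed

lemma pi_hat_le:
  assumes "c \<ge> 0"
   and "\<And>\<epsilon>. \<epsilon> > 0 \<Longrightarrow> \<exists>N. \<forall>H :: nat hypergraph. uniform r H \<and> card (verts H) \<ge> N \<and> berge_free G H \<longrightarrow>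
    real (card (edges (shadow H))) \<le> (c + \<epsilon>) * real (card (verts H) choose 2)"
  shows "pi_hat r G \<le> ereal c"
proof (rule ereal_le_epsilon2)
  fix \<epsilon> :: real assume \<epsilon>: "\<epsilon> > 0"
  obtain N where N: "\<And>H :: nat hypergraph. \<lbrakk>uniform r H; card (verts H) \<ge> N; berge_free G H\<rbrakk> \<Longrightarrow>
    real (card (edges (shadow H))) \<le> (c + \<epsilon>) * real (card (verts H) choose 2)"
    using assms(2)[OF \<epsilon>] by blast
  have "ereal (real (ex_hat r n G) / real (n choose 2)) \<le> ereal (c + \<epsilon>)" if n: "n \<ge> max N 2" for n
  proof -
    let ?S = "{card (edges (shadow H)) |H :: nat hypergraph.
     uniform r H \<and> card (verts H) = n \<and> berge_free G H}"
    have *: "real s \<le> (c + \<epsilon>) * real (n choose 2)" if "s \<in> ?S" for s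
      using that N n by auto
    have "real (Sup ?S) \<le> (c + \<epsilon>) * real (n choose 2)"
    proof (cases "?S = {}")
      case True
      \<comment> \<open>With no admissible \<open>H\<close> the supremum is 0, which
        \<open>c \<ge> 0\<close> covers.\<close>
      then show ?thesis using assms(1) \<epsilon> by (simp only: Sup_nat_empty) simp
    next
      case False
      \<comment> \<open>Every element obeys the bound, so the set is a finite nonempty set of
        naturals and its supremum is one of its elements.\<close>
      have "bdd_above ?S"
        by (rule bdd_aboveI[of _ "nat \<lfloor>(c + \<epsilon>) * real (n choose 2)\<rfloor>"])
          (use * in \<open>simp add: le_nat_floor\<close>)
      then have "finite ?S" by (simp only: bdd_above_nat)
      then have "Sup ?S \<in> ?S" using False by (simp only: Sup_nat_def if_False) (rule Max_in)
      then show ?thesis using * by blast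
    qed
    moreover have "real (n choose 2) > 0" using n by auto
    ultimately show ?thesis by (simp add: ex_hat_def pos_divide_le_eq)
  qed
  then show "pi_hat r G \<le> ereal c + ereal \<epsilon>"
    unfolding pi_hat_def
    by (intro Limsup_bounded) (auto simp: eventually_sequentially intro!: exI[of _ "max N 2"])
qed

lemma pi_hat_nonneg: "0 \<le> pi_hat r G"
  unfolding pi_hat_def
  by (rule le_Limsup) auto

lemma card_ordered_pairs:
  assumes "finite E" "\<And>e. e \<in> E \<Longrightarrow> card e = 2"
  shows "card {(u, v). {u, v} \<in> E} = 2 * card E"
proof -
  have eq: "{(u, v). {u, v} \<in> E} = (\<Union>e\<in>E. {(u, v). {u, v} = e})" by auto
  have c: "card {(u, v). {u, v} = e} = 2 \<and> finite {(u, v). {u, v} = e}" if "e \<in> E" for e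
  proof -
    obtain a b where ab: "e = {a, b}" "a \<noteq> b" using assms(2) \<open>e \<in> E\<close> by (metis card_2_iff)
    then have "{(u, v). {u, v} = e} = {(a, b), (b, a)}" by (auto simp: doubleton_eq_iff)
    then show ?thesis using ab by auto
  qed
  have "card (\<Union>e\<in>E. {(u, v). {u, v} = e}) = (\<Sum>e\<in>E. card {(u, v). {u, v} = e})"
    using assms(1) c by (intro card_UN_disjoint) auto
  also have "\<dots> = 2 * card E" using c by simp
  finally show ?thesis using eq by simp
qed

section \<open>Colourings and the chromatic number\<close>

lemma ex_coloring:
  assumes "simple_graph G"
  shows "\<exists>c. proper_coloring G (chromatic_number G) c"
proof -
  obtain f :: "'a \<Rightarrow> nat" where f: "inj_on f (verts G)" "f ` verts G = {..<card (verts G)}"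
    using simple_graphD(1)[OF assms] ex_bij_betw_finite_nat[of "verts G"]
    by (metis atLeast0LessThan bij_betw_def)
  have "proper_coloring G (card (verts G)) f"
    unfolding proper_coloring_def
    using f simple_graph_edge_neq[OF assms] by (metis inj_on_def order_refl)
  then have "\<exists>c. proper_coloring G (card (verts G)) c" by blast
  then show ?thesis unfolding chromatic_number_def by (rule LeastI)
qed

lemma ex_coloring_mono:
  assumes "simple_graph G" "chromatic_number G \<le> k"
  shows "\<exists>c. proper_coloring G k c"
  using ex_coloring[OF assms(1)] assms(2) unfolding proper_coloring_def
  by (meson lessThan_subset_iff subset_trans)

lemma no_coloring:
  assumes "k < chromatic_number G"
  shows "\<not> proper_coloring G k c"
  using assms not_less_Least unfolding chromatic_number_def by blast

section \<open>Constructions\<close>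

lemma real_choose_two: "real (n choose 2) = real n * (real n - 1) / 2"
  by (induction n) (auto simp: numeral_2_eq_2 field_simps)

text \<open>The order makes \<open>(u, v)\<close> recoverable from \<open>{u, v}\<close>, so shadows
  can be bounded below by sizes of rectangles of ordered pairs.\<close>

lemma card_increasing_pairs_le:
  fixes E :: "'a::linorder set set"
  assumes "finite E" "\<And>u v. (u, v) \<in> P \<Longrightarrow> u < v \<and> {u, v} \<in> E"
  shows "card P \<le> card E"
proof (rule card_inj_on_le[where f = "\<lambda>(u, v). {u, v}"])
  show "inj_on (\<lambda>(u, v). {u, v}) P"
  proof (rule inj_onI, clarify)
    fix a b c d assume "(a, b) \<in> P" "(c, d) \<in> P" "{a, b} = {c, d}"
    then show "a = c \<and> b = d" using assms(2)[of a b] assms(2)[of c d] by (auto simp: doubleton_eq_iff)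
  qed
qed (use assms in auto)

text \<open>The parts are the residue classes modulo \<open>r\<close>, and the triples are those
  with three different residues. A Berge copy of \<open>G\<close> would pull the residues back to a
  proper colouring with \<open>r\<close> colours.\<close>

lemma pi_hat_ge_multipartite:
  assumes G: "simple_graph G" and r: "r \<ge> 3" and nc: "\<And>c. \<not> proper_coloring G r c"
  shows "ereal (1 - 1 / real r) \<le> pi_hat 3 G"
proof (rule pi_hat_ge)
  fix N :: nat
  define m where "m = max N 2"
  define V where "V = {..<r * m}"
  define H where "H = (V, {h. h \<subseteq> V \<and> card h = 3 \<and> inj_on (\<lambda>x. x mod r) h})"
  have m: "m \<ge> 2" "m \<ge> N" unfolding m_def by auto
  have vH: "verts H = V" and eH: "edges H = {h. h \<subseteq> V \<and> card h = 3 \<and> inj_on (\<lambda>x. x mod r) h}"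
    unfolding H_def verts_def edges_def by auto
  have unif: "uniform 3 H"
    unfolding uniform_def hypergraph_def vH eH V_def by auto
  have free: "berge_free G H"
  proof (rule berge_freeI[OF G])
    fix i f assume i: "inj_on i (verts G)" "i ` verts G \<subseteq> verts H"
      and f: "\<And>e. e \<in> edges G \<Longrightarrow> f e \<in> edges H \<and> i ` e \<subseteq> f e"
    have "proper_coloring G r (\<lambda>v. i v mod r)"
      unfolding proper_coloring_def
    proof (intro conjI allI impI)
      show "(\<lambda>v. i v mod r) ` verts G \<subseteq> {..<r}" using r by auto
      fix u v assume uv: "{u, v} \<in> edges G"
      have "i u \<noteq> i v"
        using simple_graph_edge_neq[OF G uv] i(1) by (meson inj_onD)
      moreover have "inj_on (\<lambda>x. x mod r) (f {u, v})" "i u \<in> f {u, v}" "i v \<in> f {u, v}"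
        using f[OF uv] eH by auto
      ultimately show "i u mod r \<noteq> i v mod r" by (meson inj_onD)
    qed
    then show False using nc by blast
  qed
  let ?S = "Sigma V (\<lambda>u. V - {v \<in> V. v mod r = u mod r})"
  have "card {v \<in> V. v mod r = a} = m" if "a < r" for a
  proof -
    have "{v \<in> V. v mod r = a} = (\<lambda>i. a + r * i) ` {..<m}"
    proof (intro set_eqI iffI)
      fix v assume v: "v \<in> {v \<in> V. v mod r = a}"
      then have "v div r < m" using V_def r by (simp add: less_mult_imp_div_less mult.commute)
      moreover have "v = a + r * (v div r)" using v by auto
      ultimately show "v \<in> (\<lambda>i. a + r * i) ` {..<m}" by blast
    next
      fix v assume "v \<in> (\<lambda>i. a + r * i) ` {..<m}"
      then obtain i where i: "v = a + r * i" "i < m" by auto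
      have "a + r * i < r * Suc i" using that by simp
      also have "\<dots> \<le> r * m" using i by (intro mult_le_mono) auto
      finally show "v \<in> {v \<in> V. v mod r = a}" using i that by (auto simp: V_def)
    qed
    moreover have "inj_on (\<lambda>i. a + r * i) {..<m}" using r by (auto simp: inj_on_def)
    ultimately show ?thesis by (simp add: card_image)
  qed
  then have "card (V - {v \<in> V. v mod r = u mod r}) = r * m - m" for u
    using r by (subst card_Diff_subset) (auto simp: V_def)
  then have cS: "card ?S = r * m * (r * m - m)"
    by (subst card_SigmaI) (auto simp: V_def)
  have "?S \<subseteq> {(u, v). {u, v} \<in> edges (shadow H)}"
  proof
    fix p assume p: "p \<in> ?S"
    obtain u v where uv: "p = (u, v)" "u \<in> V" "v \<in> V" "v mod r \<noteq> u mod r" using p by auto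
    have "\<not> {..<r} \<subseteq> {u mod r, v mod r}"
      using r card_mono[of "{u mod r, v mod r}" "{..<r}"] card_insert_le_m1[of 2 "{v mod r}" "u mod r"] by auto
    then obtain w where w: "w < r" "w \<noteq> u mod r" "w \<noteq> v mod r" by auto
    have "w < r * m" using w(1) m(1) by (metis less_le_trans mult_le_mono2 nat_mult_1_right one_le_numeral order_trans)
    moreover have "w \<noteq> u" "w \<noteq> v" "u \<noteq> v" using w uv by auto
    ultimately have "{u, v, w} \<in> edges H"
      using w uv unfolding eH by (auto simp: V_def inj_on_def)
    then have "{u, v} \<in> edges (shadow H)"
      unfolding mem_shadow_iff using uv(4) by (intro conjI bexI[of _ "{u, v, w}"]) auto
    then show "p \<in> {(u, v). {u, v} \<in> edges (shadow H)}" using uv by simp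
  qed
  moreover have fin: "finite (edges (shadow H))" using uniform_finite_shadow(1)[OF unif] .
  moreover have "finite {(u, v). {u, v} \<in> edges (shadow H)}"
    by (rule finite_subset[of _ "V \<times> V"]) (use uniform_finite_shadow(2)[OF unif] vH V_def in auto)
  ultimately have "card ?S \<le> card {(u, v). {u, v} \<in> edges (shadow H)}"
    by (intro card_mono)
  also have "\<dots> = 2 * card (edges (shadow H))"
    by (rule card_ordered_pairs[OF fin]) (use uniform_finite_shadow(2)[OF unif] in blast)
  finally have "r * m * (r * m - m) \<le> 2 * card (edges (shadow H))" unfolding cS .
  then have "real (r * m * (r * m - m)) \<le> real (2 * card (edges (shadow H)))" by (rule of_nat_mono)
  moreover have "m \<le> r * m" using r by auto
  ultimately have le: "real r * real m * (real r * real m - real m) \<le> 2 * real (card (edges (shadow H)))"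
    by (simp add: of_nat_diff)
  \<comment> \<open>The \<open>r * m * (r * m - m)\<close> ordered pairs are exactly the fraction
    \<open>1 - 1 / r\<close> of \<open>(r * m) ^ 2\<close>, hence at least that fraction of
    \<open>r * m * (r * m - 1)\<close>.\<close>
  have "(1 - 1 / real r) * (real r * real m - 1) \<le> real r * real m - real m"
    using r by (simp add: field_simps)
  then have "real r * real m * ((1 - 1 / real r) * (real r * real m - 1))
      \<le> real r * real m * (real r * real m - real m)"
    by (intro mult_left_mono) auto
  then have "(1 - 1 / real r) * real (r * m choose 2) \<le> real (card (edges (shadow H)))"
    using le unfolding real_choose_two by (simp add: algebra_simps)
  moreover have "r * m \<ge> max N 2"
    using m r by (metis m_def \<open>m \<le> r * m\<close>)
  ultimately show "\<exists>H :: nat hypergraph. uniform 3 H \<and> card (verts H) \<ge> max N 2 \<and> berge_free G H \<and>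
    (1 - 1 / real r) * real (card (verts H) choose 2) \<le> real (card (edges (shadow H)))"
    using unif free vH by (intro exI[of _ H]) (auto simp: V_def)
qed

text \<open>All triples contain the apex 0, whose link is complete bipartite between two halves of
  size \<open>m\<close>. In a Berge copy an edge avoiding the apex must join the two halves, so
  deleting the vertex placed on the apex leaves a bipartite graph.\<close>

lemma pi_hat_ge_cone:
  assumes G: "simple_graph G" "verts G \<noteq> {}"
    and nb: "\<And>v. v \<in> verts G \<Longrightarrow> \<not> bipartite (delete_vertex G v)"
  shows "ereal (1 / 2) \<le> pi_hat 3 G"
proof (rule pi_hat_ge)
  fix N :: nat
  define m where "m = max N 2"
  define H :: "nat hypergraph" where "H = ({..2 * m}, {{0, a, b} |a b. a \<in> {1..m} \<and> b \<in> {m<..2 * m}})"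
  have m: "m \<ge> 2" "m \<ge> N" unfolding m_def by auto
  have vH: "verts H = {..2 * m}" and eH: "edges H = {{0, a, b} |a b. a \<in> {1..m} \<and> b \<in> {m<..2 * m}}"
    unfolding H_def verts_def edges_def by auto
  have unif: "uniform 3 H"
    unfolding uniform_def hypergraph_def vH eH by auto
  have free: "berge_free G H"
  proof (rule berge_freeI[OF G(1)])
    fix i f assume i: "inj_on i (verts G)" "i ` verts G \<subseteq> verts H"
      and f: "\<And>e. e \<in> edges G \<Longrightarrow> f e \<in> edges H \<and> i ` e \<subseteq> f e"
    \<comment> \<open>At most one vertex is placed on the apex. If there is none, any vertex of
      \<open>G\<close> serves as \<open>v\<close>; this uses that \<open>verts G\<close> is
      nonempty.\<close>
    obtain v where v: "v \<in> verts G" "\<And>u. u \<in> verts G \<Longrightarrow> i u = 0 \<Longrightarrow> u = v"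
    proof (cases "\<exists>v\<in>verts G. i v = 0")
      case True
      then show ?thesis using that i(1) by (metis inj_onD)
    next
      case False
      then show ?thesis using that G(2) by blast
    qed
    let ?U1 = "{u \<in> verts G - {v}. i u \<le> m}" and ?U2 = "{u \<in> verts G - {v}. i u > m}"
    have "bipartition (delete_vertex G v) ?U1 ?U2"
      unfolding bipartition_def
    proof (intro conjI ballI)
      show "?U1 \<union> ?U2 = verts (delete_vertex G v)" by (auto simp: delete_vertex_def verts_def)
      fix e assume "e \<in> edges (delete_vertex G v)"
      then have e: "e \<in> edges G" "v \<notin> e" by (auto simp: delete_vertex_def edges_def)
      obtain x y where xy: "e = {x, y}" "x \<noteq> y" "x \<in> verts G" "y \<in> verts G"
        by (rule simple_graph_edgeE[OF G(1) e(1)])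
      have ne: "i x \<noteq> i y" "i x \<noteq> 0" "i y \<noteq> 0" using xy i(1) v(2) e(2) by (auto dest: inj_onD)
      obtain a b where ab: "f e = {0, a, b}" "a \<in> {1..m}" "b \<in> {m<..2 * m}"
        using f[OF e(1)] eH by auto
      have "{i x, i y} \<subseteq> {a, b}" using f[OF e(1)] ab ne xy by auto
      then have "(i x = a \<and> i y = b) \<or> (i x = b \<and> i y = a)" using ne by auto
      then show "\<exists>u\<in>?U1. \<exists>v\<in>?U2. e = {u, v}"
        using xy e(2) ab by (elim disjE) (auto simp: insert_commute intro!: bexI[of _ x] bexI[of _ y])
    qed auto
    then show False using nb[OF v(1)] unfolding bipartite_def by blast
  qed
  \<comment> \<open>The cross pairs alone number \<open>m * m\<close>, slightly less than half of
    \<open>2 * m + 1 choose 2\<close>; the pairs at the apex make up the difference.\<close>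
  let ?P = "({0} \<times> {1..2 * m}) \<union> ({1..m} \<times> {m<..2 * m})"
  have fin: "finite (edges (shadow H))" using uniform_finite_shadow[OF unif] by blast
  have "{u, v} \<in> edges (shadow H)" if uv: "(u, v) \<in> ?P" for u v
  proof -
    have "\<exists>a b. a \<in> {1..m} \<and> b \<in> {m<..2 * m} \<and> {u, v} \<subseteq> {0, a, b}"
    proof (cases "u = 0")
      case True
      show ?thesis
      proof (cases "v \<le> m")
        case True
        then show ?thesis using uv m \<open>u = 0\<close> by (intro exI[of _ v] exI[of _ "2 * m"]) auto
      next
        case False
        then show ?thesis using uv m \<open>u = 0\<close> by (intro exI[of _ 1] exI[of _ v]) auto
      qed
    next
      case False
      then show ?thesis using uv by (intro exI[of _ u] exI[of _ v]) auto
    qed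
    then show ?thesis using uv unfolding mem_shadow_iff eH by auto
  qed
  then have "card ?P \<le> card (edges (shadow H))"
    using fin by (intro card_increasing_pairs_le) auto
  moreover have "card ?P = 2 * m + m * m"
    by (subst card_Un_disjoint) (auto simp: card_cartesian_product)
  ultimately have "real (2 * m + m * m) \<le> real (card (edges (shadow H)))" by linarith
  then have "1 / 2 * real (2 * m + 1 choose 2) \<le> real (card (edges (shadow H)))"
    unfolding real_choose_two by (simp add: field_simps)
  then show "\<exists>H :: nat hypergraph. uniform 3 H \<and> card (verts H) \<ge> max N 2 \<and> berge_free G H \<and>
    1 / 2 * real (card (verts H) choose 2) \<le> real (card (edges (shadow H)))"
    using unif free vH m by (intro exI[of _ H]) auto
qed

text \<open>The pairs \<open>2 * j\<close>, \<open>2 * j + 1\<close> form a perfect matching of the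
  lower half, and each triple adds one upper vertex to such a pair; \<open>div 2\<close> names the
  pair. In a Berge copy, edges inside the lower half lie on matching pairs and no edge lies inside
  the upper half. So \<open>G\<close> would satisfy condition (2) and, since each mixed edge has
  only one possible triple, be triangle-free.\<close>

lemma pi_hat_ge_matching:
  assumes G: "simple_graph G" and n: "\<not> triangle_free G \<or> \<not> condition2 G"
  shows "ereal (1 / 2) \<le> pi_hat 3 G"
proof (rule pi_hat_ge)
  fix N :: nat
  define m where "m = max N 2"
  define H :: "nat hypergraph" where
    "H = ({..<4 * m}, {{2 * j, 2 * j + 1, b} |j b. j < m \<and> b \<in> {2 * m..<4 * m}})"
  have m: "m \<ge> 2" "m \<ge> N" unfolding m_def by auto
  have vH: "verts H = {..<4 * m}"
    and eH: "edges H = {{2 * j, 2 * j + 1, b} |j b. j < m \<and> b \<in> {2 * m..<4 * m}}"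
    unfolding H_def verts_def edges_def by auto
  have unif: "uniform 3 H"
    unfolding uniform_def hypergraph_def vH eH by auto
  have free: "berge_free G H"
  proof (rule berge_freeI[OF G(1)])
    fix i f assume i: "inj_on i (verts G)" "i ` verts G \<subseteq> verts H" and inj_f: "inj_on f (edges G)"
      and f: "\<And>e. e \<in> edges G \<Longrightarrow> f e \<in> edges H \<and> i ` e \<subseteq> f e"
    have small: "i x div 2 = i y div 2"
      if xy: "{x, y} \<in> edges G" "i x < 2 * m" "i y < 2 * m" for x y
    proof -
      obtain j b where "f {x, y} = {2 * j, 2 * j + 1, b}" "b \<ge> 2 * m"
        using f[OF xy(1)] eH by auto
      then show ?thesis using f[OF xy(1)] xy by auto
    qed
    have big: False if xy: "{x, y} \<in> edges G" "i x \<ge> 2 * m" "i y \<ge> 2 * m" for x y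
    proof -
      obtain j b where jb: "f {x, y} = {2 * j, 2 * j + 1, b}" "j < m"
        using f[OF xy(1)] eH by auto
      then have "i x = i y" using f[OF xy(1)] xy by auto
      then show False using simple_graph_edge_neq[OF G xy(1)] i(1) by (auto dest: inj_onD)
    qed
    have mixed: "f {x, y} = {2 * (i x div 2), 2 * (i x div 2) + 1, i y}"
      if xy: "{x, y} \<in> edges G" "i x < 2 * m" "i y \<ge> 2 * m" for x y
    proof -
      obtain j b where jb: "f {x, y} = {2 * j, 2 * j + 1, b}" "j < m" "b \<ge> 2 * m"
        using f[OF xy(1)] eH by auto
      then have "i y = b" "i x div 2 = j" using f[OF xy(1)] xy by auto
      then show ?thesis using jb by simp
    qed
    have noloop: "x \<noteq> y \<and> i x \<noteq> i y \<and> {y, x} \<in> edges G" if "{x, y} \<in> edges G" for x y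
      using simple_graph_edge_neq[OF G that] i(1) that by (auto dest: inj_onD simp: insert_commute)
    \<comment> \<open>Three lower vertices would have the same quotient by 2, but each quotient
      occurs only twice. If \<open>z\<close> is an upper vertex, then \<open>x\<close> and
      \<open>y\<close> are matched, and the edges \<open>{x, z}\<close> and \<open>{y, z}\<close>
      are forced onto the same triple.\<close>
    have tri': False if "{x, y} \<in> edges G" "{y, z} \<in> edges G" "{x, z} \<in> edges G"
      "i x < 2 * m" "i y < 2 * m" for x y z
    proof (cases "i z < 2 * m")
      case True
      have "i x div 2 = i y div 2" "i y div 2 = i z div 2" "i x \<noteq> i y" "i y \<noteq> i z" "i x \<noteq> i z"
        using small noloop that True by blast+
      then show False by linarith
    next
      case False
      have "f {x, z} = f {y, z}"
        using mixed[of x z] mixed[of y z] small[of x y] False that by simp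
      then have "{x, z} = {y, z}" using inj_f that by (meson inj_onD)
      then show False using noloop[OF that(1)] by (auto simp: doubleton_eq_iff)
    qed
    have tri: "triangle_free G"
    proof (rule ccontr)
      assume "\<not> triangle_free G"
      then obtain x y z where xyz: "{x, y} \<in> edges G" "{y, z} \<in> edges G" "{x, z} \<in> edges G"
        unfolding triangle_free_def by blast
      have sym: "{y, x} \<in> edges G" "{z, y} \<in> edges G" "{z, x} \<in> edges G"
        using xyz noloop by blast+
      show False
        using big[OF xyz(1)] big[OF xyz(2)] big[OF xyz(3)]
          tri'[OF xyz(1,2,3)] tri'[OF xyz(2) sym(3) sym(1)] tri'[OF xyz(3) sym(2) xyz(1)]
        by (meson not_le)
    qed
    let ?U1 = "{u \<in> verts G. i u < 2 * m}" and ?U2 = "{u \<in> verts G. i u \<ge> 2 * m}"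
    let ?B = "(verts G, {e \<in> edges G. \<not> e \<subseteq> ?U1})"
    have "condition2 G"
      unfolding condition2_def
    proof (rule exI[of _ ?B], rule exI[of _ ?U1], rule exI[of _ ?U2], intro conjI)
      show "subhypergraph ?B G"
        using simple_graphD[OF G] by (auto simp: subhypergraph_def hypergraph_def verts_def edges_def)
      show "verts ?B = verts G" by (simp add: verts_def)
      show "bipartition ?B ?U1 ?U2"
        unfolding bipartition_def
      proof (intro conjI ballI)
        show "?U1 \<union> ?U2 = verts ?B" by (auto simp: verts_def)
        fix e assume "e \<in> edges ?B"
        then have e: "e \<in> edges G" "\<not> e \<subseteq> ?U1" by (auto simp: edges_def)
        obtain x y where xy: "e = {x, y}" "x \<noteq> y" "x \<in> verts G" "y \<in> verts G"
          by (rule simple_graph_edgeE[OF G(1) e(1)])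
        have "i x < 2 * m \<or> i y < 2 * m" using big[of x y] e(1) xy(1) by (meson not_le)
        then have "(x \<in> ?U1 \<and> y \<in> ?U2) \<or> (x \<in> ?U2 \<and> y \<in> ?U1)" using e(2) xy by auto
        then show "\<exists>u\<in>?U1. \<exists>v\<in>?U2. e = {u, v}"
          using xy(1) by (auto simp: insert_commute)
      qed auto
      have eq: "edges G - edges ?B = {e \<in> edges G. e \<subseteq> ?U1}" by (auto simp: edges_def)
      show "edges G - edges ?B \<subseteq> Pow ?U1 \<or> edges G - edges ?B \<subseteq> Pow ?U2" using eq by auto
      have "e = e'" if e: "e \<in> edges G" "e \<subseteq> ?U1" "e' \<in> edges G" "e' \<subseteq> ?U1" "u \<in> e" "u \<in> e'" for e e' u
      proof -
        obtain x where x: "e = {u, x}"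
          using simple_graph_edgeE[OF G e(1)] e(5) by (auto simp: doubleton_eq_iff insert_commute)
        obtain y where y: "e' = {u, y}"
          using simple_graph_edgeE[OF G e(3)] e(6) by (auto simp: doubleton_eq_iff insert_commute)
        have "i u div 2 = i x div 2" "i u div 2 = i y div 2" "i u \<noteq> i x" "i u \<noteq> i y"
          using small[of u x] small[of u y] noloop[of u x] noloop[of u y] e x y by auto
        then have "i x = i y" by linarith
        then have "x = y" using i(1) e x y by (auto dest: inj_onD)
        then show ?thesis using x y by simp
      qed
      then show "matching (edges G - edges ?B)"
        unfolding eq matching_def pairwise_def disjnt_def by blast
    qed
    then show False using n tri by blast
  qed
  have fin: "finite (edges (shadow H))" using uniform_finite_shadow[OF unif] by blast
  have "card ({..<2 * m} \<times> {2 * m..<4 * m}) \<le> card (edges (shadow H))"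
  proof (rule card_increasing_pairs_le[OF fin])
    fix u v assume uv: "(u, v) \<in> {..<2 * m} \<times> {2 * m..<4 * m}"
    have "{u, v} \<subseteq> {2 * (u div 2), 2 * (u div 2) + 1, v}" by auto
    moreover have "{2 * (u div 2), 2 * (u div 2) + 1, v} \<in> edges H"
    proof -
      have "u div 2 < m" "v \<in> {2 * m..<4 * m}" using uv by auto
      then show ?thesis
        unfolding eH by - (rule CollectI, rule exI[of _ "u div 2"], rule exI[of _ v], simp)
    qed
    ultimately have "\<exists>h\<in>edges H. {u, v} \<subseteq> h" by (rule rev_bexI[rotated])
    then show "u < v \<and> {u, v} \<in> edges (shadow H)" using uv unfolding mem_shadow_iff by simp
  qed
  then have "2 * m * (2 * m) \<le> card (edges (shadow H))"
    by (simp add: card_cartesian_product)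
  then have "real (2 * m * (2 * m)) \<le> real (card (edges (shadow H)))" by (rule of_nat_mono)
  then have "1 / 2 * real (4 * m choose 2) \<le> real (card (edges (shadow H)))"
    unfolding real_choose_two by (simp add: field_simps)
  then show "\<exists>H :: nat hypergraph. uniform 3 H \<and> card (verts H) \<ge> max N 2 \<and> berge_free G H \<and>
    1 / 2 * real (card (verts H) choose 2) \<le> real (card (edges (shadow H)))"
    using unif free vH m by (intro exI[of _ H]) auto
qed

section \<open>Counting lemmas\<close>

text \<open>Averaging over \<open>C\<close>, with the division cleared to stay in the
  naturals.\<close>

lemma pigeonhole_fibre:
  assumes "finite W" "finite C" "C \<noteq> {}" "f ` W \<subseteq> C"
  shows "\<exists>c\<in>C. card W \<le> card C * card {w \<in> W. f w = c}"
proof (rule ccontr)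
  assume "\<not> ?thesis"
  then have "(\<Sum>c\<in>C. card C * card {w \<in> W. f w = c}) < (\<Sum>c\<in>C. card W)"
    using assms by (intro sum_strict_mono) auto
  moreover have "(\<Sum>c\<in>C. card {w \<in> W. f w = c}) = card W"
    using sum.group[OF assms(1,2,4), of "\<lambda>_. 1::nat"] by simp
  ultimately show False using assms by (simp flip: sum_distrib_left)
qed

text \<open>By double counting, at least \<open>c / 2 * M\<close> elements of \<open>Q\<close> lie
  in \<open>t\<close> or more of the sets. Each has a membership pattern in \<open>Pow I\<close>,
  and passing to the most popular pattern \<open>J\<close> loses only the factor
  \<open>2 ^ card I\<close>, which does not depend on \<open>Q\<close>.\<close>

lemma common_neighbourhood:
  fixes N :: "'i \<Rightarrow> 'b set" and c M :: real
  assumes I: "finite I" "I \<noteq> {}" and Q: "finite Q" "real (card Q) \<le> M" and pos: "c > 0" "M > 0"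
    and N: "\<And>i. i \<in> I \<Longrightarrow> N i \<subseteq> Q" "\<And>i. i \<in> I \<Longrightarrow> c * M \<le> real (card (N i))"
    and t: "real t \<le> c / 2 * real (card I)"
  shows "\<exists>J\<subseteq>I. t \<le> card J \<and> c / 2 / 2 ^ card I * M \<le> real (card {q \<in> Q. \<forall>j\<in>J. q \<in> N j})"
proof -
  define D where "D q = {i \<in> I. q \<in> N i}" for q
  define Q1 where "Q1 = {q \<in> Q. t \<le> card (D q)}"
  have fin: "finite Q1" "finite (Q - Q1)" using Q(1) unfolding Q1_def by auto
  have cI: "real (card I) > 0" using I by (simp add: card_gt_0_iff)
  have "(\<Sum>q\<in>Q. card (D q)) = (\<Sum>i\<in>I. card {q \<in> Q. q \<in> N i})"
    using sum.swap_restrict[of Q I "\<lambda>_ _. 1::nat" "\<lambda>q i. q \<in> N i"] I(1) Q(1) by (simp add: D_def)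
  also have "\<dots> = (\<Sum>i\<in>I. card (N i))"
    using N(1) by (intro sum.cong) (auto intro!: arg_cong[of _ _ card])
  finally have sum_eq: "(\<Sum>q\<in>Q. real (card (D q))) = (\<Sum>i\<in>I. real (card (N i)))"
    by (metis of_nat_sum)
  \<comment> \<open>Elements in at least \<open>t\<close> of the sets contribute at most
    \<open>card I\<close> each, the others less than \<open>t\<close>; by the bound on
    \<open>t\<close> the latter account for at most half of \<open>card I * (c * M)\<close>.\<close>
  have "real (card I) * (c * M) \<le> (\<Sum>i\<in>I. real (card (N i)))"
    using sum_mono[of I "\<lambda>_. c * M" "\<lambda>i. real (card (N i))"] N(2) by simp
  also have "\<dots> = (\<Sum>q\<in>Q1. real (card (D q))) + (\<Sum>q\<in>Q - Q1. real (card (D q)))"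
    unfolding sum_eq[symmetric] using sum.subset_diff[of Q1 Q "\<lambda>q. real (card (D q))"] Q(1)
    by (simp add: Q1_def)
  also have "\<dots> \<le> (\<Sum>q\<in>Q1. real (card I)) + (\<Sum>q\<in>Q - Q1. real t)"
    by (intro add_mono sum_mono) (auto simp: D_def Q1_def intro!: card_mono I)
  also have "\<dots> \<le> real (card Q1) * real (card I) + M * (c / 2 * real (card I))"
  proof -
    have "real (card (Q - Q1)) \<le> real (card Q)" using Q(1) by (intro of_nat_mono card_mono) auto
    then have "real (card (Q - Q1)) * real t \<le> M * (c / 2 * real (card I))"
      using Q(2) pos t by (intro mult_mono) auto
    then show ?thesis by simp
  qed
  finally have "real (card I) * (c / 2 * M) \<le> real (card I) * real (card Q1)"
    by (simp add: algebra_simps)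
  then have Q1: "c / 2 * M \<le> real (card Q1)" using cI by simp
  then have "Q1 \<noteq> {}" using pos by (auto simp: zero_less_mult_iff mult_le_0_iff)
  obtain J where J: "J \<in> Pow I" "card Q1 \<le> card (Pow I) * card {q \<in> Q1. D q = J}"
    using pigeonhole_fibre[of Q1 "Pow I" D] fin(1) I(1) D_def by auto
  have "real (card Q1) \<le> real (card (Pow I) * card {q \<in> Q1. D q = J})"
    using J(2) by (rule of_nat_mono)
  then have "c / 2 * M \<le> 2 ^ card I * real (card {q \<in> Q1. D q = J})"
    using Q1 by (simp add: card_Pow[OF I(1)])
  then have big: "c / 2 / 2 ^ card I * M \<le> real (card {q \<in> Q1. D q = J})"
    by (simp add: field_simps)
  moreover have "c / 2 / 2 ^ card I * M > 0" using pos by simp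
  ultimately have "card {q \<in> Q1. D q = J} \<noteq> 0" by linarith
  then obtain q where "q \<in> Q1" "D q = J" by (auto simp: card_eq_0_iff)
  then have "t \<le> card J" using Q1_def by auto
  moreover have "card {q \<in> Q1. D q = J} \<le> card {q \<in> Q. \<forall>j\<in>J. q \<in> N j}"
    using Q(1) by (intro card_mono) (auto simp: Q1_def D_def)
  ultimately show ?thesis using big J(1) by (intro exI[of _ J]) auto
qed

lemma card_eq_sum_degrees:
  assumes "finite P" "finite Q" "E \<subseteq> P \<times> Q"
  shows "card E = (\<Sum>p\<in>P. card {q \<in> Q. (p, q) \<in> E})"
proof -
  have "E = Sigma P (\<lambda>p. {q \<in> Q. (p, q) \<in> E})" using assms(3) by auto
  then show ?thesis using assms card_SigmaI[of P "\<lambda>p. {q \<in> Q. (p, q) \<in> E}"] by simp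
qed

text \<open>Only the dense case is treated, so it suffices to fix boundedly many vertices of high
  degree and to apply \<open>common_neighbourhood\<close> to their neighbourhoods. The numbers
  \<open>M\<close> and \<open>N\<close> may exceed the actual sizes of the sides, so the sides need
  only be estimated.\<close>

lemma kovari_sos_turan:
  fixes b :: real and t :: nat
  assumes b: "b > 0"
  shows "\<exists>K. \<forall>(P :: 'a set) (Q :: 'b set) E M N. finite P \<and> finite Q \<and> real (card P) \<le> M \<and>
    real (card Q) \<le> N \<and> E \<subseteq> P \<times> Q \<and> b * M * N \<le> real (card E) \<and> K \<le> M \<and> K \<le> N \<longrightarrow>
    (\<exists>A\<subseteq>P. \<exists>B\<subseteq>Q. card A = t \<and> card B = t \<and> A \<times> B \<subseteq> E)"
proof -
  \<comment> \<open>High degree means at least \<open>b / 2 * N\<close>, so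
    \<open>common_neighbourhood\<close> is used with density \<open>b / 2\<close> and needs
    \<open>t \<le> b / 4 * k\<close>. The two fractions in \<open>K\<close> then guarantee
    \<open>k\<close> vertices of high degree and \<open>t\<close> common neighbours.\<close>
  define k where "k = nat \<lceil>4 * real t / b\<rceil> + 1"
  define K where "K = 1 + 2 * real k / b + 4 * real t * 2 ^ k / b"
  have k: "real t \<le> b / 2 / 2 * real k" "k > 0"
  proof -
    have "4 * real t / b \<le> real k" unfolding k_def by linarith
    then show "real t \<le> b / 2 / 2 * real k" using b by (simp add: field_simps)
  qed (simp add: k_def)
  have K0: "K > 0" "2 * real k / b \<le> K" "4 * real t * 2 ^ k / b \<le> K"
  proof -
    have "2 * real k / b \<ge> 0" "4 * real t * 2 ^ k / b \<ge> 0" using b by auto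
    then show "K > 0" "2 * real k / b \<le> K" "4 * real t * 2 ^ k / b \<le> K" unfolding K_def by linarith+
  qed
  have "\<exists>A\<subseteq>P. \<exists>B\<subseteq>Q. card A = t \<and> card B = t \<and> A \<times> B \<subseteq> E"
    if fin: "finite P" "finite Q" and card: "real (card P) \<le> M" "real (card Q) \<le> N"
      and E: "E \<subseteq> P \<times> Q" "b * M * N \<le> real (card E)" and MN: "K \<le> M" "K \<le> N"
    for P :: "'a set" and Q :: "'b set" and E M N
  proof -
    have pos: "M > 0" "N > 0" using MN K0 by auto
    let ?N = "\<lambda>p. {q \<in> Q. (p, q) \<in> E}"
    define P1 where "P1 = {p \<in> P. b / 2 * N \<le> real (card (?N p))}"
    have "b * M * N \<le> (\<Sum>p\<in>P. real (card (?N p)))"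
      using E(2) unfolding card_eq_sum_degrees[OF fin E(1)] by simp
    also have "\<dots> = (\<Sum>p\<in>P1. real (card (?N p))) + (\<Sum>p\<in>P - P1. real (card (?N p)))"
      using sum.subset_diff[of P1 P "\<lambda>p. real (card (?N p))"] fin by (simp add: P1_def)
    also have "\<dots> \<le> (\<Sum>p\<in>P1. N) + (\<Sum>p\<in>P - P1. b / 2 * N)"
    proof (intro add_mono sum_mono)
      fix p
      have "card (?N p) \<le> card Q" using fin by (intro card_mono) auto
      then show "real (card (?N p)) \<le> N" using card(2) by linarith
    qed (auto simp: P1_def)
    also have "\<dots> \<le> real (card P1) * N + M * (b / 2 * N)"
    proof -
      have "card (P - P1) \<le> card P" using fin by (intro card_mono) auto
      then have "real (card (P - P1)) \<le> M" using card(1) by linarith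
      then show ?thesis using b pos by (simp add: mult_right_mono)
    qed
    finally have "N * (b / 2 * M) \<le> N * real (card P1)" by (simp add: algebra_simps)
    then have "b / 2 * M \<le> real (card P1)" using pos by simp
    moreover have "real k \<le> b / 2 * M"
      using order_trans[OF K0(2) MN(1)] b by (simp add: field_simps)
    ultimately have "k \<le> card P1" by linarith
    then obtain I where I: "I \<subseteq> P1" "card I = k" "finite I" by (rule obtain_subset_with_card_n)
    obtain J where J: "J \<subseteq> I" "t \<le> card J"
      and big: "b / 2 / 2 / 2 ^ card I * N \<le> real (card {q \<in> Q. \<forall>j\<in>J. q \<in> ?N j})"
    proof -
      have "I \<noteq> {}" "0 < b / 2" using I(2) k(2) b by auto
      moreover have "b / 2 * N \<le> real (card (?N i))" if "i \<in> I" for i using that I(1) P1_def by auto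
      moreover have "real t \<le> b / 2 / 2 * real (card I)" using k(1) I(2) by simp
      moreover have "?N i \<subseteq> Q" if "i \<in> I" for i by blast
      ultimately have "\<exists>J\<subseteq>I. t \<le> card J \<and>
          b / 2 / 2 / 2 ^ card I * N \<le> real (card {q \<in> Q. \<forall>j\<in>J. q \<in> ?N j})"
        using I(3) fin(2) card(2) pos(2) by (intro common_neighbourhood)
      then show thesis using that by blast
    qed
    have "real t \<le> b / 2 / 2 / 2 ^ k * N"
      using order_trans[OF K0(3) MN(2)] b by (simp add: field_simps)
    then have "t \<le> card {q \<in> Q. \<forall>j\<in>J. q \<in> ?N j}" using big I(2) by simp
    then obtain B where B: "B \<subseteq> {q \<in> Q. \<forall>j\<in>J. q \<in> ?N j}" "card B = t"
      by (rule obtain_subset_with_card_n)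
    obtain A where A: "A \<subseteq> J" "card A = t" using J(2) by (rule obtain_subset_with_card_n)
    have "A \<subseteq> P" using A J I P1_def by auto
    moreover have "A \<times> B \<subseteq> E" using A B by blast
    moreover have "B \<subseteq> Q" using B by auto
    ultimately show ?thesis using A(2) B(2) by blast
  qed
  then show ?thesis by - (rule exI[of _ K], intro allI impI, elim conjE)
qed

text \<open>A first moment argument: the values at \<open>i\<close> and \<open>j\<close> determine
  the forbidden value at \<open>k\<close>, so each condition fails for at most
  \<open>T ^ (card I - 1)\<close> of the \<open>T ^ card I\<close> choice functions, and there are
  at most \<open>card I ^ 3\<close> conditions. The case \<open>i = j\<close> is included, so that a
  \<open>g\<close> with \<open>g u u = u\<close> also yields injectivity.\<close>

lemma ex_choice_avoiding:
  fixes g :: "'v \<Rightarrow> 'v \<Rightarrow> 'v"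
  assumes I: "finite I" and P: "\<And>i. i \<in> I \<Longrightarrow> finite (P i)" "\<And>i. i \<in> I \<Longrightarrow> card (P i) = T"
    and T: "card I ^ 3 < T"
  shows "\<exists>\<phi>. (\<forall>i\<in>I. \<phi> i \<in> P i) \<and>
    (\<forall>i\<in>I. \<forall>j\<in>I. \<forall>k\<in>I. i \<noteq> k \<longrightarrow> j \<noteq> k \<longrightarrow> \<phi> k \<noteq> g (\<phi> i) (\<phi> j))"
proof (cases "I = {}")
  case False
  define \<Phi> where "\<Phi> = PiE I P"
  define J where "J = {(i, j, k). i \<in> I \<and> j \<in> I \<and> k \<in> I \<and> i \<noteq> k \<and> j \<noteq> k}"
  define bad where "bad = (\<lambda>(i, j, k). {\<phi> \<in> \<Phi>. \<phi> k = g (\<phi> i) (\<phi> j)})"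
  have fin: "finite \<Phi>" unfolding \<Phi>_def using I P by (intro finite_PiE) auto
  have c\<Phi>: "card \<Phi> = T ^ card I" unfolding \<Phi>_def using I P by (simp add: card_PiE)
  have J: "J \<subseteq> I \<times> I \<times> I" "finite J" unfolding J_def using I
    by (auto intro: finite_subset[of _ "I \<times> I \<times> I"])
  have "card J \<le> card (I \<times> I \<times> I)" using J I by (intro card_mono) auto
  then have cJ: "card J \<le> card I ^ 3" by (simp add: card_cartesian_product power3_eq_cube)
  have cbad: "card (bad p) \<le> T ^ (card I - 1)" if pJ: "p \<in> J" for p
  proof -
    obtain i j k where p: "p = (i, j, k)" "i \<in> I" "j \<in> I" "k \<in> I" "i \<noteq> k" "j \<noteq> k"
      using pJ unfolding J_def by auto
    have "card (bad p) \<le> card (PiE (I - {k}) P)"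
    proof (rule card_inj_on_le[where f = "\<lambda>\<phi>. restrict \<phi> (I - {k})"])
      show "inj_on (\<lambda>\<phi>. restrict \<phi> (I - {k})) (bad p)"
      proof (rule inj_onI)
        fix \<phi> \<psi> assume a: "\<phi> \<in> bad p" "\<psi> \<in> bad p" "restrict \<phi> (I - {k}) = restrict \<psi> (I - {k})"
        have eq: "\<phi> x = \<psi> x" if "x \<in> I - {k}" for x using fun_cong[OF a(3), of x] that by simp
        have "\<phi> k = \<psi> k" using a(1,2) p eq[of i] eq[of j] unfolding bad_def by auto
        then have "\<phi> x = \<psi> x" if "x \<in> I" for x using eq that by (cases "x = k") auto
        note ext = this
        have "\<phi> \<in> PiE I P" "\<psi> \<in> PiE I P" using a(1,2) p unfolding bad_def \<Phi>_def by auto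
        then show "\<phi> = \<psi>" using ext by (rule PiE_ext)
      qed
      show "(\<lambda>\<phi>. restrict \<phi> (I - {k})) ` bad p \<subseteq> PiE (I - {k}) P"
        using p unfolding bad_def \<Phi>_def by (auto intro!: restrict_PiE_iff[THEN iffD2])
      show "finite (PiE (I - {k}) P)" using I P by (intro finite_PiE) auto
    qed
    also have "\<dots> = T ^ (card I - 1)" using I P p by (simp add: card_PiE)
    finally show ?thesis .
  qed
  have "card (\<Union>p\<in>J. bad p) \<le> (\<Sum>p\<in>J. card (bad p))" using J by (intro card_UN_le) auto
  also have "\<dots> \<le> card J * T ^ (card I - 1)" using sum_bounded_above[of J "\<lambda>p. card (bad p)"] cbad by auto
  also have "\<dots> \<le> card I ^ 3 * T ^ (card I - 1)" using cJ by simp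
  also have "\<dots> < T * T ^ (card I - 1)" using T by simp
  also have "\<dots> = T ^ card I" using False I by (metis card_gt_0_iff power_eq_if not_gr_zero)
  finally have "card (\<Union>p\<in>J. bad p) < card \<Phi>" using c\<Phi> by simp
  then have "\<not> \<Phi> \<subseteq> (\<Union>p\<in>J. bad p)"
  proof -
    have "finite (bad p)" for p using fin by (cases p) (simp add: bad_def)
    then have "finite (\<Union>p\<in>J. bad p)" using J(2) by blast
    then show ?thesis using \<open>card (\<Union>p\<in>J. bad p) < card \<Phi>\<close> card_mono by (metis not_le)
  qed
  then obtain \<phi> where \<phi>: "\<phi> \<in> \<Phi>" "\<phi> \<notin> (\<Union>p\<in>J. bad p)" by blast
  show ?thesis
  proof (intro exI[of _ \<phi>] conjI ballI impI)
    show "\<phi> i \<in> P i" if "i \<in> I" for i using that \<phi>(1) unfolding \<Phi>_def by auto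
    fix i j k assume "i \<in> I" "j \<in> I" "k \<in> I" "i \<noteq> k" "j \<noteq> k"
    then have "(i, j, k) \<in> J" unfolding J_def by auto
    then show "\<phi> k \<noteq> g (\<phi> i) (\<phi> j)" using \<phi> unfolding bad_def by auto
  qed
qed auto

text \<open>The tangent at 1 lies above the concave power. The proof is weighted AM-GM for
  \<open>x\<close> and 1, obtained from \<open>ln t \<le> t - 1\<close> at \<open>x / M\<close> and
  \<open>1 / M\<close>, where \<open>M\<close> is the weighted mean.\<close>

lemma powr_le_tangent:
  fixes x s :: real
  assumes "0 \<le> x" "0 < s" "s \<le> 1"
  shows "x powr s \<le> 1 + s * (x - 1)"
proof (cases "x = 0")
  case False
  define M where "M = s * x + (1 - s)"
  have x: "x > 0" using False assms by auto
  then have M: "M > 0" unfolding M_def using assms by (simp add: add_pos_nonneg)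
  have "ln (x / M) \<le> x / M - 1" "ln (1 / M) \<le> 1 / M - 1" using x M by (intro ln_le_minus_one; simp)+
  then have "s * ln (x / M) + (1 - s) * ln (1 / M) \<le> s * (x / M - 1) + (1 - s) * (1 / M - 1)"
    using assms by (intro add_mono mult_left_mono) auto
  also have "\<dots> = (s * x + (1 - s)) / M - 1" by (simp add: add_divide_distrib diff_divide_distrib algebra_simps)
  also have "\<dots> = 0" using M unfolding M_def by simp
  finally have "s * ln x \<le> ln M" using x M by (simp add: ln_div algebra_simps)
  then have "exp (s * ln x) \<le> M" using M by (metis exp_le_cancel_iff exp_ln)
  then show ?thesis using x unfolding M_def by (simp add: powr_def algebra_simps)
qed (use assms in auto)

section \<open>Erdos-Stone theorem and chromatic upper bound\<close>

text \<open>Disjointness of the parts is left implicit: a common element \<open>u\<close> of two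
  parts would satisfy \<open>E u u\<close>, which is impossible for a shadow.\<close>

definition contains_multipartite :: "('a \<Rightarrow> 'a \<Rightarrow> bool) \<Rightarrow> 'a set \<Rightarrow> nat \<Rightarrow> nat \<Rightarrow> bool" where
  "contains_multipartite E V k t \<longleftrightarrow> (\<exists>P. \<forall>i<k. P i \<subseteq> V \<and> card (P i) = t \<and>
     (\<forall>j<k. i \<noteq> j \<longrightarrow> (\<forall>u\<in>P i. \<forall>v\<in>P j. E u v)))"

text \<open>Induction adds one part at a time. The induction hypothesis supplies parts of a larger
  size \<open>T\<close>; a positive proportion of all vertices has \<open>t\<close> neighbours in
  each of them, and \<open>t\<close> of these vertices have the same neighbourhood in their union.
  Multiplying the number of non-neighbours by \<open>r\<close> avoids a division by zero at the
  start of the induction.\<close>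

lemma ex_complete_multipartite_min_degree:
  fixes \<epsilon> :: real and r t :: nat
  assumes \<epsilon>: "0 < \<epsilon>" "\<epsilon> \<le> 1"
  shows "\<exists>K. \<forall>(V :: 'a set) E. finite V \<and> K \<le> card V \<and> symp E \<and>
    (\<forall>v\<in>V. real r * real (card {u \<in> V. \<not> E v u}) \<le> (1 - \<epsilon>) * real (card V)) \<longrightarrow>
    contains_multipartite E V (Suc r) t"
proof (induction r arbitrary: t)
  case 0
  have "contains_multipartite E V (Suc 0) t"
    if tV: "t \<le> card V" for V :: "'a set" and E
  proof -
    obtain A where "A \<subseteq> V" "card A = t" using tV by (rule obtain_subset_with_card_n)
    then show ?thesis unfolding contains_multipartite_def by (intro exI[of _ "\<lambda>_. A"]) auto
  qed
  then show ?case by blast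
next
  case (Suc r)
  \<comment> \<open>With \<open>t \<le> \<epsilon> / 2 * T\<close>, a vertex with fewer than
    \<open>t\<close> neighbours in a part misses at least \<open>(1 - \<epsilon> / 2) * T\<close>
    vertices of it.\<close>
  define T where "T = nat \<lceil>2 * real t / \<epsilon>\<rceil> + 1"
  have T: "real t \<le> \<epsilon> / 2 * real T" "T > 0"
  proof -
    have "2 * real t / \<epsilon> \<le> real T" unfolding T_def by linarith
    then show "real t \<le> \<epsilon> / 2 * real T" using \<epsilon> by (simp add: field_simps)
  qed (simp add: T_def)
  obtain K where K: "\<And>(V :: 'a set) E. \<lbrakk>finite V; K \<le> card V; symp E;
      \<forall>v\<in>V. real r * real (card {u \<in> V. \<not> E v u}) \<le> (1 - \<epsilon>) * real (card V)\<rbrakk> \<Longrightarrow>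
    contains_multipartite E V (Suc r) T"
    using Suc.IH[of T] by blast
  define L where "L = T * (r + 1)"
  define K' where "K' = max K (nat \<lceil>2 * real t * 2 ^ L / \<epsilon>\<rceil> + 1)"
  have main: "contains_multipartite E V (Suc (Suc r)) t"
    if V: "finite V" "K' \<le> card V" and E: "symp E"
      and deg: "\<forall>v\<in>V. real (Suc r) * real (card {u \<in> V. \<not> E v u}) \<le> (1 - \<epsilon>) * real (card V)"
    for V :: "'a set" and E
  proof -
    define n where "n = real (card V)"
    have "\<forall>v\<in>V. real r * real (card {u \<in> V. \<not> E v u}) \<le> (1 - \<epsilon>) * real (card V)"
    proof
      fix v assume "v \<in> V"
      have "real r * real (card {u \<in> V. \<not> E v u}) \<le> real (Suc r) * real (card {u \<in> V. \<not> E v u})"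
        by (intro mult_right_mono) auto
      then show "real r * real (card {u \<in> V. \<not> E v u}) \<le> (1 - \<epsilon>) * real (card V)"
        using deg \<open>v \<in> V\<close> by (meson order_trans)
    qed
    moreover have "K \<le> card V" using V(2) K'_def by simp
    ultimately have "contains_multipartite E V (Suc r) T" using K[OF V(1) _ E] by blast
    then obtain P where P: "\<And>i. i \<le> r \<Longrightarrow> P i \<subseteq> V" "\<And>i. i \<le> r \<Longrightarrow> card (P i) = T"
      "\<And>i j u v. \<lbrakk>i \<le> r; j \<le> r; i \<noteq> j; u \<in> P i; v \<in> P j\<rbrakk> \<Longrightarrow> E u v"
      unfolding contains_multipartite_def less_Suc_eq_le by blast
    have finP: "finite (P i)" if "i \<le> r" for i using P(1)[OF that] V(1) finite_subset by blast
    define W where "W = {u \<in> V. \<forall>i\<le>r. t \<le> card {v \<in> P i. E v u}}"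
    have miss: "(1 - \<epsilon> / 2) * real T \<le> (\<Sum>i\<le>r. real (card {v \<in> P i. \<not> E v u}))" if "u \<in> V - W" for u
    proof -
      obtain i where i: "i \<le> r" "card {v \<in> P i. E v u} < t" using \<open>u \<in> V - W\<close> W_def by (auto simp: not_le)
      have "T = card ({v \<in> P i. E v u} \<union> {v \<in> P i. \<not> E v u})"
        unfolding P(2)[OF i(1), symmetric] by (rule arg_cong[of _ _ card]) auto
      also have "\<dots> \<le> card {v \<in> P i. E v u} + card {v \<in> P i. \<not> E v u}" by (rule card_Un_le)
      finally have "real T \<le> real t + real (card {v \<in> P i. \<not> E v u})" using i by linarith
      then have "(1 - \<epsilon> / 2) * real T \<le> real (card {v \<in> P i. \<not> E v u})" using T(1) by (simp add: algebra_simps)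
      also have "\<dots> \<le> (\<Sum>i\<le>r. real (card {v \<in> P i. \<not> E v u}))"
        using i(1) by (intro member_le_sum) auto
      finally show ?thesis .
    qed
    \<comment> \<open>Non-adjacent pairs between \<open>V - W\<close> and the parts are counted in
      two ways: each vertex of \<open>V - W\<close> misses most of some part, while each vertex of a
      part has few non-neighbours.\<close>
    have "real (card (V - W)) * ((1 - \<epsilon> / 2) * real T) = (\<Sum>u\<in>V - W. (1 - \<epsilon> / 2) * real T)" by simp
    also have "\<dots> \<le> (\<Sum>u\<in>V - W. \<Sum>i\<le>r. real (card {v \<in> P i. \<not> E v u}))" by (intro sum_mono miss)
    also have "\<dots> \<le> (\<Sum>u\<in>V. \<Sum>i\<le>r. real (card {v \<in> P i. \<not> E v u}))"
      using V(1) by (intro sum_mono2) (auto intro: sum_nonneg)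
    also have "\<dots> = (\<Sum>i\<le>r. \<Sum>u\<in>V. real (card {v \<in> P i. \<not> E v u}))" by (rule sum.swap)
    also have "\<dots> = (\<Sum>i\<le>r. \<Sum>v\<in>P i. real (card {u \<in> V. \<not> E v u}))"
    proof (rule sum.cong[OF refl])
      fix i assume "i \<in> {..r}"
      then show "(\<Sum>u\<in>V. real (card {v \<in> P i. \<not> E v u})) = (\<Sum>v\<in>P i. real (card {u \<in> V. \<not> E v u}))"
        using sum.swap_restrict[of V "P i" "\<lambda>_ _. 1::real" "\<lambda>u v. \<not> E v u"] V(1) finP by simp
    qed
    also have "\<dots> \<le> (\<Sum>i\<le>r. \<Sum>v\<in>P i. (1 - \<epsilon>) * n / real (Suc r))"
    proof (intro sum_mono)
      fix i v assume "i \<in> {..r}" "v \<in> P i"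
      then have "v \<in> V" using P(1) by auto
      then have "real (Suc r) * real (card {u \<in> V. \<not> E v u}) \<le> (1 - \<epsilon>) * n" using deg n_def by blast
      then show "real (card {u \<in> V. \<not> E v u}) \<le> (1 - \<epsilon>) * n / real (Suc r)"
        by (simp add: pos_le_divide_eq mult.commute del: of_nat_Suc)
    qed
    also have "\<dots> = (\<Sum>i\<le>r. real T * ((1 - \<epsilon>) * n / real (Suc r)))"
      using P(2) by (intro sum.cong) auto
    also have "\<dots> = real T * ((1 - \<epsilon>) * n)" by (simp del: of_nat_Suc)
    finally have "real T * (real (card (V - W)) * (1 - \<epsilon> / 2)) \<le> real T * ((1 - \<epsilon>) * n)"
      by (simp add: algebra_simps)
    then have "real (card (V - W)) * (1 - \<epsilon> / 2) \<le> (1 - \<epsilon>) * n" using T(2) by simp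
    \<comment> \<open>Writing \<open>1 - \<epsilon> \<le> (1 - \<epsilon> / 2) ^ 2\<close> allows
      one factor to be cancelled and leaves at least \<open>\<epsilon> / 2 * n\<close> vertices in
      \<open>W\<close>.\<close>
    also have "\<dots> \<le> ((1 - \<epsilon> / 2) * n) * (1 - \<epsilon> / 2)"
    proof -
      have "(1 - \<epsilon> / 2) * (1 - \<epsilon> / 2) - (1 - \<epsilon>) = (\<epsilon> / 2)\<^sup>2" by (simp add: power2_eq_square field_simps)
      then have "1 - \<epsilon> \<le> (1 - \<epsilon> / 2) * (1 - \<epsilon> / 2)" by (smt (verit) zero_le_power2)
      then have "(1 - \<epsilon>) * n \<le> (1 - \<epsilon> / 2) * (1 - \<epsilon> / 2) * n" unfolding n_def by (intro mult_right_mono) auto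
      then show ?thesis by (simp add: mult_ac)
    qed
    finally have "real (card (V - W)) \<le> (1 - \<epsilon> / 2) * n" using \<epsilon> by (simp add: mult.commute)
    moreover have "real (card (V - W)) = n - real (card W)"
    proof -
      have "W \<subseteq> V" unfolding W_def by auto
      then show ?thesis unfolding n_def using V(1) by (simp add: card_Diff_subset card_mono finite_subset of_nat_diff)
    qed
    ultimately have W: "\<epsilon> / 2 * n \<le> real (card W)" by (simp add: algebra_simps)
    define K0 where "K0 = (\<Union>i\<le>r. P i)"
    have "card K0 \<le> (\<Sum>i\<le>r. card (P i))" unfolding K0_def by (intro card_UN_le) auto
    also have "\<dots> = L" using P(2) by (simp add: L_def)
    finally have cK0: "card K0 \<le> L" .
    have fK0: "finite K0" unfolding K0_def using finP by auto
    have finW: "finite W" unfolding W_def using V by auto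
    \<comment> \<open>The union \<open>K0\<close> has at most \<open>2 ^ L\<close> subsets, so
      \<open>t\<close> vertices of \<open>W\<close> have the same neighbourhood \<open>S\<close> in
      it. They form the new part, and the old parts are cut down to \<open>t\<close> vertices inside
      \<open>S\<close>.\<close>
    obtain S where S: "S \<in> Pow K0" "card W \<le> card (Pow K0) * card {u \<in> W. {v \<in> K0. E v u} = S}"
      using pigeonhole_fibre[of W "Pow K0" "\<lambda>u. {v \<in> K0. E v u}"] finW fK0 by auto
    define F where "F = {u \<in> W. {v \<in> K0. E v u} = S}"
    have "t \<le> card F"
    proof -
      have "card (Pow K0) \<le> 2 ^ L" using cK0 by (simp add: card_Pow[OF fK0])
      then have "card W \<le> 2 ^ L * card F" using S(2) unfolding F_def by (meson le_trans mult_le_mono1)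
      then have "real (card W) \<le> 2 ^ L * real (card F)" 
        by (simp flip: of_nat_le_iff[where 'a = real])
      moreover have "2 * real t * 2 ^ L / \<epsilon> \<le> n"
      proof -
        have "nat \<lceil>2 * real t * 2 ^ L / \<epsilon>\<rceil> + 1 \<le> card V" using V(2) unfolding K'_def by linarith
        then show ?thesis unfolding n_def by linarith
      qed
      then have "real t * 2 ^ L \<le> \<epsilon> / 2 * n" using \<epsilon> by (simp add: field_simps)
      ultimately have "real t * 2 ^ L \<le> 2 ^ L * real (card F)" using W by linarith
      then show ?thesis by simp
    qed
    then obtain A where A: "A \<subseteq> F" "card A = t" by (rule obtain_subset_with_card_n)
    have "\<exists>Q\<subseteq>P i \<inter> S. card Q = t" if i: "i \<le> r" for i
    proof (cases "t = 0")
      case False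
      then obtain u where "u \<in> F" using \<open>t \<le> card F\<close> by fastforce
      then have "t \<le> card {v \<in> P i. E v u}" "{v \<in> K0. E v u} = S" using i unfolding F_def W_def by auto
      moreover have "{v \<in> P i. E v u} \<subseteq> P i \<inter> S" using \<open>{v \<in> K0. E v u} = S\<close> i unfolding K0_def by auto
      ultimately have "t \<le> card (P i \<inter> S)" using finP[OF i] by (meson card_mono finite_Int le_trans)
      then obtain Q where "Q \<subseteq> P i \<inter> S" "card Q = t" by (rule obtain_subset_with_card_n)
      then show ?thesis by blast
    qed (intro exI[of _ "{}"], simp)
    then obtain Q where Q: "\<And>i. i \<le> r \<Longrightarrow> Q i \<subseteq> P i \<inter> S" "\<And>i. i \<le> r \<Longrightarrow> card (Q i) = t" by metis
    have QA: "E v u \<and> E u v" if "i \<le> r" "v \<in> Q i" "u \<in> A" for i u v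
    proof -
      have "E v u" using that Q(1)[of i] A unfolding F_def by blast
      then show ?thesis using E by (auto dest: sympD)
    qed
    have AV: "A \<subseteq> V" using A unfolding F_def W_def by auto
    have QQ: "E u v" if "i \<le> r" "j \<le> r" "i \<noteq> j" "u \<in> Q i" "v \<in> Q j" for i j u v
      using P(3)[of i j u v] Q(1)[of i] Q(1)[of j] that by blast
    have QV: "Q i \<subseteq> V" if "i \<le> r" for i using P(1)[OF that] Q(1)[OF that] by blast
    show ?thesis
      unfolding contains_multipartite_def less_Suc_eq_le
    proof (intro exI[of _ "\<lambda>i. if i \<le> r then Q i else A"] allI impI conjI ballI)
      fix i j u v assume ij: "i \<le> Suc r" "j \<le> Suc r" "i \<noteq> j"
        and uv: "u \<in> (if i \<le> r then Q i else A)" "v \<in> (if j \<le> r then Q j else A)"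
      consider "i \<le> r" "j \<le> r" | "i \<le> r" "\<not> j \<le> r" | "\<not> i \<le> r" "j \<le> r" using ij by linarith
      then show "E u v"
        using uv QA[of i u v] QA[of j v u] QQ[of i j u v] ij(3) by cases simp_all
    qed (use A AV Q(2) QV in auto)
  qed
  show ?case by (rule exI[of _ K'], intro allI impI, elim conjE) (rule main)
qed

text \<open>Ordered pairs are counted, hence the comparison with the square of the order. The proof
  passes to a large subset in which every vertex has high degree, where the minimum degree version
  applies.\<close>

lemma erdos_stone:
  fixes \<epsilon> :: real and r t :: nat
  assumes \<epsilon>: "0 < \<epsilon>" "\<epsilon> \<le> 1" and r: "r \<ge> 1"
  shows "\<exists>K. \<forall>(V :: 'a set) E. finite V \<and> K \<le> card V \<and> symp E \<and>
    (1 - 1 / real r + \<epsilon>) * (real (card V))\<^sup>2 \<le> real (card {(u, v). u \<in> V \<and> v \<in> V \<and> E u v}) \<longrightarrow>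
    contains_multipartite E V (Suc r) t"
proof -
  have \<epsilon>2: "0 < \<epsilon> / 2" "\<epsilon> / 2 \<le> 1" using \<epsilon> by auto
  obtain K where K: "\<And>(V :: 'a set) E. \<lbrakk>finite V; K \<le> card V; symp E;
      \<forall>v\<in>V. real r * real (card {u \<in> V. \<not> E v u}) \<le> (1 - \<epsilon> / 2) * real (card V)\<rbrakk> \<Longrightarrow>
    contains_multipartite E V (Suc r) t"
    using ex_complete_multipartite_min_degree[OF \<epsilon>2, of r t] by blast
  \<comment> \<open>Since \<open>\<alpha> \<le> 2\<close>, the term \<open>8 / \<epsilon>\<close>
    gives \<open>\<alpha> * n \<le> \<epsilon> / 4 * n ^ 2\<close>. The other term makes
    \<open>sqrt \<epsilon> / 2 * n\<close>, a lower bound for the size of the maximizer, at least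
    \<open>K\<close>.\<close>
  define K' where "K' = nat \<lceil>8 / \<epsilon> + 2 * real K / sqrt \<epsilon>\<rceil> + 1"
  define \<alpha> where "\<alpha> = 1 - 1 / real r + \<epsilon> / 2"
  have \<alpha>: "0 \<le> \<alpha>" "\<alpha> \<le> 2"
  proof -
    have "0 \<le> 1 / real r" "1 / real r \<le> 1" using r by auto
    then show "0 \<le> \<alpha>" "\<alpha> \<le> 2" unfolding \<alpha>_def using \<epsilon> by linarith+
  qed
  have main: "contains_multipartite E V (Suc r) t"
    if V: "finite V" "K' \<le> card V" and E: "symp E" and dens: "(1 - 1 / real r + \<epsilon>) * (real (card V))\<^sup>2
      \<le> real (card {(u, v). u \<in> V \<and> v \<in> V \<and> E u v})" for V :: "'a set" and E
  proof -
    define n where "n = real (card V)"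
    define R where "R S = {(u, v). u \<in> S \<and> v \<in> S \<and> E u v}" for S
    \<comment> \<open>A vertex set maximizing this potential cannot be improved by dropping a vertex, which
      forces minimum degree at least \<open>\<alpha>\<close> times its size.\<close>
    define f where "f S = real (card (R S)) - \<alpha> * real (card S) * (real (card S) + 1)" for S
    have "finite (f ` Pow V)" "f ` Pow V \<noteq> {}" using V(1) by auto
    then have "Max (f ` Pow V) \<in> f ` Pow V" by (rule Max_in)
    then obtain S where S: "S \<subseteq> V" "f S = Max (f ` Pow V)" by auto
    have max: "f S' \<le> f S" if "S' \<subseteq> V" for S' using S V(1) that by (auto intro!: Max_ge)
    have finS: "finite S" using S V finite_subset by blast
    define s where "s = real (card S)"
    have n: "8 / \<epsilon> \<le> n" "2 * real K / sqrt \<epsilon> \<le> n"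
    proof -
      have "8 / \<epsilon> + 2 * real K / sqrt \<epsilon> \<le> n" using V(2) unfolding K'_def n_def by linarith
      moreover have "0 \<le> 8 / \<epsilon>" "0 \<le> 2 * real K / sqrt \<epsilon>" using \<epsilon> by auto
      ultimately show "8 / \<epsilon> \<le> n" "2 * real K / sqrt \<epsilon> \<le> n" by linarith+
    qed
    have "(\<alpha> + \<epsilon> / 2) * n\<^sup>2 \<le> real (card (R V))"
      using dens unfolding \<alpha>_def R_def n_def by (simp add: algebra_simps)
    \<comment> \<open>The potential of \<open>V\<close> is quadratic in \<open>n\<close>, while that
      of \<open>S\<close> is at most the square of its size; so the maximizer has linear
      size.\<close>
    then have "\<epsilon> / 2 * n\<^sup>2 - \<alpha> * n \<le> f V" unfolding f_def n_def by (simp add: algebra_simps power2_eq_square)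
    also have "\<dots> \<le> f S" by (rule max) simp
    also have "\<dots> \<le> s\<^sup>2"
    proof -
      have "R S \<subseteq> S \<times> S" unfolding R_def by auto
      then have "card (R S) \<le> card (S \<times> S)" using finS by (intro card_mono) auto
      then have "real (card (R S)) \<le> real (card (S \<times> S))" by (rule of_nat_mono)
      moreover have "0 \<le> \<alpha> * s * (s + 1)" using \<alpha> by (simp add: s_def)
      ultimately show ?thesis unfolding f_def s_def[symmetric]
        by (simp add: card_cartesian_product power2_eq_square s_def)
    qed
    finally have "\<epsilon> / 2 * n\<^sup>2 - \<alpha> * n \<le> s\<^sup>2" .
    moreover have "\<alpha> * n \<le> \<epsilon> / 4 * n\<^sup>2"
    proof -
      have "8 \<le> \<epsilon> * n" using n(1) \<epsilon> by (simp add: field_simps)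
      then have "\<alpha> \<le> \<epsilon> / 4 * n" using \<alpha> by linarith
      then have "\<alpha> * n \<le> \<epsilon> / 4 * n * n" unfolding n_def by (intro mult_right_mono) auto
      then show ?thesis by (simp add: power2_eq_square)
    qed
    ultimately have "\<epsilon> / 4 * n\<^sup>2 \<le> s\<^sup>2" by simp
    moreover have "(real K)\<^sup>2 \<le> \<epsilon> / 4 * n\<^sup>2"
    proof -
      have "real K \<le> sqrt \<epsilon> / 2 * n" using n(2) \<epsilon> by (simp add: field_simps)
      then have "(real K)\<^sup>2 \<le> (sqrt \<epsilon> / 2 * n)\<^sup>2" by (intro power_mono) auto
      then show ?thesis using \<epsilon> by (simp add: power_mult_distrib power_divide)
    qed
    ultimately have "(real K)\<^sup>2 \<le> s\<^sup>2" by simp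
    then have "real K \<le> s" unfolding s_def by (rule power2_le_imp_le) simp
    then have KS: "K \<le> card S" unfolding s_def by simp
    have "\<forall>v\<in>S. real r * real (card {u \<in> S. \<not> E v u}) \<le> (1 - \<epsilon> / 2) * real (card S)"
    proof
      fix v assume v: "v \<in> S"
      define d where "d = real (card {u \<in> S. E v u})"
      have "R S \<subseteq> R (S - {v}) \<union> ({v} \<times> {u \<in> S. E v u} \<union> {u \<in> S. E v u} \<times> {v})"
        unfolding R_def using sympD[OF E] by auto
      then have "card (R S) \<le> card (R (S - {v}) \<union> ({v} \<times> {u \<in> S. E v u} \<union> {u \<in> S. E v u} \<times> {v}))"
      proof (rule card_mono[rotated])
        have "finite (R (S - {v}))" by (rule finite_subset[of _ "S \<times> S"]) (use finS in \<open>auto simp: R_def\<close>)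
        then show "finite (R (S - {v}) \<union> ({v} \<times> {u \<in> S. E v u} \<union> {u \<in> S. E v u} \<times> {v}))" using finS by simp
      qed
      also have "\<dots> \<le> card (R (S - {v})) + (card ({v} \<times> {u \<in> S. E v u}) + card ({u \<in> S. E v u} \<times> {v}))"
        by (meson add_left_mono card_Un_le le_trans)
      finally have "real (card (R S)) \<le> real (card (R (S - {v}))) + 2 * d"
        unfolding d_def by (simp add: card_cartesian_product)
      moreover have "f (S - {v}) \<le> f S" using S(1) by (intro max) blast
      moreover have "real (card (S - {v})) = s - 1"
        using card_Suc_Diff1[OF finS v] unfolding s_def by linarith
      \<comment> \<open>Dropping \<open>v\<close> loses at most \<open>2 * d\<close> ordered pairs
        and lowers the subtracted term by exactly \<open>2 * \<alpha> * s\<close>.\<close>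
      ultimately have "\<alpha> * (s * (s + 1) - (s - 1) * s) \<le> 2 * d"
        unfolding f_def s_def[symmetric] by (simp add: algebra_simps)
      then have d: "\<alpha> * s \<le> d" by (simp add: algebra_simps)
      have "s = real (card ({u \<in> S. E v u} \<union> {u \<in> S. \<not> E v u}))"
        unfolding s_def by (rule arg_cong[of _ _ "\<lambda>x. real (card x)"]) auto
      also have "\<dots> = d + real (card {u \<in> S. \<not> E v u})"
        unfolding d_def using finS by (subst card_Un_disjoint) auto
      finally have "real (card {u \<in> S. \<not> E v u}) \<le> (1 - \<alpha>) * s" using d by (simp add: algebra_simps)
      then have "real r * real (card {u \<in> S. \<not> E v u}) \<le> real r * ((1 - \<alpha>) * s)"
        by (intro mult_left_mono) auto
      also have "\<dots> = (1 - real r * (\<epsilon> / 2)) * s" unfolding \<alpha>_def using r by (simp add: field_simps)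
      also have "\<dots> \<le> (1 - \<epsilon> / 2) * s"
      proof (rule mult_right_mono)
        have "1 * (\<epsilon> / 2) \<le> real r * (\<epsilon> / 2)" using r \<epsilon> by (intro mult_right_mono) auto
        then show "1 - real r * (\<epsilon> / 2) \<le> 1 - \<epsilon> / 2" by simp
      qed (simp add: s_def)
      finally show "real r * real (card {u \<in> S. \<not> E v u}) \<le> (1 - \<epsilon> / 2) * real (card S)" unfolding s_def .
    qed
    then have "contains_multipartite E S (Suc r) t" using K[OF finS KS E] by blast
    then obtain P where "\<forall>i<Suc r. P i \<subseteq> S \<and> card (P i) = t \<and>
        (\<forall>j<Suc r. i \<noteq> j \<longrightarrow> (\<forall>u\<in>P i. \<forall>v\<in>P j. E u v))"
      unfolding contains_multipartite_def by (rule exE)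
    then show ?thesis unfolding contains_multipartite_def using S(1) by (intro exI[of _ P]) (meson order_trans)
  qed
  show ?thesis by (rule exI[of _ K'], intro allI impI, elim conjE) (rule main)
qed

section \<open>Berge copies in multipartite shadows\<close>

lemma shadow_symp: "symp (\<lambda>u v. {u, v} \<in> edges (shadow H))"
  by (rule sympI) (simp add: insert_commute)

text \<open>Fix a triple \<open>h\<close> over each shadow edge, with third vertex given by
  \<open>g\<close>. The vertices of \<open>G\<close> are placed in the parts of their colours so
  that no image vertex is the third vertex of a triple used by two others. Each used triple then
  meets the image exactly in its own edge, so the triples are distinct.\<close>

lemma not_berge_free_multipartite:
  fixes H :: "'b hypergraph"
  assumes G: "simple_graph G" and c: "proper_coloring G k c" and H: "uniform 3 H"
    and P: "\<And>i. i < k \<Longrightarrow> P i \<subseteq> verts H" "\<And>i. i < k \<Longrightarrow> card (P i) = T"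
      "\<And>i j u v. \<lbrakk>i < k; j < k; i \<noteq> j; u \<in> P i; v \<in> P j\<rbrakk> \<Longrightarrow> {u, v} \<in> edges (shadow H)"
    and T: "card (verts G) ^ 3 < T"
  shows "\<not> berge_free G H"
proof -
  have "\<exists>h\<in>edges H. e \<subseteq> h" if "e \<in> edges (shadow H)" for e
    using that by (auto simp: shadow_def edges_def)
  then obtain h where h: "\<And>e. e \<in> edges (shadow H) \<Longrightarrow> h e \<in> edges H \<and> e \<subseteq> h e" by metis
  \<comment> \<open>The default \<open>g u u = u\<close> turns the avoidance conditions with
    \<open>i = j\<close> into injectivity of the embedding.\<close>
  define g where "g u v = (if u = v then u else SOME w. w \<in> h {u, v} - {u, v})" for u v
  have g: "h {u, v} = {u, v, g u v}" if uv: "{u, v} \<in> edges (shadow H)" "u \<noteq> v" for u v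
  proof -
    have "card (h {u, v}) = 3" using h[OF uv(1)] H unfolding uniform_def by blast
    moreover have "{u, v} \<subseteq> h {u, v}" using h[OF uv(1)] by blast
    ultimately have "card (h {u, v} - {u, v}) = 1" using uv(2) by (simp add: card_Diff_subset)
    then obtain w where w: "h {u, v} - {u, v} = {w}" by (auto simp: card_1_singleton_iff)
    then have "g u v = w" unfolding g_def using uv(2) by simp
    then show ?thesis using w \<open>{u, v} \<subseteq> h {u, v}\<close> by blast
  qed
  have ck: "c v < k" if "v \<in> verts G" for v using c that unfolding proper_coloring_def by auto
  have fin: "finite (P i)" if "i < k" for i
    using P(2)[OF that] T card.infinite by force
  obtain \<phi> where \<phi>: "\<And>i. i \<in> verts G \<Longrightarrow> \<phi> i \<in> P (c i)"
    "\<And>i j k. \<lbrakk>i \<in> verts G; j \<in> verts G; k \<in> verts G; i \<noteq> k; j \<noteq> k\<rbrakk> \<Longrightarrow> \<phi> k \<noteq> g (\<phi> i) (\<phi> j)"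
  proof -
    have "\<exists>\<phi>. (\<forall>i\<in>verts G. \<phi> i \<in> P (c i)) \<and>
      (\<forall>i\<in>verts G. \<forall>j\<in>verts G. \<forall>k\<in>verts G. i \<noteq> k \<longrightarrow> j \<noteq> k \<longrightarrow> \<phi> k \<noteq> g (\<phi> i) (\<phi> j))"
      by (rule ex_choice_avoiding[where T = T]) (use simple_graphD(1)[OF G] fin ck P(2) T in auto)
    then show thesis using that by blast
  qed
  have inj: "inj_on \<phi> (verts G)"
  proof (rule inj_onI, rule ccontr)
    fix u v assume "u \<in> verts G" "v \<in> verts G" "\<phi> u = \<phi> v" "u \<noteq> v"
    then show False using \<phi>(2)[of u u v] by (simp add: g_def)
  qed
  have edge: "\<phi> ` e \<in> edges (shadow H) \<and> h (\<phi> ` e) \<inter> \<phi> ` verts G = \<phi> ` e" if e: "e \<in> edges G" for e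
  proof -
    obtain u v where uv: "e = {u, v}" "u \<noteq> v" "u \<in> verts G" "v \<in> verts G"
      by (rule simple_graph_edgeE[OF G e])
    have "c u \<noteq> c v" using c e uv(1) unfolding proper_coloring_def by blast
    then have sh: "{\<phi> u, \<phi> v} \<in> edges (shadow H)" using P(3) ck \<phi>(1) uv by blast
    have "\<phi> u \<noteq> \<phi> v" using inj uv by (auto dest: inj_onD)
    then have eq: "h {\<phi> u, \<phi> v} = {\<phi> u, \<phi> v, g (\<phi> u) (\<phi> v)}" using g sh by blast
    have "\<phi> w \<in> {\<phi> u, \<phi> v}" if "w \<in> verts G" "\<phi> w \<in> h {\<phi> u, \<phi> v}" for w
      using that eq \<phi>(2)[of u v w] uv by auto
    then show ?thesis using sh uv eq by auto
  qed
  show ?thesis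
  proof (rule not_berge_freeI[where i = \<phi> and P = "\<lambda>e h'. h' = h (\<phi> ` e)"])
    show "hypergraph H" using H unfolding uniform_def by blast
    show "inj_on \<phi> (verts G)" by (rule inj)
    show "\<phi> ` verts G \<subseteq> verts H" using \<phi>(1) P(1) ck by blast
    show "\<exists>h'\<in>edges H. \<phi> ` e \<subseteq> h' \<and> h' = h (\<phi> ` e)" if "e \<in> edges G" for e
      using edge[OF that] h[of "\<phi> ` e"] by blast
    fix e e' h' assume e: "e \<in> edges G" "e' \<in> edges G" "h' = h (\<phi> ` e)" "h' = h (\<phi> ` e')"
    then have "\<phi> ` e = \<phi> ` e'" using edge[of e] edge[of e'] by metis
    then show "e = e'" using inj simple_graphD(3)[OF G] e by (metis inj_on_image_eq_iff)
  qed
qed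

lemma pi_hat_le_chromatic:
  assumes G: "simple_graph G" and c: "proper_coloring G (Suc r) c" and r: "r \<ge> 1"
  shows "pi_hat 3 G \<le> ereal (1 - 1 / real r)"
proof (rule pi_hat_le)
  show nonneg: "0 \<le> 1 - 1 / real r" using r by simp
  fix \<epsilon> :: real assume \<epsilon>: "\<epsilon> > 0"
  define \<delta> where "\<delta> = min 1 (\<epsilon> / 2)"
  have \<delta>: "0 < \<delta>" "\<delta> \<le> 1" "\<delta> \<le> \<epsilon> / 2" unfolding \<delta>_def using \<epsilon> by auto
  define T where "T = card (verts G) ^ 3 + 1"
  obtain K where K: "\<And>(V :: nat set) E. \<lbrakk>finite V; K \<le> card V; symp E;
      (1 - 1 / real r + \<delta>) * (real (card V))\<^sup>2 \<le> real (card {(u, v). u \<in> V \<and> v \<in> V \<and> E u v})\<rbrakk> \<Longrightarrow>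
    contains_multipartite E V (Suc r) T"
    using erdos_stone[OF \<delta>(1,2) r, of T] by blast
  \<comment> \<open>The second term lets half of \<open>\<epsilon>\<close> absorb the difference
    between \<open>n * (n - 1)\<close> and \<open>n ^ 2\<close>.\<close>
  define N where "N = max K (nat \<lceil>2 * (1 + \<epsilon>) / \<epsilon>\<rceil>)"
  show "\<exists>N. \<forall>H :: nat hypergraph. uniform 3 H \<and> card (verts H) \<ge> N \<and> berge_free G H \<longrightarrow>
    real (card (edges (shadow H))) \<le> (1 - 1 / real r + \<epsilon>) * real (card (verts H) choose 2)"
  proof (intro exI[of _ N] allI impI, elim conjE, rule ccontr)
    fix H :: "nat hypergraph" assume H: "uniform 3 H" "card (verts H) \<ge> N" "berge_free G H"
      and big: "\<not> real (card (edges (shadow H))) \<le> (1 - 1 / real r + \<epsilon>) * real (card (verts H) choose 2)"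
    define n where "n = real (card (verts H))"
    define p where "p = 1 - 1 / real r"
    have fin: "finite (edges (shadow H))" using uniform_finite_shadow(1)[OF H(1)] .
    have "{(u, v). u \<in> verts H \<and> v \<in> verts H \<and> {u, v} \<in> edges (shadow H)} = {(u, v). {u, v} \<in> edges (shadow H)}"
      using uniform_finite_shadow(2)[OF H(1)] by auto
    also have "card \<dots> = 2 * card (edges (shadow H))"
      by (rule card_ordered_pairs[OF fin]) (use uniform_finite_shadow(2)[OF H(1)] in blast)
    finally have eq: "card {(u, v). u \<in> verts H \<and> v \<in> verts H \<and> {u, v} \<in> edges (shadow H)} = 2 * card (edges (shadow H))" .
    have "nat \<lceil>2 * (1 + \<epsilon>) / \<epsilon>\<rceil> \<le> card (verts H)" using H(2) N_def by simp
    then have "2 * (1 + \<epsilon>) / \<epsilon> \<le> n" unfolding n_def by linarith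
    then have "1 + \<epsilon> \<le> \<epsilon> / 2 * n" using \<epsilon> by (simp add: field_simps)
    moreover have "p \<le> 1" unfolding p_def by simp
    ultimately have "p + \<epsilon> \<le> \<epsilon> / 2 * n" by linarith
    then have "(p + \<epsilon>) * n \<le> \<epsilon> / 2 * n * n" unfolding n_def by (intro mult_right_mono) auto
    then have "(p + \<epsilon> / 2) * n\<^sup>2 \<le> (p + \<epsilon>) * (n * (n - 1))"
      by (simp add: algebra_simps power2_eq_square)
    moreover have "(p + \<delta>) * n\<^sup>2 \<le> (p + \<epsilon> / 2) * n\<^sup>2" using \<delta>(3) by (intro mult_right_mono) auto
    moreover have "(p + \<epsilon>) * (n * (n - 1)) \<le> 2 * real (card (edges (shadow H)))"
      using big unfolding real_choose_two n_def p_def by (simp add: algebra_simps)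
    ultimately have "(p + \<delta>) * n\<^sup>2 \<le> 2 * real (card (edges (shadow H)))" by linarith
    then have "(1 - 1 / real r + \<delta>) * (real (card (verts H)))\<^sup>2 \<le>
        real (card {(u, v). u \<in> verts H \<and> v \<in> verts H \<and> {u, v} \<in> edges (shadow H)})"
      unfolding eq p_def n_def by simp
    moreover have "finite (verts H)" using H(1) unfolding uniform_def hypergraph_def by blast
    moreover have "K \<le> card (verts H)" using H(2) N_def by simp
    ultimately have "contains_multipartite (\<lambda>u v. {u, v} \<in> edges (shadow H)) (verts H) (Suc r) T"
      using K[OF _ _ shadow_symp[of H]] by blast
    then obtain P where P: "\<forall>i<Suc r. P i \<subseteq> verts H \<and> card (P i) = T \<and>
        (\<forall>j<Suc r. i \<noteq> j \<longrightarrow> (\<forall>u\<in>P i. \<forall>v\<in>P j. {u, v} \<in> edges (shadow H)))"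
      unfolding contains_multipartite_def by (rule exE)
    have "\<not> berge_free G H"
      by (rule not_berge_free_multipartite[OF G c H(1), of P T]) (use P T_def in auto)
    then show False using H(3) by blast
  qed
qed

section \<open>One-sidedly regular pairs\<close>

text \<open>Only lower bounds appear, because the embedding only needs edges to exist. The number
  \<open>\<rho>\<close> is a proportion of the edges of the pair, not a density, and
  \<open>c\<close> refers to the density of the host graph.\<close>

definition lower_regular :: "('a \<times> 'b) set \<Rightarrow> 'a set \<Rightarrow> 'b set \<Rightarrow> real \<Rightarrow> real \<Rightarrow> real \<Rightarrow> bool" where
  "lower_regular F A B c \<gamma> \<rho> \<longleftrightarrow>
    (\<forall>x\<in>A. c / 2 * real (card B) \<le> real (card {y \<in> B. (x, y) \<in> F})) \<and>
    (\<forall>y\<in>B. c / 2 * real (card A) \<le> real (card {x \<in> A. (x, y) \<in> F})) \<and>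
    (\<forall>A'\<subseteq>A. \<forall>B'\<subseteq>B. \<gamma> * real (card A) \<le> real (card A') \<longrightarrow> \<gamma> * real (card B) \<le> real (card B') \<longrightarrow>
      \<rho> * real (card (F \<inter> A \<times> B)) \<le> real (card (F \<inter> A' \<times> B')))"

text \<open>The expression tends to \<open>\<gamma>\<close> as \<open>\<eta>\<close> tends to 0 from
  above. It arises in \<open>ex_lower_regular_pair\<close> from subtracting the edges outside a
  large subpair.\<close>

lemma ex_exponent:
  fixes \<gamma> :: real
  assumes "0 < \<gamma>"
  shows "\<exists>\<eta>>0. \<eta> \<le> 1 / 2 \<and> \<gamma> / 2 \<le> (1 - \<eta>) - \<gamma> powr (- \<eta>) * (1 - (1 - \<eta>) * \<gamma>)"
proof -
  have "((\<lambda>\<eta>. (1 - \<eta>) - \<gamma> powr (- \<eta>) * (1 - (1 - \<eta>) * \<gamma>)) \<longlongrightarrow> (1 - 0) - \<gamma> powr (- 0) * (1 - (1 - 0) * \<gamma>)) (at_right 0)"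
    using assms by (intro tendsto_intros) auto
  moreover have "(1 - 0) - \<gamma> powr (- 0) * (1 - (1 - 0) * \<gamma>) = \<gamma>" using assms by simp
  ultimately have "((\<lambda>\<eta>. (1 - \<eta>) - \<gamma> powr (- \<eta>) * (1 - (1 - \<eta>) * \<gamma>)) \<longlongrightarrow> \<gamma>) (at_right 0)" by simp
  then have "eventually (\<lambda>\<eta>. \<gamma> / 2 < (1 - \<eta>) - \<gamma> powr (- \<eta>) * (1 - (1 - \<eta>) * \<gamma>)) (at_right 0)"
    using assms by (intro order_tendstoD) auto
  moreover have "eventually (\<lambda>\<eta>. 0 < \<eta> \<and> \<eta> \<le> (1 / 2 :: real)) (at_right 0)"
    using eventually_at_right_real[of 0 "1 / 2 :: real"] by (auto elim: eventually_mono)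
  ultimately have "eventually (\<lambda>\<eta>. 0 < \<eta> \<and> \<eta> \<le> 1 / 2 \<and>
    \<gamma> / 2 \<le> (1 - \<eta>) - \<gamma> powr (- \<eta>) * (1 - (1 - \<eta>) * \<gamma>)) (at_right 0)"
    by eventually_elim auto
  then show ?thesis using eventually_happens[of _ "at_right (0 :: real)"] trivial_limit_at_right_real
    by blast
qed

text \<open>One maximizer of a weighted density replaces an iteration of density increments. The
  numbers \<open>\<rho>\<close> and \<open>\<sigma>\<close> depend only on \<open>c\<close> and
  \<open>\<gamma>\<close>, so the pair keeps a fixed proportion of \<open>n ^ 2\<close>
  edges.\<close>

lemma ex_lower_regular_pair:
  fixes c \<gamma> :: real
  assumes c: "0 < c" and \<gamma>: "0 < \<gamma>" "\<gamma> \<le> 1"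
  shows "\<exists>\<rho>>0. \<exists>\<sigma>>0. \<forall>(X :: 'a set) (Y :: 'b set) F n. finite X \<and> finite Y \<and> F \<subseteq> X \<times> Y \<and>
    real (card X) \<le> n \<and> real (card Y) \<le> n \<and> 0 < n \<and> c * n\<^sup>2 \<le> real (card F) \<longrightarrow>
    (\<exists>A\<subseteq>X. \<exists>B\<subseteq>Y. lower_regular F A B c \<gamma> \<rho> \<and> \<sigma> * n\<^sup>2 \<le> real (card (F \<inter> A \<times> B)))"
proof -
  obtain \<eta> where \<eta>: "0 < \<eta>" "\<eta> \<le> 1 / 2" "\<gamma> / 2 \<le> (1 - \<eta>) - \<gamma> powr (- \<eta>) * (1 - (1 - \<eta>) * \<gamma>)"
    using ex_exponent[OF \<gamma>(1)] by blast
  define s where "s = 1 - \<eta>"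
  have s: "1 / 2 \<le> s" "0 < s" "s \<le> 1" "s < 1" using \<eta> unfolding s_def by auto
  \<comment> \<open>One factor of \<open>\<rho>\<close> bounds the relative size of
    \<open>A'\<close> from below, the other is the bound of \<open>ex_exponent\<close>. The power in
    \<open>\<sigma>\<close> is the lower bound on \<open>card A * card B / n ^ 2\<close> that
    maximality forces.\<close>
  define \<rho> where "\<rho> = \<gamma> * (\<gamma> / 2)"
  define \<sigma> where "\<sigma> = c * c powr (1 / \<eta>)"
  have pos: "\<rho> > 0" "\<sigma> > 0" unfolding \<rho>_def \<sigma>_def using c \<gamma> by auto
  have main: "\<exists>A\<subseteq>X. \<exists>B\<subseteq>Y. lower_regular F A B c \<gamma> \<rho> \<and> \<sigma> * n\<^sup>2 \<le> real (card (F \<inter> A \<times> B))"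
    if fin: "finite X" "finite Y" and F: "F \<subseteq> X \<times> Y" and n: "real (card X) \<le> n" "real (card Y) \<le> n"
      "0 < n" and dens: "c * n\<^sup>2 \<le> real (card F)" for X :: "'a set" and Y :: "'b set" and F n
  proof -
    define e where "e A B = real (card (F \<inter> A \<times> B))" for A B
    have finF: "finite F" using F fin by (meson finite_SigmaI finite_subset)
    have e_mono: "e A B \<le> real (card A) * real (card B)" if "finite A" "finite B" for A B
    proof -
      have "card (F \<inter> A \<times> B) \<le> card (A \<times> B)" using that by (intro card_mono) auto
      then have "real (card (F \<inter> A \<times> B)) \<le> real (card (A \<times> B))" by (rule of_nat_mono)
      then show ?thesis unfolding e_def by (simp add: card_cartesian_product)
    qed
    have e_split1: "e A B = e (A - A') B + e A' B" if "A' \<subseteq> A" for A A' B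
    proof -
      have "F \<inter> A \<times> B = (F \<inter> (A - A') \<times> B) \<union> (F \<inter> A' \<times> B)" using that by auto
      moreover have "(F \<inter> (A - A') \<times> B) \<inter> (F \<inter> A' \<times> B) = {}" by auto
      ultimately show ?thesis unfolding e_def using finF by (simp add: card_Un_disjoint)
    qed
    have e_split2: "e A B = e A (B - B') + e A B'" if "B' \<subseteq> B" for A B B'
    proof -
      have "F \<inter> A \<times> B = (F \<inter> A \<times> (B - B')) \<union> (F \<inter> A \<times> B')" using that by auto
      moreover have "(F \<inter> A \<times> (B - B')) \<inter> (F \<inter> A \<times> B') = {}" by auto
      ultimately show ?thesis unfolding e_def using finF by (simp add: card_Un_disjoint)
    qed
    have "0 < c * n\<^sup>2" using c n by simp
    then have "card F \<noteq> 0" using dens by linarith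
    then have "F \<noteq> {}" by auto
    then have XY: "X \<noteq> {}" "Y \<noteq> {}" using F by auto
    define S where "S = {(A, B). A \<subseteq> X \<and> B \<subseteq> Y \<and> A \<noteq> {} \<and> B \<noteq> {}}"
    \<comment> \<open>Density times a small power of the size: a maximizer has no much denser large subpair, so by
      counting complements it has no much sparser one either.\<close>
    define \<phi> where "\<phi> p = e (fst p) (snd p) / (real (card (fst p)) * real (card (snd p))) powr s" for p
    have "S \<subseteq> Pow X \<times> Pow Y" unfolding S_def by auto
    then have finS: "finite S" using fin by (meson finite_Pow_iff finite_SigmaI finite_subset)
    have XYS: "(X, Y) \<in> S" unfolding S_def using XY by auto
    then have "Max (\<phi> ` S) \<in> \<phi> ` S" using finS by (intro Max_in) auto
    then obtain p where p: "p \<in> S" "\<phi> p = Max (\<phi> ` S)" by auto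
    obtain A B where AB: "p = (A, B)" by force
    have max: "\<phi> q \<le> \<phi> (A, B)" if "q \<in> S" for q
      using p finS that AB by auto
    have sub: "A \<subseteq> X" "B \<subseteq> Y" "A \<noteq> {}" "B \<noteq> {}" using p(1) AB unfolding S_def by auto
    have finAB: "finite A" "finite B" using sub fin finite_subset by blast+
    define a b where "a = real (card A)" and "b = real (card B)"
    have ab: "a \<ge> 1" "b \<ge> 1" unfolding a_def b_def using sub finAB by (auto simp: Suc_le_eq card_gt_0_iff)
    then have ab0: "a * b > 0" by simp
    have abn: "a * b \<le> n\<^sup>2"
    proof -
      have "a \<le> n" "b \<le> n" unfolding a_def b_def using card_mono[OF fin(1) sub(1)] card_mono[OF fin(2) sub(2)] n by linarith+
      then show ?thesis using ab n by (simp add: power2_eq_square mult_mono)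
    qed
    have key: "e A' B' \<le> e A B * (real (card A') / a * (real (card B') / b)) powr s"
      if "A' \<subseteq> A" "B' \<subseteq> B" for A' B'
    proof (cases "A' = {} \<or> B' = {}")
      case True
      then show ?thesis unfolding e_def by auto
    next
      case False
      then have "(A', B') \<in> S" using that sub unfolding S_def by auto
      then have *: "e A' B' / (real (card A') * real (card B')) powr s \<le> e A B / (a * b) powr s"
        using max[of "(A', B')"] unfolding \<phi>_def a_def b_def by simp
      have "real (card A') * real (card B') > 0"
        using False finite_subset[OF that(1) finAB(1)] finite_subset[OF that(2) finAB(2)]
        by (simp add: card_gt_0_iff)
      then have "(real (card A') * real (card B')) powr s > 0" by (metis less_irrefl powr_gt_zero)
      then have "e A' B' \<le> e A B / (a * b) powr s * (real (card A') * real (card B')) powr s"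
        using * by (simp only: pos_divide_le_eq)
      also have "\<dots> = e A B * (real (card A') * real (card B') / (a * b)) powr s"
        using ab0 by (simp add: powr_divide)
      finally show ?thesis by simp
    qed
    define q where "q = a * b / n\<^sup>2"
    have q: "0 < q" "q \<le> 1" unfolding q_def using ab0 abn n by auto
    have e_ge: "c * n\<^sup>2 * q powr s \<le> e A B"
    proof -
      have XY0: "real (card X) * real (card Y) > 0" using XY fin by (simp add: card_gt_0_iff)
      have "real (card X) * real (card Y) \<le> n\<^sup>2" using n by (simp add: power2_eq_square mult_mono)
      then have "(real (card X) * real (card Y)) powr s \<le> (n\<^sup>2) powr s"
        using XY0 s by (intro powr_mono2) auto
      moreover have "F \<inter> X \<times> Y = F" using F by auto
      ultimately have "c * n\<^sup>2 / (n\<^sup>2) powr s \<le> \<phi> (X, Y)"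
        unfolding \<phi>_def e_def using dens XY fin c by (auto simp: card_gt_0_iff intro!: frac_le)
      also have "\<dots> \<le> \<phi> (A, B)" by (rule max[OF XYS])
      also have "\<dots> = e A B / (a * b) powr s" unfolding \<phi>_def a_def b_def by simp
      finally have "c * n\<^sup>2 / (n\<^sup>2) powr s * (a * b) powr s \<le> e A B"
        using ab0 by (subst (asm) pos_le_divide_eq) auto
      then show ?thesis unfolding q_def using ab0 n by (simp add: powr_divide)
    qed
    have qs: "q \<le> q powr s" using q s powr_mono'[of s 1 q] by simp
    have e_dens: "c * (a * b) \<le> e A B"
    proof -
      have "c * (a * b) = c * n\<^sup>2 * q" unfolding q_def using n by simp
      also have "\<dots> \<le> c * n\<^sup>2 * q powr s" using qs c by (intro mult_left_mono) auto
      finally show ?thesis using e_ge by linarith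
    qed
    have "\<sigma> * n\<^sup>2 \<le> e A B"
    proof -
      \<comment> \<open>Comparing the lower bound from maximality with the trivial bound of
        \<open>a * b\<close> edges gives \<open>c \<le> q powr \<eta>\<close>, so the maximizer
        cannot be too small.\<close>
      have "e A B \<le> n\<^sup>2 * q" using e_mono[OF finAB] n unfolding q_def a_def b_def by simp
      then have "n\<^sup>2 * (c * q powr s) \<le> n\<^sup>2 * q" using e_ge by (simp add: mult_ac)
      then have "c * q powr s \<le> q" using n by simp
      also have "q = q powr \<eta> * q powr s" using q by (simp add: s_def flip: powr_add)
      finally have "c \<le> q powr \<eta>" using q by simp
      then have "c powr (1 / \<eta>) \<le> (q powr \<eta>) powr (1 / \<eta>)" using c \<eta> by (intro powr_mono2) auto
      also have "\<dots> = q" using q \<eta> by (simp add: powr_powr)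
      finally have "c * n\<^sup>2 * c powr (1 / \<eta>) \<le> c * n\<^sup>2 * q" using c by (intro mult_left_mono) auto
      also have "\<dots> = c * (a * b)" unfolding q_def using n by simp
      finally show ?thesis using e_dens unfolding \<sigma>_def by (simp add: mult_ac)
    qed
    moreover have "lower_regular F A B c \<gamma> \<rho>"
      unfolding lower_regular_def
    proof (intro conjI ballI allI impI)
      have e0: "0 \<le> e A B" unfolding e_def by simp
      have half: "c / 2 * (a * b) \<le> s * e A B"
        using mult_mono[OF s(1) e_dens] c ab0 s e0 by simp
      fix x assume x: "x \<in> A"
      have "real (card (A - {x})) = a - 1" using card_Suc_Diff1[OF finAB(1) x] unfolding a_def by linarith
      \<comment> \<open>Removing \<open>x\<close> loses exactly its degree, and by maximality and
        the tangent bound this loss is at least \<open>s * e A B / a\<close>. The factor 2 in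
        \<open>c / 2\<close> comes from \<open>s \<ge> 1 / 2\<close>.\<close>
      then have "e (A - {x}) B \<le> e A B * (1 - 1 / a) powr s"
        using key[of "A - {x}" B] ab unfolding b_def[symmetric] by (simp add: diff_divide_distrib)
      also have "\<dots> \<le> e A B * (1 + s * ((1 - 1 / a) - 1))"
        using powr_le_tangent[of "1 - 1 / a" s] ab s e0 by (intro mult_left_mono) auto
      also have "\<dots> = e A B - s * e A B / a" by (simp add: algebra_simps)
      finally have "s * e A B / a \<le> e {x} B" using e_split1[of "{x}" A B] x by simp
      moreover have "c / 2 * b \<le> s * e A B / a" using half ab by (simp add: pos_le_divide_eq mult_ac)
      moreover have "e {x} B = real (card {y \<in> B. (x, y) \<in> F})"
      proof -
        have "F \<inter> {x} \<times> B = Pair x ` {y \<in> B. (x, y) \<in> F}" by auto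
        then show ?thesis unfolding e_def by (simp add: card_image inj_on_def)
      qed
      ultimately show "c / 2 * real (card B) \<le> real (card {y \<in> B. (x, y) \<in> F})" unfolding b_def by linarith
    next
      have e0: "0 \<le> e A B" unfolding e_def by simp
      have half: "c / 2 * (a * b) \<le> s * e A B"
        using mult_mono[OF s(1) e_dens] c ab0 s e0 by simp
      fix y assume y: "y \<in> B"
      have "real (card (B - {y})) = b - 1" using card_Suc_Diff1[OF finAB(2) y] unfolding b_def by linarith
      then have "e A (B - {y}) \<le> e A B * (1 - 1 / b) powr s"
        using key[of A "B - {y}"] ab unfolding a_def[symmetric] by (simp add: diff_divide_distrib)
      also have "\<dots> \<le> e A B * (1 + s * ((1 - 1 / b) - 1))"
        using powr_le_tangent[of "1 - 1 / b" s] ab s e0 by (intro mult_left_mono) auto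
      also have "\<dots> = e A B - s * e A B / b" by (simp add: algebra_simps)
      finally have "s * e A B / b \<le> e A {y}" using e_split2[of "{y}" B A] y by simp
      moreover have "c / 2 * a \<le> s * e A B / b" using half ab by (simp add: pos_le_divide_eq mult_ac)
      moreover have "e A {y} = real (card {x \<in> A. (x, y) \<in> F})"
      proof -
        have "F \<inter> A \<times> {y} = (\<lambda>x. (x, y)) ` {x \<in> A. (x, y) \<in> F}" by auto
        then show ?thesis unfolding e_def by (simp add: card_image inj_on_def)
      qed
      ultimately show "c / 2 * real (card A) \<le> real (card {x \<in> A. (x, y) \<in> F})" unfolding a_def by linarith
    next
      fix A' B' assume A': "A' \<subseteq> A" "\<gamma> * real (card A) \<le> real (card A')"
        and B': "B' \<subseteq> B" "\<gamma> * real (card B) \<le> real (card B')"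
      have e0: "0 \<le> e A B" unfolding e_def by simp
      define \<alpha> \<beta> where "\<alpha> = real (card A') / a" and "\<beta> = real (card B') / b"
      have cA': "card A' \<le> card A" "card B' \<le> card B" using A' B' finAB by (auto intro: card_mono)
      have \<alpha>: "\<gamma> \<le> \<alpha>" "\<alpha> \<le> 1" "\<gamma> \<le> \<beta>" "\<beta> \<le> 1"
        using A'(2) B'(2) cA' ab unfolding \<alpha>_def \<beta>_def a_def b_def by (auto simp: field_simps)
      have "real (card (A - A')) = a - real (card A')" "real (card (B - B')) = b - real (card B')"
        using A' B' finAB cA' unfolding a_def b_def
        by (auto simp: card_Diff_subset finite_subset of_nat_diff)
      then have diff: "real (card (A - A')) / a = 1 - \<alpha>" "real (card (B - B')) / b = 1 - \<beta>"
        unfolding \<alpha>_def \<beta>_def using ab by (auto simp: diff_divide_distrib)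
      have one: "real (card B) / b = 1" using ab unfolding b_def by simp
      have "e (A - A') B \<le> e A B * (1 - \<alpha>) powr s"
        using key[of "A - A'" B] diff(1) one by simp
      also have "\<dots> \<le> e A B * (1 - s * \<alpha>)"
        using powr_le_tangent[of "1 - \<alpha>" s] \<alpha> s e0 by (intro mult_left_mono) auto
      finally have 1: "e (A - A') B \<le> e A B * (1 - s * \<alpha>)" .
      have "e A' (B - B') \<le> e A B * (\<alpha> * (1 - \<beta>)) powr s"
        using key[of A' "B - B'"] A'(1) diff(2) unfolding \<alpha>_def by simp
      also have "\<dots> \<le> e A B * (\<alpha> * \<gamma> powr (- \<eta>) * (1 - s * \<gamma>))"
      proof (intro mult_left_mono e0)
        have "(\<alpha> * (1 - \<beta>)) powr s = \<alpha> powr s * (1 - \<beta>) powr s" using \<alpha> \<gamma> by (simp add: powr_mult)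
        also have "\<alpha> powr s = \<alpha> * \<alpha> powr (- \<eta>)"
        proof -
          have "\<alpha> powr s = \<alpha> powr (1 + - \<eta>)" unfolding s_def by simp
          also have "\<dots> = \<alpha> powr 1 * \<alpha> powr (- \<eta>)" by (rule powr_add)
          finally show ?thesis using \<alpha> \<gamma> by simp
        qed
        also have "\<alpha> * \<alpha> powr (- \<eta>) * (1 - \<beta>) powr s \<le> \<alpha> * \<gamma> powr (- \<eta>) * (1 - s * \<gamma>)"
        proof (intro mult_mono)
          show "\<alpha> powr - \<eta> \<le> \<gamma> powr - \<eta>" using \<alpha> \<gamma> \<eta> by (intro powr_mono2') auto
          have "(1 - \<beta>) powr s \<le> 1 - s * \<beta>" using powr_le_tangent[of "1 - \<beta>" s] \<alpha> s by simp
          also have "\<dots> \<le> 1 - s * \<gamma>" using \<alpha> s by simp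
          finally show "(1 - \<beta>) powr s \<le> 1 - s * \<gamma>" .
        qed (use \<alpha> \<gamma> in auto)
        finally show "(\<alpha> * (1 - \<beta>)) powr s \<le> \<alpha> * \<gamma> powr (- \<eta>) * (1 - s * \<gamma>)" .
      qed
      finally have 2: "e A' (B - B') \<le> e A B * (\<alpha> * \<gamma> powr (- \<eta>) * (1 - s * \<gamma>))" .
      \<comment> \<open>Both kinds of edges outside the subpair are bounded above by maximality, so
        enough edges remain inside it.\<close>
      have "e A B = e (A - A') B + e A' (B - B') + e A' B'"
        using e_split1[OF A'(1), of B] e_split2[OF B'(1), of A'] by simp
      then have "e A B * \<alpha> * (s - \<gamma> powr (- \<eta>) * (1 - s * \<gamma>)) \<le> e A' B'"
        using 1 2 by (simp add: algebra_simps)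
      moreover have "e A B * \<rho> \<le> e A B * \<alpha> * (s - \<gamma> powr (- \<eta>) * (1 - s * \<gamma>))"
      proof -
        have "\<gamma> * (\<gamma> / 2) \<le> \<alpha> * (s - \<gamma> powr (- \<eta>) * (1 - s * \<gamma>))"
          using \<eta>(3) \<alpha> \<gamma> unfolding s_def by (intro mult_mono) auto
        then show ?thesis unfolding \<rho>_def using e0 by (simp add: mult_left_mono mult.assoc)
      qed
      ultimately show "\<rho> * real (card (F \<inter> A \<times> B)) \<le> real (card (F \<inter> A' \<times> B'))"
        unfolding e_def by (simp add: mult.commute)
    qed
    ultimately show ?thesis using sub unfolding e_def by blast
  qed
  show ?thesis
    by (rule exI[of _ \<rho>], rule conjI[OF pos(1)], rule exI[of _ \<sigma>], rule conjI[OF pos(2)],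
      intro allI impI, elim conjE) (rule main)
qed

section \<open>Embedding into tripartite systems\<close>

text \<open>Every pair in \<open>F\<close> carries one selected triple. As the three parts are
  disjoint, the triple reveals its pair, so using different pairs already guarantees different
  hyperedges.\<close>

locale tripartite_system =
  fixes H :: "'b hypergraph" and X Y Z :: "'b set" and F :: "('b \<times> 'b) set" and \<zeta> :: "'b \<Rightarrow> 'b \<Rightarrow> 'b"
  assumes hyp: "hypergraph H"
    and sub: "X \<subseteq> verts H" "Y \<subseteq> verts H" "Z \<subseteq> verts H"
    and disj: "X \<inter> Y = {}" "X \<inter> Z = {}" "Y \<inter> Z = {}"
    and F: "F \<subseteq> X \<times> Y"
    and \<zeta>: "\<And>x y. (x, y) \<in> F \<Longrightarrow> \<zeta> x y \<in> Z \<and> {x, y, \<zeta> x y} \<in> edges H"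
begin

lemma swap: "tripartite_system H Y X Z (F\<inverse>) (\<lambda>y x. \<zeta> x y)"
proof
  show "F\<inverse> \<subseteq> Y \<times> X" using F by auto
  show "\<zeta> x y \<in> Z \<and> {y, x, \<zeta> x y} \<in> edges H" if "(y, x) \<in> F\<inverse>" for x y
    using \<zeta>[of x y] that by (simp add: insert_commute)
qed (use hyp sub disj in auto)

lemma fin: "finite X" "finite Y" "finite Z"
  using hyp sub finite_subset unfolding hypergraph_def by blast+

lemma edge_determines_pair:
  assumes "(x, y) \<in> F" "(x', y') \<in> F" "{x, y, \<zeta> x y} = {x', y', \<zeta> x' y'}"
  shows "x = x' \<and> y = y'"
proof -
  have "\<zeta> x y \<in> Z" "\<zeta> x' y' \<in> Z" "x \<in> X" "x' \<in> X" "y \<in> Y" "y' \<in> Y"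
    using \<zeta> assms F by auto
  then have "x \<noteq> y'" "x \<noteq> \<zeta> x' y'" "y \<noteq> x'" "y \<noteq> \<zeta> x' y'" using disj by auto
  moreover have "x \<in> {x', y', \<zeta> x' y'}" "y \<in> {x', y', \<zeta> x' y'}" unfolding assms(3)[symmetric] by auto
  ultimately show ?thesis by simp
qed

text \<open>The vertex \<open>v\<close> goes to \<open>z\<close>, its neighbours to \<open>S\<close>
  and \<open>R\<close>, and the other vertices to \<open>X'\<close> and \<open>Y'\<close>, according
  to the bipartition of \<open>G - v\<close>. Nothing is required between \<open>S\<close> and
  \<open>R\<close>, since neighbours of \<open>v\<close> are not adjacent. The edge from
  \<open>v\<close> to a neighbour placed at \<open>x\<close> in \<open>S\<close> uses the triple on
  \<open>x\<close>, \<open>p x\<close> and \<open>z\<close>; since \<open>p x\<close> avoids the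
  image of the opposite part, no edge of \<open>G - v\<close> uses this pair. The role of
  \<open>q\<close> is symmetric.\<close>

lemma not_berge_free_cone:
  fixes G :: "'a hypergraph"
  assumes G: "simple_graph G" "triangle_free G" and v: "bipartite (delete_vertex G v)" "v \<in> verts G"
    and z: "z \<in> Z"
    and S: "S \<subseteq> X" "X' \<subseteq> X" "S \<inter> X' = {}" "R \<subseteq> Y" "Y' \<subseteq> Y" "R \<inter> Y' = {}"
    and card: "card (verts G) \<le> card S" "card (verts G) \<le> card X'"
      "card (verts G) \<le> card R" "card (verts G) \<le> card Y'"
    and FF: "S \<times> Y' \<subseteq> F" "X' \<times> R \<subseteq> F" "X' \<times> Y' \<subseteq> F"
    and p: "\<And>x. x \<in> S \<Longrightarrow> (x, p x) \<in> F \<and> \<zeta> x (p x) = z \<and> p x \<notin> R \<union> Y'"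
    and q: "\<And>y. y \<in> R \<Longrightarrow> (q y, y) \<in> F \<and> \<zeta> (q y) y = z \<and> q y \<notin> S \<union> X'"
  shows "\<not> berge_free G H"
proof -
  obtain U1 U2 where U: "U1 \<union> U2 = verts G - {v}" "U1 \<inter> U2 = {}"
    and bip: "\<And>e. e \<in> edges G \<Longrightarrow> v \<notin> e \<Longrightarrow> \<exists>a\<in>U1. \<exists>b\<in>U2. e = {a, b}"
  proof -
    obtain U1 U2 where "bipartition (delete_vertex G v) U1 U2" using v unfolding bipartite_def by blast
    then have "U1 \<union> U2 = verts G - {v}" "U1 \<inter> U2 = {}"
      "\<And>e. e \<in> edges G \<Longrightarrow> v \<notin> e \<Longrightarrow> \<exists>a\<in>U1. \<exists>b\<in>U2. e = {a, b}"
      by (simp_all add: bipartition_def delete_vertex_def verts_def edges_def)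
    then show thesis by (rule that)
  qed
  define N where "N = {u. {v, u} \<in> edges G}"
  have finV: "finite (verts G)" using simple_graphD(1)[OF G(1)] .
  have finS: "finite S" "finite X'" "finite R" "finite Y'" using S fin finite_subset by blast+
  obtain f1 where f1: "f1 ` verts G \<subseteq> S" "inj_on f1 (verts G)" using card_le_inj[OF finV finS(1) card(1)] by blast
  obtain f2 where f2: "f2 ` verts G \<subseteq> X'" "inj_on f2 (verts G)" using card_le_inj[OF finV finS(2) card(2)] by blast
  obtain f3 where f3: "f3 ` verts G \<subseteq> R" "inj_on f3 (verts G)" using card_le_inj[OF finV finS(3) card(3)] by blast
  obtain f4 where f4: "f4 ` verts G \<subseteq> Y'" "inj_on f4 (verts G)" using card_le_inj[OF finV finS(4) card(4)] by blast
  define i where "i u = (if u = v then z else if u \<in> U1 then (if u \<in> N then f1 u else f2 u)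
    else (if u \<in> N then f3 u else f4 u))" for u
  have UV: "a \<in> verts G \<and> a \<noteq> v" if "a \<in> U1 \<union> U2" for a using U that by auto
  have iv: "i v = z" unfolding i_def by simp
  have i1: "i a = f1 a \<and> i a \<in> S" if "a \<in> U1" "a \<in> N" for a using that UV[of a] f1 unfolding i_def by auto
  have i2: "i a = f2 a \<and> i a \<in> X'" if "a \<in> U1" "a \<notin> N" for a using that UV[of a] f2 unfolding i_def by auto
  have i3: "i a = f3 a \<and> i a \<in> R" if "a \<in> U2" "a \<in> N" for a using that UV[of a] U(2) f3 unfolding i_def by auto
  have i4: "i a = f4 a \<and> i a \<in> Y'" if "a \<in> U2" "a \<notin> N" for a using that UV[of a] U(2) f4 unfolding i_def by auto
  have iU1: "i a \<in> S \<union> X'" if "a \<in> U1" for a using i1 i2 that by blast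
  have iU2: "i a \<in> R \<union> Y'" if "a \<in> U2" for a using i3 i4 that by blast
  have inj1: "inj_on i U1"
  proof (rule inj_onI)
    fix a b assume ab: "a \<in> U1" "b \<in> U1" "i a = i b"
    have "a \<in> N \<longleftrightarrow> b \<in> N" using i1[of a] i2[of a] i1[of b] i2[of b] ab S(3) by fastforce
    then show "a = b"
      using ab i1[of a] i2[of a] i1[of b] i2[of b] UV[of a] UV[of b] f1(2) f2(2) by (cases "a \<in> N") (auto dest: inj_onD)
  qed
  have inj2: "inj_on i U2"
  proof (rule inj_onI)
    fix a b assume ab: "a \<in> U2" "b \<in> U2" "i a = i b"
    have "a \<in> N \<longleftrightarrow> b \<in> N" using i3[of a] i4[of a] i3[of b] i4[of b] ab S(6) by fastforce
    then show "a = b"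
      using ab i3[of a] i4[of a] i3[of b] i4[of b] UV[of a] UV[of b] f3(2) f4(2) by (cases "a \<in> N") (auto dest: inj_onD)
  qed
  have iX: "i ` U1 \<subseteq> X" using iU1 S by blast
  have iY: "i ` U2 \<subseteq> Y" using iU2 S by blast
  have verts_eq: "verts G = insert v (U1 \<union> U2)" using U(1) v(2) by blast
  have iF: "(i a, i b) \<in> F" if ab: "a \<in> U1" "b \<in> U2" "{a, b} \<in> edges G" for a b
  proof -
    have "\<not> (a \<in> N \<and> b \<in> N)" using G(2) ab(3) unfolding N_def triangle_free_def by blast
    then consider "a \<in> N" "b \<notin> N" | "a \<notin> N" "b \<in> N" | "a \<notin> N" "b \<notin> N" by blast
    then show ?thesis
      by cases (use i1[of a] i2[of a] i3[of b] i4[of b] ab FF in blast)+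
  qed
  have aN: "(i a, p (i a)) \<in> F \<and> \<zeta> (i a) (p (i a)) = z \<and> p (i a) \<notin> i ` U2" if "a \<in> U1" "a \<in> N" for a
  proof -
    have "i ` U2 \<subseteq> R \<union> Y'" using iU2 by auto
    then show ?thesis using p[of "i a"] i1[OF that] by auto
  qed
  have bN: "(q (i b), i b) \<in> F \<and> \<zeta> (q (i b)) (i b) = z \<and> q (i b) \<notin> i ` U1" if "b \<in> U2" "b \<in> N" for b
  proof -
    have "i ` U1 \<subseteq> S \<union> X'" using iU1 by auto
    then show ?thesis using q[of "i b"] i3[OF that] by auto
  qed
  define P where "P e h \<longleftrightarrow>
    (\<exists>a\<in>U1. \<exists>b\<in>U2. e = {a, b} \<and> h = {i a, i b, \<zeta> (i a) (i b)}) \<or>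
    (\<exists>a\<in>U1 \<inter> N. e = {v, a} \<and> h = {i a, p (i a), \<zeta> (i a) (p (i a))}) \<or>
    (\<exists>b\<in>U2 \<inter> N. e = {v, b} \<and> h = {q (i b), i b, \<zeta> (q (i b)) (i b)})" for e h
  show ?thesis
  proof (rule not_berge_freeI[where i = i and P = P])
    show "hypergraph H" by (rule hyp)
    show "inj_on i (verts G)"
    proof -
      have "inj_on i (U1 \<union> U2)" using inj1 inj2 iX iY disj(1) by (intro inj_on_Un[THEN iffD2]) blast
      moreover have "z \<notin> i ` (U1 \<union> U2)" using iX iY z disj by blast
      ultimately show ?thesis unfolding verts_eq using iv by auto
    qed
    show "i ` verts G \<subseteq> verts H" unfolding verts_eq using iX iY iv z sub by auto
  next
    fix e assume e: "e \<in> edges G"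
    show "\<exists>h\<in>edges H. i ` e \<subseteq> h \<and> P e h"
    proof (cases "v \<in> e")
      case False
      then obtain a b where ab: "a \<in> U1" "b \<in> U2" "e = {a, b}" using bip[OF e] by blast
      then have "(i a, i b) \<in> F" using iF e by blast
      then show ?thesis using \<zeta> ab by (intro bexI[of _ "{i a, i b, \<zeta> (i a) (i b)}"]) (auto simp: P_def)
    next
      case True
      obtain u where u: "e = {v, u}" "u \<noteq> v" "u \<in> verts G"
      proof -
        obtain x y where xy: "e = {x, y}" "x \<noteq> y" "x \<in> verts G" "y \<in> verts G"
          by (rule simple_graph_edgeE[OF G(1) e])
        then consider "x = v" | "y = v" using True by blast
        then show thesis by cases (use xy that[of x] that[of y] in \<open>auto simp: insert_commute\<close>)
      qed
      then have uN: "u \<in> N" using e unfolding N_def by simp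
      have "u \<in> U1 \<or> u \<in> U2" using u U(1) by blast
      then show ?thesis
      proof
        assume "u \<in> U1"
        then show ?thesis using aN[of u] uN \<zeta>[of "i u" "p (i u)"] u iv
          by (intro bexI[of _ "{i u, p (i u), \<zeta> (i u) (p (i u))}"]) (auto simp: P_def)
      next
        assume "u \<in> U2"
        then show ?thesis using bN[of u] uN \<zeta>[of "q (i u)" "i u"] u iv
          by (intro bexI[of _ "{q (i u), i u, \<zeta> (q (i u)) (i u)}"]) (auto simp: P_def)
      qed
    qed
  next
    fix e e' h assume e: "e \<in> edges G" "e' \<in> edges G" "P e h" "P e' h"
    \<comment> \<open>Each triple is traced back to its pair. A pair in the images of
      \<open>U1\<close> and \<open>U2\<close> belongs to an edge of \<open>G - v\<close>; if only
      one coordinate is in the corresponding image, the edge contains \<open>v\<close> and that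
      coordinate identifies its other end.\<close>
    have kinds: "(\<exists>x y. (x, y) \<in> F \<and> h = {x, y, \<zeta> x y} \<and>
        ((\<exists>a\<in>U1. \<exists>b\<in>U2. e = {a, b} \<and> x = i a \<and> y = i b) \<or>
         (\<exists>a\<in>U1. e = {v, a} \<and> x = i a \<and> y \<notin> i ` U2) \<or>
         (\<exists>b\<in>U2. e = {v, b} \<and> y = i b \<and> x \<notin> i ` U1)))" if "e \<in> edges G" "P e h" for e
      using that(2) unfolding P_def
    proof (elim disjE bexE conjE)
      fix a b assume ab: "a \<in> U1" "b \<in> U2" "e = {a, b}" "h = {i a, i b, \<zeta> (i a) (i b)}"
      have "(i a, i b) \<in> F" using iF ab that by blast
      then show ?thesis using ab by blast
    next
      fix a assume ab: "a \<in> U1 \<inter> N" "e = {v, a}" "h = {i a, p (i a), \<zeta> (i a) (p (i a))}"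
      have "(i a, p (i a)) \<in> F" "p (i a) \<notin> i ` U2" using aN[of a] ab by auto
      then show ?thesis using ab by blast
    next
      fix b assume ab: "b \<in> U2 \<inter> N" "e = {v, b}" "h = {q (i b), i b, \<zeta> (q (i b)) (i b)}"
      have "(q (i b), i b) \<in> F" "q (i b) \<notin> i ` U1" using bN[of b] ab by auto
      then show ?thesis using ab by blast
    qed
    obtain x y where xy: "(x, y) \<in> F" "h = {x, y, \<zeta> x y}"
        and k: "(\<exists>a\<in>U1. \<exists>b\<in>U2. e = {a, b} \<and> x = i a \<and> y = i b) \<or>
         (\<exists>a\<in>U1. e = {v, a} \<and> x = i a \<and> y \<notin> i ` U2) \<or>
         (\<exists>b\<in>U2. e = {v, b} \<and> y = i b \<and> x \<notin> i ` U1)"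
      using kinds[OF e(1,3)] by (elim exE conjE) (rule that)
    obtain x' y' where xy': "(x', y') \<in> F" "h = {x', y', \<zeta> x' y'}"
        and k': "(\<exists>a\<in>U1. \<exists>b\<in>U2. e' = {a, b} \<and> x' = i a \<and> y' = i b) \<or>
         (\<exists>a\<in>U1. e' = {v, a} \<and> x' = i a \<and> y' \<notin> i ` U2) \<or>
         (\<exists>b\<in>U2. e' = {v, b} \<and> y' = i b \<and> x' \<notin> i ` U1)"
      using kinds[OF e(2,4)] by (elim exE conjE) (rule that)
    have eq: "x' = x" "y' = y" using edge_determines_pair[of x y x' y'] xy xy' by auto
    have j1: "a = a'" if "a \<in> U1" "a' \<in> U1" "i a = i a'" for a a' using inj1 that by (meson inj_onD)
    have j2: "a = a'" if "a \<in> U2" "a' \<in> U2" "i a = i a'" for a a' using inj2 that by (meson inj_onD)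
    show "e = e'" using k
    proof (elim disjE bexE conjE)
      fix a b assume "a \<in> U1" "b \<in> U2" "e = {a, b}" "x = i a" "y = i b"
      then show ?thesis using k' unfolding eq using j1 j2 by blast
    next
      fix a assume "a \<in> U1" "e = {v, a}" "x = i a" "y \<notin> i ` U2"
      then show ?thesis using k' unfolding eq using j1 by blast
    next
      fix b assume "b \<in> U2" "e = {v, b}" "y = i b" "x \<notin> i ` U1"
      then show ?thesis using k' unfolding eq using j2 by blast
    qed
  qed
qed

text \<open>The link of \<open>z\<close> contains all of \<open>A \<times> B\<close>. Each side
  provides two sets for the embedding and one spare vertex, the partner for the whole opposite side;
  hence the \<open>+ 1\<close>.\<close>

lemma not_berge_free_book:
  fixes G :: "'a hypergraph"
  assumes G: "simple_graph G" "triangle_free G" and v: "bipartite (delete_vertex G v)" "v \<in> verts G"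
    and AB: "A \<subseteq> X" "B \<subseteq> Y" "A \<times> B \<subseteq> F" and z: "\<And>x y. x \<in> A \<Longrightarrow> y \<in> B \<Longrightarrow> \<zeta> x y = z"
    and card: "2 * card (verts G) + 1 \<le> card A" "2 * card (verts G) + 1 \<le> card B"
  shows "\<not> berge_free G H"
proof -
  have split: "\<exists>S X' x0. S \<union> X' \<subseteq> A \<and> S \<inter> X' = {} \<and> card S = card (verts G) \<and> card X' = card (verts G) \<and>
    x0 \<in> A \<and> x0 \<notin> S \<union> X'" if "2 * card (verts G) + 1 \<le> card A" "finite A" for A :: "'b set"
  proof -
    let ?m = "card (verts G)"
    have "?m \<le> card A" using that by simp
    then obtain S where S: "S \<subseteq> A" "card S = ?m" "finite S" by (rule obtain_subset_with_card_n)
    have "card (A - S) = card A - ?m" using S by (simp add: card_Diff_subset)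
    then have "?m \<le> card (A - S)" using that by simp
    then obtain X' where X': "X' \<subseteq> A - S" "card X' = ?m" "finite X'" by (rule obtain_subset_with_card_n)
    have "card (S \<union> X') = 2 * ?m" using S X' by (subst card_Un_disjoint) auto
    then have "\<not> A \<subseteq> S \<union> X'" using that S X' card_mono[of "S \<union> X'" A] by auto
    then obtain x0 where "x0 \<in> A" "x0 \<notin> S \<union> X'" by blast
    then show ?thesis using S X' 
      by - (rule exI[of _ S], rule exI[of _ X'], rule exI[of _ x0], auto)
  qed
  have finAB: "finite A" "finite B" using AB fin finite_subset by blast+
  obtain S X' x0 where S: "S \<union> X' \<subseteq> A" "S \<inter> X' = {}" "card S = card (verts G)" "card X' = card (verts G)"
    "x0 \<in> A" "x0 \<notin> S \<union> X'" using split[OF card(1) finAB(1)] by blast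
  obtain R Y' y0 where R: "R \<union> Y' \<subseteq> B" "R \<inter> Y' = {}" "card R = card (verts G)" "card Y' = card (verts G)"
    "y0 \<in> B" "y0 \<notin> R \<union> Y'" using split[OF card(2) finAB(2)] by blast
  have zZ: "z \<in> Z" using z[OF S(5) R(5)] \<zeta>[of x0 y0] AB(3) S(5) R(5) by auto
  show ?thesis
    by (rule not_berge_free_cone[OF G v zZ, of S X' R Y' "\<lambda>_. y0" "\<lambda>_. x0"]) (use S R AB z in auto)
qed

end

text \<open>A normal form: the subgraph \<open>B\<close> is eliminated and, after exchanging the
  parts if necessary, the matching lies in \<open>U1\<close>.\<close>

lemma condition2_partition:
  assumes "condition2 G"
  shows "\<exists>U1 U2. U1 \<union> U2 = verts G \<and> U1 \<inter> U2 = {} \<and>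
    (\<forall>e\<in>edges G. e \<subseteq> U1 \<or> (\<exists>u\<in>U1. \<exists>v\<in>U2. e = {u, v})) \<and>
    (\<forall>e\<in>edges G. \<forall>e'\<in>edges G. e \<subseteq> U1 \<longrightarrow> e' \<subseteq> U1 \<longrightarrow> e \<inter> e' \<noteq> {} \<longrightarrow> e = e')"
proof -
  obtain B U1 U2 where B: "subhypergraph B G" "verts B = verts G" "bipartition B U1 U2"
     "matching (edges G - edges B)" "edges G - edges B \<subseteq> Pow U1 \<or> edges G - edges B \<subseteq> Pow U2"
    using assms unfolding condition2_def by blast
  have main: ?thesis if W: "bipartition B W1 W2" "edges G - edges B \<subseteq> Pow W1" for W1 W2
  proof (rule exI[of _ W1], rule exI[of _ W2], intro conjI ballI impI)
    have U: "W1 \<union> W2 = verts G" "W1 \<inter> W2 = {}" "\<And>e. e \<in> edges B \<Longrightarrow> \<exists>u\<in>W1. \<exists>v\<in>W2. e = {u, v}"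
      using W B(2) unfolding bipartition_def by auto
    show "W1 \<union> W2 = verts G" "W1 \<inter> W2 = {}" using U by auto
    show "e \<subseteq> W1 \<or> (\<exists>u\<in>W1. \<exists>v\<in>W2. e = {u, v})" if "e \<in> edges G" for e
      using U(3)[of e] W(2) that by blast
    have notB: "e \<in> edges G - edges B" if "e \<in> edges G" "e \<subseteq> W1" for e
      using U(2) U(3)[of e] that by blast
    show "e = e'" if "e \<in> edges G" "e' \<in> edges G" "e \<subseteq> W1" "e' \<subseteq> W1" "e \<inter> e' \<noteq> {}" for e e'
      using notB[of e] notB[of e'] B(4) that
      unfolding matching_def pairwise_def disjnt_def by blast
  qed
  have "bipartition B U2 U1"
    using B(3) unfolding bipartition_def by (metis Int_commute Un_commute insert_commute)
  then show ?thesis using main[OF B(3)] main[of U2 U1] B(5) by blast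
qed

text \<open>The triples over \<open>A \<times> B\<close> consist of a pair \<open>x\<close>,
  \<open>w x\<close> and a vertex of \<open>B\<close>, as in the matching construction. Vertices of
  \<open>U2\<close> go to \<open>B\<close> without a reserved vertex \<open>b0\<close>, which
  completes the triples for the matching edges inside \<open>U1\<close>.\<close>

lemma (in tripartite_system) not_berge_free_matching:
  fixes G :: "'a hypergraph"
  assumes G: "simple_graph G" "triangle_free G" "condition2 G"
    and AB: "A \<subseteq> X" "B \<subseteq> Y" "A \<times> B \<subseteq> F" and w: "\<And>x y. x \<in> A \<Longrightarrow> y \<in> B \<Longrightarrow> \<zeta> x y = w x" "inj_on w A"
    and card: "card (verts G) \<le> card A" "card (verts G) + 1 \<le> card B"
  shows "\<not> berge_free G H"
proof -
  obtain U1 U2 where U: "U1 \<union> U2 = verts G" "U1 \<inter> U2 = {}"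
    and kind: "\<And>e. e \<in> edges G \<Longrightarrow> e \<subseteq> U1 \<or> (\<exists>u\<in>U1. \<exists>v\<in>U2. e = {u, v})"
    and mat: "\<And>e e' u. \<lbrakk>e \<in> edges G; e' \<in> edges G; e \<subseteq> U1; e' \<subseteq> U1; u \<in> e; u \<in> e'\<rbrakk> \<Longrightarrow> e = e'"
  proof -
    obtain U1 U2 where *: "U1 \<union> U2 = verts G \<and> U1 \<inter> U2 = {} \<and>
      (\<forall>e\<in>edges G. e \<subseteq> U1 \<or> (\<exists>u\<in>U1. \<exists>v\<in>U2. e = {u, v})) \<and>
      (\<forall>e\<in>edges G. \<forall>e'\<in>edges G. e \<subseteq> U1 \<longrightarrow> e' \<subseteq> U1 \<longrightarrow> e \<inter> e' \<noteq> {} \<longrightarrow> e = e')"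
      using condition2_partition[OF G(3)] by (elim exE)
    show thesis
    proof (rule that[of U1 U2])
      show "e = e'" if "e \<in> edges G" "e' \<in> edges G" "e \<subseteq> U1" "e' \<subseteq> U1" "u \<in> e" "u \<in> e'" for e e' u
        using * that by (meson disjoint_iff)
    qed (use * in simp_all)
  qed
  have finV: "finite (verts G)" using simple_graphD(1)[OF G(1)] .
  have finAB: "finite A" "finite B" using AB fin finite_subset by blast+
  have "B \<noteq> {}" using card(2) by auto
  then obtain b0 where b0: "b0 \<in> B" by blast
  have "card (verts G) \<le> card (B - {b0})" using card(2) b0 finAB by simp
  then obtain g where g: "g ` verts G \<subseteq> B - {b0}" "inj_on g (verts G)"
    using card_le_inj[OF finV, of "B - {b0}"] finAB by blast
  obtain f where f: "f ` verts G \<subseteq> A" "inj_on f (verts G)"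
    using card_le_inj[OF finV finAB(1) card(1)] by blast
  \<comment> \<open>A matching edge inside \<open>U1\<close> is mapped onto one pair \<open>(x, w x)\<close>, its representative to \<open>x\<close>.\<close>
  define C where "C u = insert u (\<Union>{e \<in> edges G. e \<subseteq> U1 \<and> u \<in> e})" for u
  define rep where "rep u = (SOME x. x \<in> C u)" for u
  have C_edge: "C u = e" if "e \<in> edges G" "e \<subseteq> U1" "u \<in> e" for e u
  proof -
    have "{e' \<in> edges G. e' \<subseteq> U1 \<and> u \<in> e'} = {e}" using mat[of e _ u] that by blast
    then show ?thesis unfolding C_def using that by auto
  qed
  have C_cases: "C u = {u} \<or> (\<exists>e\<in>edges G. e \<subseteq> U1 \<and> u \<in> e \<and> C u = e)" for u
  proof (cases "\<exists>e\<in>edges G. e \<subseteq> U1 \<and> u \<in> e")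
    case True
    then show ?thesis using C_edge by blast
  next
    case False
    then show ?thesis unfolding C_def by auto
  qed
  have rep: "rep u \<in> C u" for u unfolding rep_def by (rule someI[of _ u]) (simp add: C_def)
  have C_eq: "C x = C u" if "x \<in> C u" for x u
    using C_cases[of u]
  proof
    assume "\<exists>e\<in>edges G. e \<subseteq> U1 \<and> u \<in> e \<and> C u = e"
    then show ?thesis using C_edge[of _ x] that by auto
  qed (use that in simp)
  have rep_cong: "rep u = rep u'" if "C u = C u'" for u u' using that unfolding rep_def by simp
  have rep_eq: "C u = C u'" if "rep u = rep u'" for u u' using C_eq rep that by metis
  have mates: "u = u' \<or> {u, u'} \<in> edges G \<and> C u = {u, u'}" if eq: "C u = C u'" for u u'
  proof (cases "u = u'")
    case False
    note ne = this
    have "u' \<in> C u" unfolding eq by (simp add: C_def)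
    then obtain e where e: "e \<in> edges G" "e \<subseteq> U1" "u \<in> e" "C u = e" "u' \<in> e" using C_cases[of u] ne by auto
    have "e = {u, u'}" using simple_graph_edgeE[OF G(1) e(1)] e(3,5) ne by (metis doubleton_eq_iff insertE singletonD)
    then show ?thesis using e by blast
  qed simp
  have repV: "rep u \<in> U1" if "u \<in> U1" for u using rep[of u] C_cases[of u] that by auto
  define i where "i u = (if u \<in> U1 then (if rep u = u then f u else w (f (rep u))) else g u)" for u
  have fA: "f (rep u) \<in> A" if "u \<in> U1" for u using repV[OF that] U f by blast
  have gB: "g u \<in> B \<and> g u \<noteq> b0" if "u \<in> U2" for u using that U g by blast
  have finj: "rep u = rep u'" if "u \<in> U1" "u' \<in> U1" "f (rep u) = f (rep u')" for u u'
    using f(2) repV U that by (metis UnI1 inj_onD)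
  have wZ: "w x \<in> Z" if "x \<in> A" for x
    using w(1)[OF that b0] \<zeta>[of x b0] AB(3) that b0 by auto
  have iU1: "i u \<in> {f (rep u), w (f (rep u))}" if "u \<in> U1" for u using that unfolding i_def by auto
  have iU2: "i u = g u" if "u \<in> U2" for u using that U(2) unfolding i_def by auto
  have inj1: "inj_on i U1"
  proof (rule inj_onI)
    fix u u' assume u: "u \<in> U1" "u' \<in> U1" "i u = i u'"
    have XZ: "f (rep a) \<noteq> w (f (rep b))" if "a \<in> U1" "b \<in> U1" for a b
      using fA[OF that(1)] wZ[OF fA[OF that(2)]] AB(1) disj(2) by auto
    consider "rep u = u" "rep u' = u'" | "rep u \<noteq> u" "rep u' \<noteq> u'"
      using u XZ[of u u'] XZ[of u' u] unfolding i_def by (auto split: if_splits)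
    then show "u = u'"
    proof cases
      case 1
      then show ?thesis using u finj[of u u'] unfolding i_def by simp
    next
      case 2
      then have "w (f (rep u)) = w (f (rep u'))" using u unfolding i_def by simp
      then have "rep u = rep u'" using w(2) fA u finj by (meson inj_onD)
      then show ?thesis using mates[OF rep_eq] rep[of u] 2 by force
    qed
  qed
  have iXZ: "i ` U1 \<subseteq> X \<union> Z"
  proof
    fix y assume "y \<in> i ` U1"
    then obtain u where u: "u \<in> U1" "y = i u" by blast
    then show "y \<in> X \<union> Z" using iU1[OF u(1)] fA[OF u(1)] wZ[OF fA[OF u(1)]] AB(1) by auto
  qed
  have iY: "i ` U2 \<subseteq> Y" using iU2 gB AB(2) by auto
  have pF: "(f (rep u), b) \<in> F \<and> \<zeta> (f (rep u)) b = w (f (rep u))" if "u \<in> U1" "b \<in> B" for u b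
    using fA[OF that(1)] that w(1) AB(3) by blast
  define P where "P e h \<longleftrightarrow>
    (\<exists>u\<in>U1. \<exists>v\<in>U2. e = {u, v} \<and> h = {f (rep u), g v, \<zeta> (f (rep u)) (g v)}) \<or>
    (\<exists>u\<in>U1. e \<subseteq> U1 \<and> u \<in> e \<and> h = {f (rep u), b0, \<zeta> (f (rep u)) b0})" for e h
  show ?thesis
  proof (rule not_berge_freeI[where i = i and P = P])
    show "hypergraph H" by (rule hyp)
    have "inj_on i U2" using g(2) iU2 U by (metis (no_types, lifting) UnI2 inj_onD inj_onI)
    then show "inj_on i (verts G)"
      unfolding U(1)[symmetric] using inj1 iXZ iY disj by (intro inj_on_Un[THEN iffD2]) blast
    show "i ` verts G \<subseteq> verts H" unfolding U(1)[symmetric] using iXZ iY sub by blast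
  next
    fix e assume e: "e \<in> edges G"
    show "\<exists>h\<in>edges H. i ` e \<subseteq> h \<and> P e h"
    proof (cases "e \<subseteq> U1")
      case True
      obtain u u' where u: "e = {u, u'}" by (rule simple_graph_edgeE[OF G(1) e])
      have uU: "u \<in> U1" "u' \<in> U1" using True u by auto
      have "C u = e" "C u' = e" using C_edge[OF e True] u by auto
      then have r: "rep u' = rep u" using rep_cong by metis
      let ?h = "{f (rep u), b0, \<zeta> (f (rep u)) b0}"
      have "i ` e \<subseteq> ?h" using u iU1[OF uU(1)] iU1[OF uU(2)] r pF[OF uU(1) b0] by auto
      moreover have "?h \<in> edges H" using pF[OF uU(1) b0] \<zeta> by blast
      moreover have "P e ?h" unfolding P_def using uU True u by blast
      ultimately show ?thesis by blast
    next
      case False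
      then obtain u v where uv: "u \<in> U1" "v \<in> U2" "e = {u, v}" using kind[OF e] by blast
      let ?h = "{f (rep u), g v, \<zeta> (f (rep u)) (g v)}"
      have F': "(f (rep u), g v) \<in> F \<and> \<zeta> (f (rep u)) (g v) = w (f (rep u))" using pF uv gB by blast
      then have "i ` e \<subseteq> ?h" using uv iU1[OF uv(1)] iU2[OF uv(2)] by auto
      moreover have "?h \<in> edges H" using F' \<zeta> by blast
      moreover have "P e ?h" unfolding P_def using uv by blast
      ultimately show ?thesis by blast
    qed
  next
    fix e e' h assume e: "e \<in> edges G" "e' \<in> edges G" and P: "P e h" "P e' h"
    have kinds: "\<exists>u\<in>U1. \<exists>b\<in>B. h = {f (rep u), b, \<zeta> (f (rep u)) b} \<and>
        ((\<exists>v\<in>U2. e = {u, v} \<and> b = g v) \<or> (e \<subseteq> U1 \<and> u \<in> e \<and> b = b0))" if "P e h" for e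
      using that unfolding P_def
    proof (elim disjE bexE conjE)
      fix u v assume "u \<in> U1" "v \<in> U2" "e = {u, v}" "h = {f (rep u), g v, \<zeta> (f (rep u)) (g v)}"
      then show ?thesis using gB[of v] 
        by - (rule bexI[of _ u], rule bexI[of _ "g v"], auto)
    next
      fix u assume "u \<in> U1" "e \<subseteq> U1" "u \<in> e" "h = {f (rep u), b0, \<zeta> (f (rep u)) b0}"
      then show ?thesis using b0 
        by - (rule bexI[of _ u], rule bexI[of _ b0], auto)
    qed
    obtain u b where u: "u \<in> U1" "b \<in> B" "h = {f (rep u), b, \<zeta> (f (rep u)) b}"
      "(\<exists>v\<in>U2. e = {u, v} \<and> b = g v) \<or> (e \<subseteq> U1 \<and> u \<in> e \<and> b = b0)"
      using kinds[OF P(1)] by blast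
    obtain u' b' where u': "u' \<in> U1" "b' \<in> B" "h = {f (rep u'), b', \<zeta> (f (rep u')) b'}"
      "(\<exists>v\<in>U2. e' = {u', v} \<and> b' = g v) \<or> (e' \<subseteq> U1 \<and> u' \<in> e' \<and> b' = b0)"
      using kinds[OF P(2)] by blast
    have eq: "f (rep u) = f (rep u') \<and> b = b'"
      by (rule edge_determines_pair) (use pF[OF u(1,2)] pF[OF u'(1,2)] u(3) u'(3) in simp_all)
    then have C: "C u = C u'" by (intro rep_eq finj[OF u(1) u'(1)]) simp
    have b: "b' = b" using eq by simp
    show "e = e'" using u(4)
    proof (elim disjE bexE conjE)
      fix v assume v: "v \<in> U2" "e = {u, v}" "b = g v"
      then obtain v' where v': "v' \<in> U2" "e' = {u', v'}" "b = g v'" using u'(4) b gB by auto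
      have "v' = v" using v v' g(2) U by (metis UnI2 inj_onD)
      \<comment> \<open>Otherwise \<open>u\<close> and \<open>u'\<close> are the ends of a matching
        edge with common neighbour \<open>v\<close>, a triangle.\<close>
      moreover have "u = u'"
      proof (rule ccontr)
        assume "u \<noteq> u'"
        then have "{u, u'} \<in> edges G" using mates[OF C] by blast
        then show False using G(2) e v v' \<open>v' = v\<close> unfolding triangle_free_def by blast
      qed
      ultimately show ?thesis using v v' by simp
    next
      assume a: "e \<subseteq> U1" "u \<in> e" "b = b0"
      then have a': "e' \<subseteq> U1" "u' \<in> e'" using u'(4) b gB by auto
      show ?thesis using C_edge[OF e(1) a(1,2)] C_edge[OF e(2) a'] C by simp
    qed
  qed
qed

text \<open>Greedy choice: every chosen pair blocks at most \<open>2 * d\<close> pairs, those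
  sharing a coordinate with it, so an unblocked pair remains.\<close>

lemma ex_matching_of_bounded_degree:
  fixes L :: "('a \<times> 'b) set" and d :: real
  assumes L: "finite L" and d: "0 \<le> d"
    "\<And>x y. (x, y) \<in> L \<Longrightarrow> real (card {y'. (x, y') \<in> L}) \<le> d"
    "\<And>x y. (x, y) \<in> L \<Longrightarrow> real (card {x'. (x', y) \<in> L}) \<le> d"
    and k: "2 * d * real k < real (card L)"
  shows "\<exists>M\<subseteq>L. card M = k \<and> inj_on fst M \<and> inj_on snd M"
  using k
proof (induction k)
  case 0
  show ?case by (intro exI[of _ "{}"]) auto
next
  case (Suc k)
  have "2 * d * real k \<le> 2 * d * real (Suc k)" using d(1) by (intro mult_left_mono) auto
  then obtain M where M: "M \<subseteq> L" "card M = k" "inj_on fst M" "inj_on snd M" using Suc by force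
  have finM: "finite M" using M(1) L finite_subset by blast
  define T where "T p = {fst p} \<times> {y'. (fst p, y') \<in> L} \<union> {x'. (x', snd p) \<in> L} \<times> {snd p}" for p
  have fT: "finite {y'. (x, y') \<in> L}" "finite {x'. (x', y) \<in> L}" for x y
    by (rule finite_subset[of _ "snd ` L"], use L in force, use L in simp,
        rule finite_subset[of _ "fst ` L"], use L in force, use L in simp)
  have "real (card (T p)) \<le> 2 * d" if "p \<in> M" for p
  proof -
    have pL: "(fst p, snd p) \<in> L" using that M(1) by auto
    have "card (T p) \<le> card {y'. (fst p, y') \<in> L} + card {x'. (x', snd p) \<in> L}"
      unfolding T_def using card_Un_le[of "{fst p} \<times> {y'. (fst p, y') \<in> L}" "{x'. (x', snd p) \<in> L} \<times> {snd p}"]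
      by (simp add: card_cartesian_product)
    then show ?thesis using d(2)[OF pL] d(3)[OF pL] by linarith
  qed
  then have "(\<Sum>p\<in>M. real (card (T p))) \<le> real k * (2 * d)"
    using sum_bounded_above[of M "\<lambda>p. real (card (T p))" "2 * d"] M(2) by simp
  moreover have "real (card (\<Union>p\<in>M. T p)) \<le> (\<Sum>p\<in>M. real (card (T p)))"
    using card_UN_le[OF finM, of T] by (metis of_nat_le_iff of_nat_sum)
  moreover have "2 * d * real (Suc k) = real k * (2 * d) + 2 * d" by (simp add: algebra_simps)
  ultimately have "card (\<Union>p\<in>M. T p) < card L" using Suc.prems d(1) by linarith
  moreover have "finite (\<Union>p\<in>M. T p)" using finM fT unfolding T_def by auto
  ultimately have "\<not> L \<subseteq> (\<Union>p\<in>M. T p)" using card_mono by (metis not_le)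
  then obtain x y where xy: "(x, y) \<in> L" "\<And>p. p \<in> M \<Longrightarrow> (x, y) \<notin> T p" by force
  have new: "x \<noteq> fst p" "y \<noteq> snd p" if "p \<in> M" for p
    using xy(2)[OF that] xy(1) unfolding T_def by auto
  then have "(x, y) \<notin> M" by force
  then have "card (insert (x, y) M) = Suc k" using finM M(2) by simp
  moreover have "inj_on fst (insert (x, y) M)" "inj_on snd (insert (x, y) M)"
    using M(3,4) new by (auto simp: inj_on_insert)
  ultimately show ?case using M(1) xy(1) by (intro exI[of _ "insert (x, y) M"]) auto
qed

section \<open>Dense tripartite systems: heavy and light pairs\<close>

context tripartite_system begin

text \<open>The third vertex is a function \<open>w\<close> of \<open>x\<close> alone. Either
  \<open>w\<close> has a large fibre, which gives a book, or it takes many values, which gives a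
  matching; the square in the bound on \<open>card A\<close> pays for this pigeonhole step.\<close>

lemma not_berge_free_book_or_matching:
  fixes G :: "'a hypergraph"
  assumes G: "simple_graph G" "triangle_free G" "condition2 G"
    and v: "bipartite (delete_vertex G v)" "v \<in> verts G"
    and AB: "A \<subseteq> X" "B \<subseteq> Y" "A \<times> B \<subseteq> F"
    and const: "\<And>x y y'. x \<in> A \<Longrightarrow> y \<in> B \<Longrightarrow> y' \<in> B \<Longrightarrow> \<zeta> x y = \<zeta> x y'"
    and card: "(2 * card (verts G) + 1)\<^sup>2 \<le> card A" "2 * card (verts G) + 1 \<le> card B"
  shows "\<not> berge_free G H"
proof -
  define m where "m = 2 * card (verts G) + 1"
  have m: "1 \<le> m" "card (verts G) + 1 \<le> m" "m \<le> card B" "m * m \<le> card A"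
    unfolding m_def using card by (auto simp: power2_eq_square)
  have "B \<noteq> {}" using m by auto
  then obtain y0 where y0: "y0 \<in> B" by blast
  define w where "w x = \<zeta> x y0" for x
  have w: "\<zeta> x y = w x" if "x \<in> A" "y \<in> B" for x y unfolding w_def using const that y0 by blast
  have finA: "finite A" using AB fin finite_subset by blast
  have "A \<noteq> {}" using m by auto
  then obtain z where z: "z \<in> w ` A" "card A \<le> card (w ` A) * card {x \<in> A. w x = z}"
    using pigeonhole_fibre[of A "w ` A" w] finA by auto
  show ?thesis
  proof (cases "m \<le> card {x \<in> A. w x = z}")
    case True
    show ?thesis
      by (rule not_berge_free_book[OF G(1,2) v, of "{x \<in> A. w x = z}" B z])
        (use AB w True m(3) m_def in auto)
  next
    case False
    have "m \<le> card (w ` A)"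
    proof (rule ccontr)
      assume "\<not> m \<le> card (w ` A)"
      then have "card (w ` A) * card {x \<in> A. w x = z} < m * m"
        using False by (intro mult_strict_mono) auto
      then show False using z(2) m(4) by linarith
    qed
    obtain A1 where A1: "A1 \<subseteq> A" "inj_on w A1" "w ` A = w ` A1" by (metis subset_image_inj subset_refl)
    then have "card A1 = card (w ` A)" by (simp add: card_image)
    then have "m \<le> card A1" using \<open>m \<le> card (w ` A)\<close> by simp
    then show ?thesis
      using A1 AB w m by (intro not_berge_free_matching[OF G, of A1 B w]) auto
  qed
qed

text \<open>The pairs \<open>(x, \<zeta> x y)\<close> form one side of an auxiliary bipartite graph
  towards \<open>Y\<close>. Each accounts for at least \<open>\<delta> * n\<close> pairs of
  \<open>F\<close>, without overlap, so there are at most \<open>n / \<delta>\<close> of them and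
  the auxiliary graph is dense. On a complete bipartite piece of it, \<open>\<zeta> x y\<close> does
  not depend on \<open>y\<close>. The hypothesis \<open>kst\<close> allows \<open>K\<close> to be
  fixed before the system.\<close>

lemma not_berge_free_heavy:
  fixes G :: "'a hypergraph" and n b \<delta> K :: real
  assumes G: "simple_graph G" "triangle_free G" "condition2 G"
    and v: "bipartite (delete_vertex G v)" "v \<in> verts G"
    and n: "real (card X) \<le> n" "real (card Y) \<le> n" "0 < n"
    and D: "D \<subseteq> F" "b * n\<^sup>2 \<le> real (card D)" and \<delta>: "0 < \<delta>"
    and heavy: "\<And>x y. (x, y) \<in> D \<Longrightarrow> \<delta> * n \<le> real (card {y' \<in> Y. (x, y') \<in> F \<and> \<zeta> x y' = \<zeta> x y})"
    and kst: "\<And>(P :: ('b \<times> 'b) set) (Q :: 'b set) E M N. \<lbrakk>finite P; finite Q; real (card P) \<le> M;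
      real (card Q) \<le> N; E \<subseteq> P \<times> Q; b * \<delta> * M * N \<le> real (card E); K \<le> M; K \<le> N\<rbrakk> \<Longrightarrow>
      \<exists>A\<subseteq>P. \<exists>B\<subseteq>Q. card A = (2 * card (verts G) + 1)\<^sup>2 \<and> card B = (2 * card (verts G) + 1)\<^sup>2 \<and> A \<times> B \<subseteq> E"
    and K: "K \<le> n" "K \<le> n / \<delta>"
  shows "\<not> berge_free G H"
proof -
  define P where "P = (\<lambda>(x, y). (x, \<zeta> x y)) ` D"
  define C where "C = (\<lambda>(x, z). {y \<in> Y. (x, y) \<in> F \<and> \<zeta> x y = z})"
  define E where "E = (\<lambda>(x, y). ((x, \<zeta> x y), y)) ` D"
  have finF: "finite F" using F fin by (meson finite_SigmaI finite_subset)
  have finD: "finite D" using D finF finite_subset by blast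
  have finP: "finite P" unfolding P_def using finD by simp
  have C: "\<delta> * n \<le> real (card (C p))" "finite (C p)" if "p \<in> P" for p
    using that heavy fin unfolding P_def C_def by auto
  have "card (Sigma P C) \<le> card F"
  proof (rule card_inj_on_le[where f = "\<lambda>((x, z), y). (x, y)"])
    show "inj_on (\<lambda>((x, z), y). (x, y)) (Sigma P C)" unfolding inj_on_def C_def by auto
  qed (use finF in \<open>auto simp: C_def\<close>)
  then have "(\<Sum>p\<in>P. card (C p)) \<le> card F" using C finP by (simp add: card_SigmaI)
  then have "(\<Sum>p\<in>P. real (card (C p))) \<le> real (card F)" by (metis of_nat_le_iff of_nat_sum)
  moreover have "real (card P) * (\<delta> * n) \<le> (\<Sum>p\<in>P. real (card (C p)))"
    using sum_mono[of P "\<lambda>_. \<delta> * n" "\<lambda>p. real (card (C p))"] C by simp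
  moreover have "real (card F) \<le> n * n"
  proof -
    have "card F \<le> card (X \<times> Y)" using F fin by (intro card_mono) auto
    then have "real (card F) \<le> real (card (X \<times> Y))" by (rule of_nat_mono)
    also have "\<dots> \<le> n * n" using n by (auto simp: card_cartesian_product intro!: mult_mono)
    finally show ?thesis .
  qed
  ultimately have "real (card P) * \<delta> * n \<le> n * n" by simp
  then have "real (card P) * \<delta> \<le> n" using n(3) by simp
  then have cP: "real (card P) \<le> n / \<delta>" using \<delta> by (simp add: pos_le_divide_eq)
  have EP: "E \<subseteq> P \<times> Y" unfolding E_def P_def using D F by force
  have "inj_on (\<lambda>(x, y). ((x, \<zeta> x y), y)) D" unfolding inj_on_def by auto
  then have cE: "card E = card D" unfolding E_def by (rule card_image)
  have "b * \<delta> * (n / \<delta>) * n \<le> real (card E)" unfolding cE using D(2) \<delta> by (simp add: power2_eq_square)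
  then obtain A B where AB: "A \<subseteq> P" "B \<subseteq> Y" "card A = (2 * card (verts G) + 1)\<^sup>2"
    "card B = (2 * card (verts G) + 1)\<^sup>2" "A \<times> B \<subseteq> E"
    using kst[OF finP fin(2) cP n(2) EP _ K(2,1)] by blast
  have ABD: "(x, y) \<in> D \<and> z = \<zeta> x y" if "(x, z) \<in> A" "y \<in> B" for x y z
    using that AB(5) unfolding E_def by auto
  have "B \<noteq> {}" using AB(4) by auto
  \<comment> \<open>For any fixed \<open>y\<close> in \<open>B\<close>, the second coordinate of an
    element of \<open>A\<close> is determined as \<open>\<zeta> x y\<close>.\<close>
  then have "inj_on fst A" using ABD unfolding inj_on_def by (metis equals0I prod.collapse)
  then have cA: "card (fst ` A) = (2 * card (verts G) + 1)\<^sup>2" using AB(3) by (simp add: card_image)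
  have sq: "2 * card (verts G) + 1 \<le> (2 * card (verts G) + 1)\<^sup>2" by (simp add: power2_eq_square)
  show ?thesis
  proof (rule not_berge_free_book_or_matching[OF G v, of "fst ` A" B])
    have "fst ` P \<subseteq> X" using D(1) F unfolding P_def by auto
    then show "fst ` A \<subseteq> X" using AB(1) by blast
    show "B \<subseteq> Y" by (rule AB(2))
    show "fst ` A \<times> B \<subseteq> F" using ABD D(1) by auto
    show "\<zeta> x y = \<zeta> x y'" if "x \<in> fst ` A" "y \<in> B" "y' \<in> B" for x y y' using ABD that by fastforce
  qed (use cA AB(4) sq in auto)
qed

text \<open>Left ends of one half of \<open>M\<close> and right ends of the other half have large
  common neighbourhoods by the minimum degree clauses. Regularity puts many edges between these
  neighbourhoods, so they contain a complete bipartite piece, and \<open>not_berge_free_cone\<close>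
  applies with the matching partners as \<open>p\<close> and \<open>q\<close>.\<close>

lemma not_berge_free_link_matching:
  fixes G :: "'a hypergraph" and c n \<rho> \<sigma> K :: real and k :: nat
  assumes G: "simple_graph G" "triangle_free G"
    and v: "bipartite (delete_vertex G v)" "v \<in> verts G"
    and n: "real (card X) \<le> n" "real (card Y) \<le> n" "0 < n"
    and c: "0 < c" and k: "real (card (verts G)) \<le> c / 4 * real k" "0 < k" and \<rho>: "0 < \<rho>"
    and AB: "A \<subseteq> X" "B \<subseteq> Y" "lower_regular F A B c (c / 4 / 2 ^ k) \<rho>"
    and dens: "\<sigma> * n\<^sup>2 \<le> real (card (F \<inter> A \<times> B))"
    and M: "M \<subseteq> F \<inter> A \<times> B" "card M = 2 * k" "inj_on fst M" "inj_on snd M"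
      "\<And>x y. (x, y) \<in> M \<Longrightarrow> \<zeta> x y = z"
    and kst: "\<And>(P :: 'b set) (Q :: 'b set) E M N. \<lbrakk>finite P; finite Q; real (card P) \<le> M;
      real (card Q) \<le> N; E \<subseteq> P \<times> Q; \<rho> * \<sigma> / 2 * M * N \<le> real (card E); K \<le> M; K \<le> N\<rbrakk> \<Longrightarrow>
      \<exists>A\<subseteq>P. \<exists>B\<subseteq>Q. card A = card (verts G) \<and> card B = card (verts G) \<and> A \<times> B \<subseteq> E"
    and K: "K \<le> n" "4 * real k \<le> \<rho> * \<sigma> / 2 * n"
  shows "\<not> berge_free G H"
proof -
  have finAB: "finite A" "finite B" using AB fin finite_subset by blast+
  have finF: "finite F" using F fin by (meson finite_SigmaI finite_subset)
  have finM: "finite M" using M(1) finF finite_subset by blast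
  have "M \<noteq> {}" using M(2) k(2) by auto
  then have ne: "A \<noteq> {}" "B \<noteq> {}" using M(1) by auto
  have "k \<le> card M" using M(2) by simp
  \<comment> \<open>The two halves ensure that a partner of a vertex of \<open>S\<close> never lies
    in \<open>R\<close>, and conversely.\<close>
  then obtain M1 where M1: "M1 \<subseteq> M" "card M1 = k" "finite M1" by (rule obtain_subset_with_card_n)
  define M2 where "M2 = M - M1"
  have M2: "M2 \<subseteq> M" "card M2 = k" "finite M2" "M1 \<inter> M2 = {}"
    unfolding M2_def using M(2) M1 finM by (auto simp: card_Diff_subset)
  have ne1: "M1 \<noteq> {}" "M2 \<noteq> {}" using M1 M2 k(2) by auto
  have MAB: "fst p \<in> A \<and> snd p \<in> B \<and> (fst p, snd p) \<in> F" if "p \<in> M" for p using that M(1) by auto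
  have pos: "real (card A) > 0" "real (card B) > 0" using ne finAB by (auto simp: card_gt_0_iff)
  have c4: "c / 2 / 2 / 2 ^ k = c / 4 / 2 ^ k" "c / 2 / 2 = c / 4" by simp_all
  have "\<exists>J\<subseteq>M1. card (verts G) \<le> card J \<and> c / 2 / 2 / 2 ^ card M1 * real (card B) \<le>
      real (card {y \<in> B. \<forall>p\<in>J. y \<in> {y \<in> B. (fst p, y) \<in> F}})"
  proof (rule common_neighbourhood)
    show "c / 2 * real (card B) \<le> real (card {y \<in> B. (fst p, y) \<in> F})" if "p \<in> M1" for p
      using AB(3) MAB[of p] that M1(1) unfolding lower_regular_def by auto
  qed (use M1 ne1 finAB pos c k in auto)
  then obtain J1 where J1: "J1 \<subseteq> M1" "card (verts G) \<le> card J1"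
    "c / 4 / 2 ^ k * real (card B) \<le> real (card {y \<in> B. \<forall>p\<in>J1. y \<in> {y \<in> B. (fst p, y) \<in> F}})"
    unfolding M1(2) c4 by blast
  have "\<exists>J\<subseteq>M2. card (verts G) \<le> card J \<and> c / 2 / 2 / 2 ^ card M2 * real (card A) \<le>
      real (card {x \<in> A. \<forall>p\<in>J. x \<in> {x \<in> A. (x, snd p) \<in> F}})"
  proof (rule common_neighbourhood)
    show "c / 2 * real (card A) \<le> real (card {x \<in> A. (x, snd p) \<in> F})" if "p \<in> M2" for p
      using AB(3) MAB[of p] that M2(1) unfolding lower_regular_def by auto
  qed (use M2 ne1 finAB pos c k in auto)
  then obtain J2 where J2: "J2 \<subseteq> M2" "card (verts G) \<le> card J2"
    "c / 4 / 2 ^ k * real (card A) \<le> real (card {x \<in> A. \<forall>p\<in>J2. x \<in> {x \<in> A. (x, snd p) \<in> F}})"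
    unfolding M2(2) c4 by blast
  define Y0 where "Y0 = {y \<in> B. \<forall>p\<in>J1. y \<in> {y \<in> B. (fst p, y) \<in> F}}"
  define X0 where "X0 = {x \<in> A. \<forall>p\<in>J2. x \<in> {x \<in> A. (x, snd p) \<in> F}}"
  have sub0: "X0 \<subseteq> A" "Y0 \<subseteq> B" unfolding X0_def Y0_def by auto
  have reg: "\<rho> * real (card (F \<inter> A \<times> B)) \<le> real (card (F \<inter> X0 \<times> Y0))"
    using AB(3) sub0 J1(3) J2(3) unfolding lower_regular_def X0_def[symmetric] Y0_def[symmetric] by blast
  \<comment> \<open>Removing all matching ends keeps the partners outside \<open>X'\<close> and
    \<open>Y'\<close>. It costs at most \<open>4 * k * n\<close> edges, at most half of the
    \<open>\<rho> * \<sigma> * n ^ 2\<close> that regularity guarantees.\<close>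
  define X1 where "X1 = X0 - fst ` M"
  define Y1 where "Y1 = Y0 - snd ` M"
  define E where "E = F \<inter> X1 \<times> Y1"
  have sub1: "X1 \<subseteq> X" "Y1 \<subseteq> Y" unfolding X1_def Y1_def using sub0 AB by auto
  have "F \<inter> X0 \<times> Y0 \<subseteq> E \<union> (fst ` M \<times> Y \<union> X \<times> snd ` M)"
    unfolding E_def X1_def Y1_def using F by auto
  then have "card (F \<inter> X0 \<times> Y0) \<le> card (E \<union> (fst ` M \<times> Y \<union> X \<times> snd ` M))"
    using finM fin finF by (intro card_mono) (auto simp: E_def)
  also have "\<dots> \<le> card E + (card (fst ` M \<times> Y) + card (X \<times> snd ` M))"
    by (meson add_left_mono card_Un_le le_trans)
  also have "\<dots> = card E + (2 * k * card Y + card X * (2 * k))"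
    using M by (simp add: card_cartesian_product card_image)
  finally have "real (card (F \<inter> X0 \<times> Y0)) \<le> real (card E + (2 * k * card Y + card X * (2 * k)))"
    by (rule of_nat_mono)
  also have "\<dots> \<le> real (card E) + 4 * real k * n"
  proof -
    have "real k * real (card Y) \<le> real k * n" "real k * real (card X) \<le> real k * n"
      using n by (auto intro!: mult_left_mono)
    then show ?thesis by (simp add: algebra_simps)
  qed
  also have "\<dots> \<le> real (card E) + \<rho> * \<sigma> / 2 * n * n"
    using mult_right_mono[OF K(2), of n] n by simp
  finally have "real (card (F \<inter> X0 \<times> Y0)) \<le> real (card E) + \<rho> * \<sigma> / 2 * n * n" .
  moreover have "\<rho> * (\<sigma> * n\<^sup>2) \<le> \<rho> * real (card (F \<inter> A \<times> B))" using dens \<rho> by (intro mult_left_mono) auto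
  moreover have "\<rho> * (\<sigma> * n\<^sup>2) = 2 * (\<rho> * \<sigma> / 2 * n * n)" by (simp add: power2_eq_square)
  ultimately have "\<rho> * \<sigma> / 2 * n * n \<le> real (card E)" using reg by linarith
  moreover have "finite X1" "finite Y1" using sub1 fin finite_subset by blast+
  moreover have "real (card X1) \<le> n" "real (card Y1) \<le> n"
    using card_mono[OF fin(1) sub1(1)] card_mono[OF fin(2) sub1(2)] n by linarith+
  moreover have "E \<subseteq> X1 \<times> Y1" unfolding E_def by auto
  ultimately have "\<exists>A\<subseteq>X1. \<exists>B\<subseteq>Y1. card A = card (verts G) \<and> card B = card (verts G) \<and> A \<times> B \<subseteq> E"
    using K(1) by (intro kst[of X1 Y1 n n E])
  then obtain X' Y' where XY': "X' \<subseteq> X1" "Y' \<subseteq> Y1" "card X' = card (verts G)" "card Y' = card (verts G)" "X' \<times> Y' \<subseteq> E"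
    by blast
  define p where "p x = (SOME y. (x, y) \<in> M)" for x
  define q where "q y = (SOME x. (x, y) \<in> M)" for y
  have pM: "p (fst a) = snd a" if a: "a \<in> M" for a
  proof -
    have "(fst a, p (fst a)) \<in> M" unfolding p_def by (rule someI[of _ "snd a"]) (use a in simp)
    then show ?thesis using M(3) a by (metis fst_conv inj_onD snd_conv)
  qed
  have qM: "q (snd a) = fst a" if a: "a \<in> M" for a
  proof -
    have "(q (snd a), snd a) \<in> M" unfolding q_def by (rule someI[of _ "fst a"]) (use a in simp)
    then show ?thesis using M(4) a by (metis fst_conv inj_onD snd_conv)
  qed
  have J1M: "J1 \<subseteq> M" "J2 \<subseteq> M" "J1 \<inter> J2 = {}" using J1(1) J2(1) M1(1) M2(1,4) by auto
  obtain a0 where "a0 \<in> M" using \<open>M \<noteq> {}\<close> by blast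
  then have zZ: "z \<in> Z" using M(5)[of "fst a0" "snd a0"] \<zeta>[of "fst a0" "snd a0"] MAB[of a0] by auto
  show ?thesis
  proof (rule not_berge_free_cone[OF G v zZ, of "fst ` J1" X' "snd ` J2" Y' p q])
    have "fst ` M \<subseteq> X" "snd ` M \<subseteq> Y" using MAB AB by auto
    then show "fst ` J1 \<subseteq> X" "snd ` J2 \<subseteq> Y" using J1M by blast+
    show "X' \<subseteq> X" "Y' \<subseteq> Y" using XY' sub1 by auto
    show "fst ` J1 \<inter> X' = {}" "snd ` J2 \<inter> Y' = {}" 
      using XY'(1,2) J1M(1,2) unfolding X1_def Y1_def by blast+
    have "card (fst ` J1) = card J1" "card (snd ` J2) = card J2"
      using M(3,4) J1M by (auto intro!: card_image inj_on_subset[of _ M])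
    then show "card (verts G) \<le> card (fst ` J1)" "card (verts G) \<le> card (snd ` J2)" using J1(2) J2(2) by auto
    show "card (verts G) \<le> card X'" "card (verts G) \<le> card Y'" using XY' by auto
    show "fst ` J1 \<times> Y' \<subseteq> F" using XY'(2) unfolding Y1_def Y0_def by auto
    show "X' \<times> snd ` J2 \<subseteq> F" using XY'(1) unfolding X1_def X0_def by auto
    show "X' \<times> Y' \<subseteq> F" using XY'(5) unfolding E_def by auto
  next
    fix x assume "x \<in> fst ` J1"
    then obtain a where a: "a \<in> J1" "x = fst a" by auto
    have aM: "a \<in> M" using a J1M by auto
    have "snd a \<notin> snd ` J2"
    proof
      assume "snd a \<in> snd ` J2"
      then obtain b where "b \<in> J2" "snd a = snd b" by auto
      then have "a = b" using M(4) aM J1M by (meson inj_onD subsetD)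
      then show False using a \<open>b \<in> J2\<close> J1M by auto
    qed
    moreover have "snd a \<notin> Y'" using XY'(2) aM unfolding Y1_def by auto
    ultimately show "(x, p x) \<in> F \<and> \<zeta> x (p x) = z \<and> p x \<notin> snd ` J2 \<union> Y'"
      using pM[OF aM] MAB[OF aM] M(5)[of "fst a" "snd a"] aM a(2) by simp
  next
    fix y assume "y \<in> snd ` J2"
    then obtain a where a: "a \<in> J2" "y = snd a" by auto
    have aM: "a \<in> M" using a J1M by auto
    have "fst a \<notin> fst ` J1"
    proof
      assume "fst a \<in> fst ` J1"
      then obtain b where "b \<in> J1" "fst a = fst b" by auto
      then have "a = b" using M(3) aM J1M by (meson inj_onD subsetD)
      then show False using a \<open>b \<in> J1\<close> J1M by auto
    qed
    moreover have "fst a \<notin> X'" using XY'(1) aM unfolding X1_def by auto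
    ultimately show "(q y, y) \<in> F \<and> \<zeta> (q y) y = z \<and> q y \<notin> fst ` J1 \<union> X'"
      using qM[OF aM] MAB[OF aM] M(5)[of "fst a" "snd a"] aM a(2) by simp
  qed
qed

end

lemma dense_tripartite_system_not_berge_free:
  fixes G :: "'a hypergraph" and c :: real
  assumes G: "simple_graph G" "triangle_free G" "condition2 G"
    and v: "bipartite (delete_vertex G v)" "v \<in> verts G" and c: "0 < c" "c \<le> 1"
  shows "\<exists>N. \<forall>(H :: 'b hypergraph) X Y Z F \<zeta> n. tripartite_system H X Y Z F \<zeta> \<and> real (card X) \<le> n \<and>
    real (card Y) \<le> n \<and> real (card Z) \<le> n \<and> c * n\<^sup>2 \<le> real (card F) \<and> N \<le> n \<longrightarrow> \<not> berge_free G H"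
proof -
  define m where "m = card (verts G)"
  \<comment> \<open>Degrees in the regular pair have relative size at least \<open>c / 2\<close>, so
    \<open>common_neighbourhood\<close> finds \<open>m\<close> suitable vertices among
    \<open>k\<close> if \<open>m \<le> c / 4 * k\<close>.\<close>
  define k where "k = nat \<lceil>4 * real m / c\<rceil> + 1"
  have k: "real m \<le> c / 4 * real k" "0 < k"
  proof -
    have "4 * real m / c \<le> real k" unfolding k_def by linarith
    then show "real m \<le> c / 4 * real k" using c by (simp add: field_simps)
  qed (simp add: k_def)
  \<comment> \<open>This is the relative size of the common neighbourhoods obtained from
    \<open>k\<close> vertices.\<close>
  define \<gamma> where "\<gamma> = c / 4 / 2 ^ k"
  have "\<gamma> \<le> c / 4 / 1" unfolding \<gamma>_def using c by (intro divide_left_mono) auto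
  then have \<gamma>: "\<gamma> \<le> 1" using c by linarith
  have \<gamma>0: "0 < \<gamma>" unfolding \<gamma>_def using c by simp
  obtain \<rho> \<sigma> where \<rho>: "0 < \<rho>" and \<sigma>: "0 < \<sigma>"
    and reg: "\<forall>(X :: 'b set) (Y :: 'b set) F n. finite X \<and> finite Y \<and> F \<subseteq> X \<times> Y \<and>
    real (card X) \<le> n \<and> real (card Y) \<le> n \<and> 0 < n \<and> c * n\<^sup>2 \<le> real (card F) \<longrightarrow>
    (\<exists>A\<subseteq>X. \<exists>B\<subseteq>Y. lower_regular F A B c \<gamma> \<rho> \<and> \<sigma> * n\<^sup>2 \<le> real (card (F \<inter> A \<times> B)))"
    using ex_lower_regular_pair[OF c(1) \<gamma>0 \<gamma>] by (elim exE conjE) (rule that)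
  \<comment> \<open>The greedy matching of size \<open>2 * k\<close> at maximum degree
    \<open>\<delta> * n\<close> needs more than
    \<open>4 * k * \<delta> * n = \<sigma> / 4 * n\<close> pairs; the link found below has at least
    \<open>\<sigma> / 2 * n\<close>.\<close>
  define \<delta> where "\<delta> = \<sigma> / (16 * real k)"
  have \<delta>: "0 < \<delta>" unfolding \<delta>_def using \<sigma> k by simp
  have b1: "0 < \<sigma> / 4 * \<delta>" using \<sigma> \<delta> by simp
  obtain K1 where K1: "\<forall>(P :: ('b \<times> 'b) set) (Q :: 'b set) E M N. finite P \<and> finite Q \<and> real (card P) \<le> M \<and>
    real (card Q) \<le> N \<and> E \<subseteq> P \<times> Q \<and> \<sigma> / 4 * \<delta> * M * N \<le> real (card E) \<and> K1 \<le> M \<and> K1 \<le> N \<longrightarrow>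
    (\<exists>A\<subseteq>P. \<exists>B\<subseteq>Q. card A = (2 * m + 1)\<^sup>2 \<and> card B = (2 * m + 1)\<^sup>2 \<and> A \<times> B \<subseteq> E)"
    using kovari_sos_turan[OF b1, of "(2 * m + 1)\<^sup>2"] by (rule exE)
  \<comment> \<open>Splits the conjunctive premise into separate ones, the form in which the
    embedding lemmas expect it.\<close>
  note kst1 = K1[rule_format, OF conjI[OF _ conjI[OF _ conjI[OF _ conjI[OF _ conjI[OF _ conjI[OF _ conjI]]]]]]]
  have b2: "0 < \<rho> * \<sigma> / 2" using \<rho> \<sigma> by simp
  obtain K2 where K2: "\<forall>(P :: 'b set) (Q :: 'b set) E M N. finite P \<and> finite Q \<and> real (card P) \<le> M \<and>
    real (card Q) \<le> N \<and> E \<subseteq> P \<times> Q \<and> \<rho> * \<sigma> / 2 * M * N \<le> real (card E) \<and> K2 \<le> M \<and> K2 \<le> N \<longrightarrow>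
    (\<exists>A\<subseteq>P. \<exists>B\<subseteq>Q. card A = m \<and> card B = m \<and> A \<times> B \<subseteq> E)"
    using kovari_sos_turan[OF b2, of m] by (rule exE)
  note kst2 = K2[rule_format, OF conjI[OF _ conjI[OF _ conjI[OF _ conjI[OF _ conjI[OF _ conjI[OF _ conjI]]]]]]]
  define N where "N = max 1 (max K1 (max (\<delta> * K1) (max K2 (8 * real k / (\<rho> * \<sigma>)))))"
  have main: "\<not> berge_free G H"
    if T: "tripartite_system H X Y Z F \<zeta>" and n: "real (card X) \<le> n" "real (card Y) \<le> n" "real (card Z) \<le> n"
      and dens: "c * n\<^sup>2 \<le> real (card F)" and N: "N \<le> n" for H :: "'b hypergraph" and X Y Z F \<zeta> n
  proof -
    interpret tripartite_system H X Y Z F \<zeta> by (rule T)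
    have N': "1 \<le> n" "K1 \<le> n" "\<delta> * K1 \<le> n" "K2 \<le> n" "8 * real k / (\<rho> * \<sigma>) \<le> n" using N unfolding N_def by auto
    have n0: "0 < n" using N' by simp
    have K1\<delta>: "K1 \<le> n / \<delta>" using N'(3) \<delta> by (simp add: pos_le_divide_eq mult.commute)
    have finF: "finite F" using F fin by (meson finite_SigmaI finite_subset)
    obtain A B where AB: "A \<subseteq> X" "B \<subseteq> Y" "lower_regular F A B c \<gamma> \<rho>" "\<sigma> * n\<^sup>2 \<le> real (card (F \<inter> A \<times> B))"
      using reg[rule_format, of X Y F n] fin F n n0 dens by blast
    define Dx where "Dx = {(x, y) \<in> F \<inter> A \<times> B. \<delta> * n \<le> real (card {y' \<in> Y. (x, y') \<in> F \<and> \<zeta> x y' = \<zeta> x y})}"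
    define Dy where "Dy = {(x, y) \<in> F \<inter> A \<times> B. \<delta> * n \<le> real (card {x' \<in> X. (x', y) \<in> F \<and> \<zeta> x' y = \<zeta> x y})}"
    have sub_D: "Dx \<subseteq> F \<inter> A \<times> B" "Dy \<subseteq> F \<inter> A \<times> B" unfolding Dx_def Dy_def by auto
    show ?thesis
    proof (cases "\<sigma> / 4 * n\<^sup>2 \<le> real (card Dx)")
      case True
      have "Dx \<subseteq> F" using sub_D by blast
      moreover have "\<delta> * n \<le> real (card {y' \<in> Y. (x, y') \<in> F \<and> \<zeta> x y' = \<zeta> x y})" if "(x, y) \<in> Dx" for x y
        using that unfolding Dx_def by auto
      ultimately show ?thesis
        by (intro not_berge_free_heavy[OF G v n(1,2) n0 _ True \<delta> _ _ N'(2) K1\<delta>])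
          (use kst1 in \<open>simp_all add: m_def\<close>)
    next
      case nx: False
      show ?thesis
      proof (cases "\<sigma> / 4 * n\<^sup>2 \<le> real (card Dy)")
        case True
        have D: "Dy\<inverse> \<subseteq> F\<inverse>" "\<sigma> / 4 * n\<^sup>2 \<le> real (card (Dy\<inverse>))" using sub_D True by (auto simp: card_inverse)
        have "\<delta> * n \<le> real (card {x' \<in> X. (y, x') \<in> F\<inverse> \<and> \<zeta> x' y = \<zeta> x y})" if "(y, x) \<in> Dy\<inverse>" for x y
          using that unfolding Dy_def by auto
        then show ?thesis
          by (intro tripartite_system.not_berge_free_heavy[OF swap G v n(2,1) n0 D \<delta> _ _ N'(2) K1\<delta>])
            (use kst1 in \<open>simp_all add: m_def\<close>)
      next
        case ny: False
        \<comment> \<open>Each heavy set has fewer than \<open>\<sigma> / 4 * n ^ 2\<close> pairs,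
          so at least \<open>\<sigma> / 2 * n ^ 2\<close> light pairs remain.\<close>
        define L0 where "L0 = F \<inter> A \<times> B - (Dx \<union> Dy)"
        have finL0: "finite L0" unfolding L0_def using finF by blast
        have "F \<inter> A \<times> B \<subseteq> L0 \<union> (Dx \<union> Dy)" unfolding L0_def by auto
        then have "card (F \<inter> A \<times> B) \<le> card (L0 \<union> (Dx \<union> Dy))"
          using finL0 sub_D finF by (intro card_mono) (auto intro: finite_subset)
        also have "\<dots> \<le> card L0 + (card Dx + card Dy)" by (meson add_left_mono card_Un_le le_trans)
        finally have "real (card (F \<inter> A \<times> B)) \<le> real (card L0) + (real (card Dx) + real (card Dy))" by linarith
        then have cL0: "\<sigma> / 2 * n\<^sup>2 \<le> real (card L0)" using nx ny AB(4) by linarith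
        have "0 < \<sigma> / 2 * n\<^sup>2" using \<sigma> n0 by simp
        then have "card L0 \<noteq> 0" using cL0 by linarith
        then have "L0 \<noteq> {}" by auto
        moreover have img: "(\<lambda>(x, y). \<zeta> x y) ` L0 \<subseteq> Z" using \<zeta> unfolding L0_def by auto
        ultimately have "Z \<noteq> {}" by blast
        \<comment> \<open>There are at most \<open>n\<close> third vertices, so some
          \<open>z\<close> serves at least \<open>\<sigma> / 2 * n\<close> light pairs; lightness
          bounds the degrees in its link.\<close>
        then obtain z where z: "z \<in> Z" "card L0 \<le> card Z * card {p \<in> L0. (\<lambda>(x, y). \<zeta> x y) p = z}"
          using pigeonhole_fibre[OF finL0 fin(3) _ img] by blast
        define L where "L = {p \<in> L0. (\<lambda>(x, y). \<zeta> x y) p = z}"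
        have finL: "finite L" unfolding L_def using finL0 by simp
        have "real (card L0) \<le> real (card Z * card L)" using z(2) unfolding L_def by (rule of_nat_mono)
        also have "\<dots> \<le> n * real (card L)" using n(3) by (simp add: mult_right_mono)
        finally have "n * (\<sigma> / 2 * n) \<le> n * real (card L)" using cL0 by (simp add: power2_eq_square mult.left_commute)
        then have cL: "\<sigma> / 2 * n \<le> real (card L)" using n0 by simp
        have LF: "(x, y) \<in> F \<and> (x, y) \<in> A \<times> B \<and> \<zeta> x y = z \<and> (x, y) \<notin> Dx \<and> (x, y) \<notin> Dy" if "(x, y) \<in> L" for x y
          using that unfolding L_def L0_def by auto
        have dx: "real (card {y'. (x, y') \<in> L}) \<le> \<delta> * n" if xy: "(x, y) \<in> L" for x y
        proof -
          have "card {y'. (x, y') \<in> L} \<le> card {y' \<in> Y. (x, y') \<in> F \<and> \<zeta> x y' = \<zeta> x y}"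
            using LF[OF xy] LF[of x] F fin by (intro card_mono) auto
          moreover have "real (card {y' \<in> Y. (x, y') \<in> F \<and> \<zeta> x y' = \<zeta> x y}) < \<delta> * n"
            using LF[OF xy] unfolding Dx_def by auto
          ultimately show ?thesis by linarith
        qed
        have dy: "real (card {x'. (x', y) \<in> L}) \<le> \<delta> * n" if xy: "(x, y) \<in> L" for x y
        proof -
          have "card {x'. (x', y) \<in> L} \<le> card {x' \<in> X. (x', y) \<in> F \<and> \<zeta> x' y = \<zeta> x y}"
            using LF[OF xy] LF[of _ y] F fin by (intro card_mono) auto
          moreover have "real (card {x' \<in> X. (x', y) \<in> F \<and> \<zeta> x' y = \<zeta> x y}) < \<delta> * n"
            using LF[OF xy] unfolding Dy_def by auto
          ultimately show ?thesis by linarith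
        qed
        have "2 * (\<delta> * n) * real (2 * k) = \<sigma> / 4 * n" unfolding \<delta>_def using k(2) by simp
        also have "\<dots> < \<sigma> / 2 * n" using \<sigma> n0 by simp
        finally have "2 * (\<delta> * n) * real (2 * k) < real (card L)" using cL by linarith
        then have "\<exists>M\<subseteq>L. card M = 2 * k \<and> inj_on fst M \<and> inj_on snd M"
          using \<delta> n0 dx dy by (intro ex_matching_of_bounded_degree[OF finL, of "\<delta> * n"]) simp_all
        then obtain M where M: "M \<subseteq> L" "card M = 2 * k" "inj_on fst M" "inj_on snd M" by blast
        have kn: "4 * real k \<le> \<rho> * \<sigma> / 2 * n" using N'(5) \<rho> \<sigma> by (simp add: field_simps)
        have MF: "M \<subseteq> F \<inter> A \<times> B" using M(1) LF by auto
        have Mz: "\<zeta> x y = z" if "(x, y) \<in> M" for x y using M(1) LF that by blast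
        show ?thesis
          by (rule not_berge_free_link_matching[OF G(1,2) v n(1,2) n0 c(1) k(1)[unfolded m_def] k(2) \<rho> AB(1,2)
              AB(3)[unfolded \<gamma>_def] AB(4) MF M(2-4) Mz kst2[unfolded m_def] N'(4) kn])
      qed
    qed
  qed
  show ?thesis by (rule exI[of _ N], intro allI impI, elim conjE) (rule main)
qed

text \<open>Fix a triple over each shadow edge and order its vertices. A uniformly random
  3-colouring gives them the colours 0, 1, 2 in this order with probability 1/27, so some colouring
  does so for at least 1/27 of the shadow edges.\<close>

lemma ex_tripartite_system:
  fixes H :: "'b hypergraph"
  assumes H: "uniform 3 H"
  shows "\<exists>X Y Z F \<zeta>. tripartite_system H X Y Z F \<zeta> \<and> card (edges (shadow H)) \<le> 27 * card F"
proof -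
  define V where "V = verts H"
  define E where "E = edges (shadow H)"
  have finV: "finite V" and hyp: "hypergraph H" using H unfolding uniform_def hypergraph_def V_def by auto
  have finE: "finite E" unfolding E_def by (rule uniform_finite_shadow(1)[OF H])
  have "\<exists>u v w. e = {u, v} \<and> u \<noteq> v \<and> w \<noteq> u \<and> w \<noteq> v \<and> {u, v, w} \<in> edges H \<and> {u, v, w} \<subseteq> V" if eE: "e \<in> E" for e
  proof -
    have "card e = 2" using uniform_finite_shadow(2)[OF H] eE unfolding E_def by blast
    then obtain u v where uv: "e = {u, v}" "u \<noteq> v" by (meson card_2_iff)
    then obtain h where h: "h \<in> edges H" "{u, v} \<subseteq> h" using eE unfolding E_def by (metis mem_shadow_iff)
    have "card h = 3" "h \<subseteq> V" using h H unfolding uniform_def hypergraph_def V_def by auto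
    then have "card (h - {u, v}) = 1" using uv h by (simp add: card_Diff_subset)
    then obtain w where w: "h - {u, v} = {w}" by (auto simp: card_1_singleton_iff)
    then have "h = {u, v, w}" "w \<noteq> u" "w \<noteq> v" using h(2) by auto
    then show ?thesis using uv h \<open>h \<subseteq> V\<close> by metis
  qed
  then obtain u v w where uvw: "\<And>e. e \<in> E \<Longrightarrow> e = {u e, v e} \<and> u e \<noteq> v e \<and> w e \<noteq> u e \<and> w e \<noteq> v e \<and>
      {u e, v e, w e} \<in> edges H \<and> {u e, v e, w e} \<subseteq> V" by metis
  define \<Phi> where "\<Phi> = PiE V (\<lambda>_. {0, 1, 2 :: nat})"
  define good where "good e = {\<phi> \<in> \<Phi>. \<phi> (u e) = 0 \<and> \<phi> (v e) = 1 \<and> \<phi> (w e) = 2}" for e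
  have fin\<Phi>: "finite \<Phi>" unfolding \<Phi>_def using finV by (intro finite_PiE) auto
  have c\<Phi>: "card \<Phi> = 3 ^ card V" unfolding \<Phi>_def using finV by (simp add: card_PiE numeral_3_eq_3)
  have cgood: "27 * card (good e) = 3 ^ card V" if e: "e \<in> E" for e
  proof -
    \<comment> \<open>As a product of ranges, \<open>good e\<close> has three fixed coordinates,
      which gives the factor 27.\<close>
    define B where "B x = (if x = u e then {0} else if x = v e then {1} else if x = w e then {2} else {0, 1, 2 :: nat})" for x
    have ne: "u e \<noteq> v e" "w e \<noteq> u e" "w e \<noteq> v e" and sV: "{u e, v e, w e} \<subseteq> V" using uvw[OF e] by auto
    have "good e = PiE V B"
    proof (intro set_eqI iffI)
      fix \<phi> assume "\<phi> \<in> good e"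
      then have g: "\<phi> \<in> PiE V (\<lambda>_. {0, 1, 2})" "\<phi> (u e) = 0" "\<phi> (v e) = 1" "\<phi> (w e) = 2"
        unfolding good_def \<Phi>_def by auto
      show "\<phi> \<in> PiE V B"
      proof (rule PiE_I)
        show "\<phi> x \<in> B x" if "x \<in> V" for x using PiE_mem[OF g(1) that] g(2-4) unfolding B_def by auto
        show "\<phi> x = undefined" if "x \<notin> V" for x using PiE_arb[OF g(1) that] .
      qed
    next
      fix \<phi> assume \<phi>: "\<phi> \<in> PiE V B"
      have "\<phi> (u e) \<in> B (u e)" "\<phi> (v e) \<in> B (v e)" "\<phi> (w e) \<in> B (w e)" using \<phi> sV by auto
      moreover have "\<phi> \<in> \<Phi>" unfolding \<Phi>_def by (rule subsetD[OF PiE_mono \<phi>]) (auto simp: B_def)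
      ultimately show "\<phi> \<in> good e" unfolding good_def B_def using ne by auto
    qed
    then have "card (good e) = (\<Prod>x\<in>V. card (B x))" using finV by (simp add: card_PiE)
    also have "\<dots> = (\<Prod>x\<in>V - {u e, v e, w e}. card (B x)) * (\<Prod>x\<in>{u e, v e, w e}. card (B x))"
      using sV finV by (rule prod.subset_diff)
    also have "(\<Prod>x\<in>V - {u e, v e, w e}. card (B x)) = (\<Prod>x\<in>V - {u e, v e, w e}. 3)"
      by (rule prod.cong) (auto simp: B_def)
    also have "(\<Prod>x\<in>{u e, v e, w e}. card (B x)) = 1" using ne by (simp add: B_def)
    finally have "card (good e) = 3 ^ card (V - {u e, v e, w e})" by simp
    moreover have "card V = card (V - {u e, v e, w e}) + 3"
    proof -
      have "card {u e, v e, w e} = 3" using ne by auto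
      then show ?thesis using sV finV card_mono[OF finV sV] by (simp add: card_Diff_subset)
    qed
    ultimately show ?thesis by (simp add: power_add)
  qed
  have "\<exists>\<phi>\<in>\<Phi>. card E \<le> 27 * card {e \<in> E. \<phi> \<in> good e}"
  proof (rule ccontr)
    assume no: "\<not> ?thesis"
    have ne: "\<Phi> \<noteq> {}" using c\<Phi> by auto
    have "(\<Sum>\<phi>\<in>\<Phi>. 27 * card {e \<in> E. \<phi> \<in> good e}) < (\<Sum>\<phi>\<in>\<Phi>. card E)"
      by (rule sum_strict_mono[OF fin\<Phi> ne]) (use no in auto)
    moreover have "(\<Sum>\<phi>\<in>\<Phi>. card {e \<in> E. \<phi> \<in> good e}) = (\<Sum>e\<in>E. card {\<phi> \<in> \<Phi>. \<phi> \<in> good e})"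
      using sum.swap_restrict[of \<Phi> E "\<lambda>_ _. 1::nat" "\<lambda>\<phi> e. \<phi> \<in> good e"] fin\<Phi> finE by simp
    moreover have "{\<phi> \<in> \<Phi>. \<phi> \<in> good e} = good e" for e unfolding good_def by auto
    moreover have "(\<Sum>e\<in>E. 27 * card (good e)) = (\<Sum>e\<in>E. 3 ^ card V)" using cgood by (intro sum.cong) auto
    ultimately show False using c\<Phi> by (simp add: mult.commute flip: sum_distrib_left sum_distrib_right)
  qed
  then obtain \<phi> where \<phi>: "card E \<le> 27 * card {e \<in> E. \<phi> \<in> good e}" by blast
  define E' where "E' = {e \<in> E. \<phi> \<in> good e}"
  define X Y Z where "X = {x \<in> V. \<phi> x = 0}" and "Y = {x \<in> V. \<phi> x = 1}" and "Z = {x \<in> V. \<phi> x = 2}"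
  define F where "F = (\<lambda>e. (u e, v e)) ` E'"
  have "inj_on (\<lambda>e. (u e, v e)) E'"
  proof (rule inj_onI)
    fix e e' assume "e \<in> E'" "e' \<in> E'" "(u e, v e) = (u e', v e')"
    moreover from this have "e = {u e, v e}" "e' = {u e', v e'}" using uvw unfolding E'_def by blast+
    ultimately show "e = e'" by simp
  qed
  then have cF: "card F = card E'" unfolding F_def by (rule card_image)
  have "tripartite_system H X Y Z F (\<lambda>x y. w {x, y})"
  proof
    fix x y assume "(x, y) \<in> F"
    then obtain e where e: "e \<in> E'" "x = u e" "y = v e" unfolding F_def by auto
    then have "{x, y} = e" using uvw[of e] unfolding E'_def by auto
    then show "w {x, y} \<in> Z \<and> {x, y, w {x, y}} \<in> edges H"
      using uvw[of e] e unfolding E'_def Z_def good_def by auto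
  next
    show "F \<subseteq> X \<times> Y" unfolding F_def X_def Y_def E'_def good_def using uvw by auto
  qed (auto simp: hyp X_def Y_def Z_def V_def)
  moreover have "card (edges (shadow H)) \<le> 27 * card F" using \<phi> cF unfolding E'_def E_def by simp
  ultimately show ?thesis by (intro exI conjI)
qed

section \<open>Density zero and the final case distinction\<close>

lemma pi_hat_le_zero:
  assumes G: "simple_graph G" and cond: "condition1 G" "condition2 G"
  shows "pi_hat 3 G \<le> ereal 0"
proof (rule pi_hat_le)
  obtain v where G': "triangle_free G" and v: "bipartite (delete_vertex G v)" "v \<in> verts G"
    using cond(1) unfolding condition1_def by blast
  fix \<epsilon> :: real assume \<epsilon>: "\<epsilon> > 0"
  \<comment> \<open>The number 108 combines the 27 of \<open>ex_tripartite_system\<close>, the 2 in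
    the binomial coefficient, and a 2 from \<open>n - 1 \<ge> n / 2\<close>.\<close>
  define c where "c = min 1 (\<epsilon> / 108)"
  have c: "0 < c" "c \<le> 1" "c \<le> \<epsilon> / 108" unfolding c_def using \<epsilon> by auto
  obtain N where N: "\<forall>(H :: nat hypergraph) X Y Z F \<zeta> n. tripartite_system H X Y Z F \<zeta> \<and> real (card X) \<le> n \<and>
    real (card Y) \<le> n \<and> real (card Z) \<le> n \<and> c * n\<^sup>2 \<le> real (card F) \<and> N \<le> n \<longrightarrow> \<not> berge_free G H"
    using dense_tripartite_system_not_berge_free[OF G G' cond(2) v c(1,2)] by (rule exE)
  show "\<exists>N. \<forall>H :: nat hypergraph. uniform 3 H \<and> card (verts H) \<ge> N \<and> berge_free G H \<longrightarrow>
    real (card (edges (shadow H))) \<le> (0 + \<epsilon>) * real (card (verts H) choose 2)"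
  proof (intro exI[of _ "max 2 (nat \<lceil>N\<rceil>)"] allI impI, elim conjE, rule ccontr)
    fix H :: "nat hypergraph" assume H: "uniform 3 H" "card (verts H) \<ge> max 2 (nat \<lceil>N\<rceil>)" "berge_free G H"
      and big: "\<not> real (card (edges (shadow H))) \<le> (0 + \<epsilon>) * real (card (verts H) choose 2)"
    define n where "n = real (card (verts H))"
    have n: "2 \<le> n" "N \<le> n" using H(2) unfolding n_def by linarith+
    obtain X Y Z F \<zeta> where T: "tripartite_system H X Y Z F \<zeta>" and le: "card (edges (shadow H)) \<le> 27 * card F"
      using ex_tripartite_system[OF H(1)] by blast
    interpret tripartite_system H X Y Z F \<zeta> by (rule T)
    have finV: "finite (verts H)" using hyp unfolding hypergraph_def by blast
    have XYZ: "real (card X) \<le> n" "real (card Y) \<le> n" "real (card Z) \<le> n"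
      unfolding n_def using sub finV by (auto intro!: card_mono)
    have "\<epsilon> * (n * (n - 1) / 2) \<le> real (card (edges (shadow H)))"
      using big unfolding real_choose_two n_def by simp
    also have "\<dots> \<le> 27 * real (card F)" using le by linarith
    finally have "\<epsilon> / 54 * (n * (n - 1)) \<le> real (card F)" by simp
    moreover have "n * (n / 2) \<le> n * (n - 1)" using n by (intro mult_left_mono) auto
    then have "\<epsilon> / 54 * (n * (n / 2)) \<le> \<epsilon> / 54 * (n * (n - 1))" 
      using \<epsilon> by (intro mult_left_mono[of "n * (n / 2)"]) auto
    moreover have "c * n\<^sup>2 \<le> \<epsilon> / 108 * n\<^sup>2" using c(3) by (intro mult_right_mono) auto
    ultimately have "c * n\<^sup>2 \<le> real (card F)" by (simp add: power2_eq_square)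
    then have "\<not> berge_free G H" using N T XYZ n(2) by blast
    then show False using H(3) by blast
  qed
qed simp

theorem theorem4:
  fixes G :: "'a hypergraph"
  assumes "simple_graph G" and "verts G \<noteq> {}"
  shows "pi_hat 3 G = ereal
    (if chromatic_number G \<ge> 4 then 1 - 1 / (real (chromatic_number G) - 1)
     else if condition1 G \<and> condition2 G then 0
     else 1 / 2)"
proof (cases "chromatic_number G \<ge> 4")
  case True
  define r where "r = chromatic_number G - 1"
  have r: "r \<ge> 3" "chromatic_number G = Suc r" using True unfolding r_def by auto
  obtain c where "proper_coloring G (Suc r) c" using ex_coloring[OF assms(1)] r by auto
  then have "pi_hat 3 G \<le> ereal (1 - 1 / real r)" using r(1) by (intro pi_hat_le_chromatic[OF assms(1)]) auto
  moreover have "ereal (1 - 1 / real r) \<le> pi_hat 3 G"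
    using r no_coloring[of r G] by (intro pi_hat_ge_multipartite[OF assms(1)]) auto
  ultimately have "pi_hat 3 G = ereal (1 - 1 / real r)" by (rule antisym)
  then show ?thesis using r by simp
next
  case False
  show ?thesis
  proof (cases "condition1 G \<and> condition2 G")
    case True
    then have "pi_hat 3 G = ereal 0"
      using pi_hat_le_zero[OF assms(1)] pi_hat_nonneg[of 3 G] by (intro antisym) (auto simp: zero_ereal_def)
    then show ?thesis using True False by simp
  next
    case ncond: False
    \<comment> \<open>At most three colours are needed, and the chromatic upper bound with
      \<open>r = 2\<close> is \<open>1 / 2\<close>.\<close>
    obtain c where "proper_coloring G (Suc 2) c" using ex_coloring_mono[OF assms(1), of "Suc 2"] False by auto
    then have "pi_hat 3 G \<le> ereal (1 - 1 / real 2)" by (intro pi_hat_le_chromatic[OF assms(1)]) auto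
    moreover have "ereal (1 / 2) \<le> pi_hat 3 G"
    \<comment> \<open>In the first case condition (1) can only fail because no vertex deletion makes
      \<open>G\<close> bipartite, so the cone construction works; otherwise the matching
      construction does.\<close>
    proof (cases "triangle_free G \<and> condition2 G")
      case True
      then have "\<And>v. v \<in> verts G \<Longrightarrow> \<not> bipartite (delete_vertex G v)"
        using ncond unfolding condition1_def by blast
      then show ?thesis by (rule pi_hat_ge_cone[OF assms])
    next
      case False
      then show ?thesis by (intro pi_hat_ge_matching[OF assms(1)]) blast
    qed
    ultimately have "pi_hat 3 G = ereal (1 / 2)" by (intro antisym) auto
    then show ?thesis using ncond False by simp
  qed
qed

end
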